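(* Let $\mathcal{W}$ be a separable Banach space with norm $\|\cdot\|_{\mathcal{W}}$, let $\mu$ be a centered non-degenerate Gaussian measure on $\mathcal{W}$ with Cameron-Martin space $\mathcal{H}_\mu\subseteq\mathcal{W}$, and suppose that $\mathcal{W}$ possesses a Schauder basis $(e_k:k=1,2,\ldots)$ which also forms an orthonormal basis for $\mathcal{H}_\mu$. Then, for any two given starting points $b,\widetilde b\in\mathcal{W}$, it is possible to construct $\mathcal{W}$-valued Brownian motions $\mathbf{B}$ and $\widetilde{\mathbf{B}}$ corresponding to $\mu$ on a common probability space, with $\mathbf{B}(0)=b$ and $\widetilde{\mathbf{B}}(0)=\widetilde b$, such that $$\mathbb{P}\left[\|\mathbf{B}(t)-\widetilde{\mathbf{B}}(t)\|_{\mathcal{W}}\to 0\text{ as }t\to\infty\right]=1 .$$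
   Context: Gaussian measures. A centered Gaussian measure $\mu$ on a separable real Banach space $\mathcal{W}$ is a Borel probability measure whose push-forward $\ell\#\mu$ under every $\ell\in\mathcal{W}^*$ is a mean-zero Gaussian measure on $\mathbb{R}$; it is non-degenerate if $\ell\#\mu$ is non-degenerate for every $\ell\neq 0$. Its covariance is $\mathrm{Cov}_\mu(\ell_1,\ell_2)=\int_{\mathcal{W}}\ell_1(w)\ell_2(w)\,\mu(dw)$ for $\ell_1,\ell_2\in\mathcal{W}^*$. Cameron-Martin space. Let $\mathring{\mathcal{H}}_\mu$ be the set of $h\in\mathcal{W}$ for which there is $h^*\in\mathcal{W}^*$ with $\mathrm{Cov}_\mu(h^*,\ell)=\ell(h)$ for all $\ell\in\mathcal{W}^*$, with inner product $\langle h,k\rangle_{\mathcal{H}_\mu}=\mathrm{Cov}_\mu(h^*,k^* )$. The Cameron-Martin space $\mathcal{H}_\mu$ is its Hilbert-space completion, which embeds continuously, injectively and densely in $\mathcal{W}$ and is identified with a subset of $\mathcal{W}$. Brownian motion. A $\mathcal{W}$-valued Brownian motion corresponding to $\mu$ is a $\mathcal{W}$-valued process with continuous sample paths and stationary Gaussian increments independent of the past, where $\mathbf{B}(t)-\mathbf{B}(s)$ (for $s<t$) has the law of $\sqrt{t-s}\,Z$ with $Z\sim\mu$. Schauder basis. A sequence $(e_k)_{k\ge1}$ in $\mathcal{W}$ such that each $x\in\mathcal{W}$ has a unique expansion $x=\sum_{k=1}^\infty\alpha_k e_k$ with $\alpha_k\in\mathbb{R}$, the ordered partial sums converging in $\|\cdot\|_{\mathcal{W}}$.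 *)

theory Defs
  imports "HOL-Probability.Probability"
begin

text \<open>A separable real Banach space is a type of sort
  \<open>{banach, second_countable_topology}\<close>; its dual is \<open>'w \<Rightarrow>\<^sub>L real\<close>.\<close>

text \<open>Mean-zero Gaussian laws on the line, the point mass at 0 (variance 0) included.\<close>

definition centered_gaussian_real :: "real measure \<Rightarrow> bool" where
  "centered_gaussian_real \<nu> \<longleftrightarrow>
     \<nu> = return borel 0 \<or> (\<exists>\<sigma>>0. \<nu> = density lborel (normal_density 0 \<sigma>))"

definition centered_gaussian_measure ::
    "'w::{banach, second_countable_topology} measure \<Rightarrow> bool" where
  "centered_gaussian_measure \<mu> \<longleftrightarrow>
     prob_space \<mu> \<and> sets \<mu> = sets borel \<and>
     (\<forall>l :: 'w \<Rightarrow>\<^sub>L real. centered_gaussian_real (distr \<mu> borel (blinfun_apply l)))"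

definition nondegenerate_gaussian ::
    "'w::{banach, second_countable_topology} measure \<Rightarrow> bool" where
  "nondegenerate_gaussian \<mu> \<longleftrightarrow>
     (\<forall>l :: 'w \<Rightarrow>\<^sub>L real. l \<noteq> 0 \<longrightarrow> distr \<mu> borel (blinfun_apply l) \<noteq> return borel 0)"

definition Cov :: "'w::{banach, second_countable_topology} measure \<Rightarrow>
    ('w \<Rightarrow>\<^sub>L real) \<Rightarrow> ('w \<Rightarrow>\<^sub>L real) \<Rightarrow> real" where
  "Cov \<mu> l1 l2 = (\<integral>w. blinfun_apply l1 w * blinfun_apply l2 w \<partial>\<mu>)"


text \<open>The pre-Hilbert space \<open>cm_pre \<mu>\<close>. The functional \<open>cm_dual \<mu> h\<close> is the \<open>h\<^sup>*\<close> with
  \<open>Cov \<mu> h\<^sup>* l = l h\<close> for all \<open>l\<close>; it is meaningful for \<open>h \<in> cm_pre \<mu>\<close> only,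
  and is unique there when \<open>\<mu>\<close> is a non-degenerate Gaussian measure.\<close>

definition cm_pre :: "'w::{banach, second_countable_topology} measure \<Rightarrow> 'w set" where
  "cm_pre \<mu> = {h. \<exists>h'. \<forall>l. Cov \<mu> h' l = blinfun_apply l h}"

definition cm_dual :: "'w::{banach, second_countable_topology} measure \<Rightarrow>
    'w \<Rightarrow> ('w \<Rightarrow>\<^sub>L real)" where
  "cm_dual \<mu> h = (SOME h'. \<forall>l. Cov \<mu> h' l = blinfun_apply l h)"

definition cm_pre_inner :: "'w::{banach, second_countable_topology} measure \<Rightarrow>
    'w \<Rightarrow> 'w \<Rightarrow> real" where
  "cm_pre_inner \<mu> h k = Cov \<mu> (cm_dual \<mu> h) (cm_dual \<mu> k)"

definition cm_pre_norm :: "'w::{banach, second_countable_topology} measure \<Rightarrow>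
    'w \<Rightarrow> real" where
  "cm_pre_norm \<mu> h = sqrt (cm_pre_inner \<mu> h h)"


text \<open>The completion, realised inside \<open>'w\<close>. A point of the abstract completion is a class of
  \<open>cm_pre_norm\<close>-Cauchy sequences in \<open>cm_pre \<mu>\<close>. Such a sequence converges in \<open>'w\<close>
  because the pre-Hilbert space embeds continuously, and by injectivity of the embedding
  of the completion its limit determines the class. So a point of the completion is
  identified with this limit, and the inner product is the limit of the inner products.\<close>

definition cm_approx :: "'w::{banach, second_countable_topology} measure \<Rightarrow>
    (nat \<Rightarrow> 'w) \<Rightarrow> 'w \<Rightarrow> bool" where
  "cm_approx \<mu> X h \<longleftrightarrow>
     (\<forall>n. X n \<in> cm_pre \<mu>) \<and>
     (\<forall>\<epsilon>>0. \<exists>N. \<forall>m\<ge>N. \<forall>n\<ge>N. cm_pre_norm \<mu> (X m - X n) < \<epsilon>) \<and>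
     X \<longlonglongrightarrow> h"

definition cm_space :: "'w::{banach, second_countable_topology} measure \<Rightarrow> 'w set" where
  "cm_space \<mu> = {h. \<exists>X. cm_approx \<mu> X h}"

definition cm_inner :: "'w::{banach, second_countable_topology} measure \<Rightarrow>
    'w \<Rightarrow> 'w \<Rightarrow> real" where
  "cm_inner \<mu> h k = (THE r. \<exists>X Y. cm_approx \<mu> X h \<and> cm_approx \<mu> Y k \<and>
     (\<lambda>n. cm_pre_inner \<mu> (X n) (Y n)) \<longlonglongrightarrow> r)"

definition cm_norm :: "'w::{banach, second_countable_topology} measure \<Rightarrow>
    'w \<Rightarrow> real" where
  "cm_norm \<mu> h = sqrt (cm_inner \<mu> h h)"


text \<open>Basis sequences are indexed from 0.\<close>

definition schauder_basis :: "(nat \<Rightarrow> 'w::real_normed_vector) \<Rightarrow> bool" where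
  "schauder_basis e \<longleftrightarrow> (\<forall>x. \<exists>!\<alpha> :: nat \<Rightarrow> real. (\<lambda>k. \<alpha> k *\<^sub>R e k) sums x)"

definition cm_orthonormal_basis :: "'w::{banach, second_countable_topology} measure \<Rightarrow>
    (nat \<Rightarrow> 'w) \<Rightarrow> bool" where
  "cm_orthonormal_basis \<mu> e \<longleftrightarrow>
     (\<forall>k. e k \<in> cm_space \<mu>) \<and>
     (\<forall>j k. cm_inner \<mu> (e j) (e k) = (if j = k then 1 else 0)) \<and>
     (\<forall>h \<in> cm_space \<mu>. \<forall>\<epsilon>>0. \<exists>g \<in> span (range e). cm_norm \<mu> (h - g) < \<epsilon>)"


text \<open>The past at time \<open>s\<close> is the \<open>\<sigma>\<close>-algebra generated by \<open>B u\<close> for \<open>0 \<le> u \<le> s\<close>.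
  The time set is \<open>{0..}\<close>; values of \<open>B\<close> at negative times play no role.\<close>

definition past_events :: "'p measure \<Rightarrow> (real \<Rightarrow> 'p \<Rightarrow> 'w::topological_space) \<Rightarrow>
    real \<Rightarrow> 'p set set" where
  "past_events M B s =
     sigma_sets (space M) (\<Union>u\<in>{0..s}. {B u -` A \<inter> space M | A. A \<in> sets borel})"

definition increment_events :: "'p measure \<Rightarrow> (real \<Rightarrow> 'p \<Rightarrow> 'w::real_normed_vector) \<Rightarrow>
    real \<Rightarrow> real \<Rightarrow> 'p set set" where
  "increment_events M B s t =
     {(\<lambda>\<omega>. B t \<omega> - B s \<omega>) -` A \<inter> space M | A. A \<in> sets borel}"

definition brownian_motion :: "'w::{banach, second_countable_topology} measure \<Rightarrow>
    'p measure \<Rightarrow> (real \<Rightarrow> 'p \<Rightarrow> 'w) \<Rightarrow> bool" where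
  "brownian_motion \<mu> M B \<longleftrightarrow>
     prob_space M \<and>
     (\<forall>t\<ge>0. B t \<in> borel_measurable M) \<and>
     (\<forall>\<omega> \<in> space M. continuous_on {0..} (\<lambda>t. B t \<omega>)) \<and>
     (\<forall>s t. 0 \<le> s \<and> s < t \<longrightarrow>
        distr M borel (\<lambda>\<omega>. B t \<omega> - B s \<omega>) = distr \<mu> borel (\<lambda>z. sqrt (t - s) *\<^sub>R z)) \<and>
     (\<forall>s t. 0 \<le> s \<and> s < t \<longrightarrow>
        prob_space.indep_set M (past_events M B s) (increment_events M B s t))"


text \<open>HOL cannot quantify existentially over the type of the sample space, so a coupling
  has to live on a fixed type. Paths of pairs lose no generality: two processes \<open>B\<close>, \<open>B'\<close> on a
  probability space over any type become the coordinate processes on the image of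
  \<open>\<omega> \<mapsto> (\<lambda>t. (B t \<omega>, B' t \<omega>))\<close>, with the \<open>\<sigma>\<close>-algebra of all sets whose preimage is measurable
  and the image measure.\<close>

type_synonym 'w path_pair = "real \<Rightarrow> 'w \<times> 'w"

end

theory Submission
  imports Defs
begin

text \<open>The time axis is cut into windows of deterministic lengths \<open>\<rho>\<^sub>n\<^sup>2\<close>. Over each window, a Brownian motion is a
  Gaussian increment plus an independent bridge, built by Levy's series of Schauder functions, and the two motions
  share all bridges, so that their difference is linear on every window. Only the increments are coupled: in the
  window \<open>n\<close>, the first \<open>n\<close> coordinates of the current difference are to be annihilated by a reflection coupling
  in the direction of their projection, which lies in the Cameron-Martin space because \<open>(e\<^sub>k)\<close> is
  orthonormal there. The probability of failure tends to \<open>0\<close> as the length of the window grows, so the lengths can be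
  chosen with summable failure probabilities. By Borel-Cantelli almost surely only finitely many attempts fail, and
  after a success in window \<open>n\<close> the difference is \<open>d - \<Sum>k<n. f\<^sub>k(d) e\<^sub>k\<close> with \<open>d\<close> the initial difference, whatever
  happened before. This tends to \<open>0\<close> because \<open>(e\<^sub>k)\<close> is a Schauder basis.\<close>

section \<open>Coordinate functionals of a Schauder basis\<close>

text \<open>A reflection coupling needs a difference in the Cameron-Martin space, which
  \<open>b - b'\<close> need not be; only its basis projections are sure to lie there. They are
  aimed at with growing \<open>n\<close>, and accepted or not, an attempt moves the difference only
  along the first \<open>n\<close> basis vectors. So failures do no harm beyond the coordinates that
  the next success clears, and summable failure probabilities suffice without any independence
  between the attempts. The current difference is random and unbounded, yet each window length is
  chosen from its law alone. This keeps the coefficients of the series deterministic, and both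
  motions become instances of one Gaussian series with different i.i.d. noises. Laws and
  independence are then read off characteristic functions of linear functionals, for which the basis
  supplies the generators of the Borel sets. Moments of the norm enter twice, through Fernique's
  rotation argument: the second moment gives each functional a representing vector, and the eighth
  makes Levy's series converge uniformly.\<close>

lemma geometric_approximation:
  fixes A :: "'a::real_normed_vector set"
  assumes dense: "\<And>x. norm x < r \<Longrightarrow> x \<in> closure A"
    and r: "0 < r" and x: "norm x < r"
  shows "\<exists>a. (\<forall>j. a j \<in> A) \<and> (\<lambda>j. (1/2)^j *\<^sub>R a j) sums x"
proof -
  have ex: "\<exists>a\<in>A. norm (y - a) < r / 2" if "norm y < r" for y
    using dense[OF that] r by (metis closure_approachable dist_commute dist_norm half_gt_zero)
  define pick where "pick y = (SOME a. a \<in> A \<and> norm (y - a) < r / 2)" for y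
  have pick: "pick y \<in> A \<and> norm (y - pick y) < r / 2" if "norm y < r" for y
    unfolding pick_def by (rule someI_ex) (use ex[OF that] in blast)
  \<comment> \<open>\<open>R j\<close> is the error left after \<open>j\<close> terms, magnified by
    \<open>2 ^ j\<close>. An error below r / 2 is doubled, which brings it back into the ball, as in
    the proof of the open mapping theorem.\<close>
  define R where "R = rec_nat x (\<lambda>_ y. 2 *\<^sub>R (y - pick y))"
  have R0: "R 0 = x" and RS: "R (Suc j) = 2 *\<^sub>R (R j - pick (R j))" for j
    by (simp_all add: R_def)
  have R: "norm (R j) < r" for j
  proof (induction j)
    case (Suc j)
    then show ?case using pick[of "R j"] by (simp add: RS)
  qed (simp add: R0 x)
  have part: "(\<Sum>i<j. (1/2)^i *\<^sub>R pick (R i)) = x - (1/2)^j *\<^sub>R R j" for j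
  proof (induction j)
    case (Suc j)
    have "(1/2)^Suc j *\<^sub>R R (Suc j) = (1/2)^j *\<^sub>R (R j - pick (R j))"
      by (simp add: RS)
    then show ?case using Suc by (simp add: scaleR_diff_right)
  qed (simp add: R0)
  have "(\<lambda>j. (1/2)^j *\<^sub>R R j) \<longlonglongrightarrow> 0"
  proof (rule Lim_null_comparison)
    show "\<forall>\<^sub>F j in sequentially. norm ((1/2)^j *\<^sub>R R j) \<le> (1/2)^j * r"
      using R by (intro always_eventually allI) (simp add: less_imp_le divide_right_mono)
    show "(\<lambda>j. (1/2)^j * r) \<longlonglongrightarrow> 0"
      by (intro tendsto_mult_left_zero LIMSEQ_power_zero) simp
  qed
  then have "(\<lambda>j. \<Sum>i<j. (1/2)^i *\<^sub>R pick (R i)) \<longlonglongrightarrow> x - 0"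
    unfolding part by (intro tendsto_intros)
  then show ?thesis using pick R unfolding sums_def by (intro exI[of _ "\<lambda>i. pick (R i)"]) simp
qed

text \<open>Uniqueness of the expansion makes the coordinates linear; their continuity is Banach's
  theorem. Baire's theorem bounds the partial sums on a dense part of some ball, and successive
  approximation extends the bound to a whole ball around 0.\<close>

theorem schauder_basis_functionals:
  fixes e :: "nat \<Rightarrow> 'w::banach"
  assumes "schauder_basis e"
  obtains f :: "nat \<Rightarrow> 'w \<Rightarrow>\<^sub>L real"
  where "\<And>x. (\<lambda>k. f k x *\<^sub>R e k) sums x" "\<And>j k. f j (e k) = (if j = k then 1 else 0)"
proof -
  have ex1: "\<exists>!\<alpha>. (\<lambda>k. \<alpha> k *\<^sub>R e k) sums x" for x :: 'w
    using assms unfolding schauder_basis_def by blast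
  define c where "c x = (THE \<alpha>. (\<lambda>k. \<alpha> k *\<^sub>R e k) sums x)" for x :: 'w
  have c: "(\<lambda>k. c x k *\<^sub>R e k) sums x" for x
    unfolding c_def by (rule theI'[OF ex1])
  have uniq: "c x = \<alpha>" if "(\<lambda>k. \<alpha> k *\<^sub>R e k) sums x" for x \<alpha>
    using ex1[of x] c[of x] that by blast
  have c_add: "c (x + y) k = c x k + c y k" for x y k
    using fun_cong[OF uniq[of "\<lambda>k. c x k + c y k" "x + y"], of k] sums_add[OF c[of x] c[of y]]
    by (simp add: scaleR_add_left)
  have c_scale: "c (a *\<^sub>R x) k = a * c x k" for a x k
    using fun_cong[OF uniq[of "\<lambda>k. a * c x k" "a *\<^sub>R x"], of k] sums_scaleR_right[OF c[of x], of a]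
    by simp
  have c_e: "c (e j) k = (if k = j then 1 else 0)" for j k
  proof -
    have "(\<lambda>k. (if k = j then 1 else 0) *\<^sub>R e k) sums ((if j = j then 1 else 0) *\<^sub>R e j)"
      using sums_single[of j "\<lambda>k. e k"] by (simp add: if_distrib[of "\<lambda>r. r *\<^sub>R _"] cong: if_cong)
    from fun_cong[OF uniq[OF this[simplified]], of k] show ?thesis by simp
  qed
  have e_nz: "e k \<noteq> 0" for k
  proof
    assume "e k = 0"
    then have "c (0 *\<^sub>R e k) k = 1" using c_e[of k k] by simp
    then show False by (simp add: c_scale del: scaleR_zero_left)
  qed
  define S where "S n x = (\<Sum>k<n. c x k *\<^sub>R e k)" for n x
  have S_lim: "(\<lambda>n. S n x) \<longlonglongrightarrow> x" for x
    using c[of x] unfolding sums_def S_def .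
  have S_add: "S n (x + y) = S n x + S n y" and S_scale: "S n (a *\<^sub>R x) = a *\<^sub>R S n x" for n x y a
    by (simp_all add: S_def c_add c_scale scaleR_add_left sum.distrib scaleR_sum_right)
  have S_diff: "S n (x - y) = S n x - S n y" for n x y
    using S_add[of n x "- 1 *\<^sub>R y"] S_scale[of n "-1" y] by simp
  define A where "A m = {x. \<forall>n. norm (S n x) \<le> real m}" for m
  have A_Un: "(\<Union>m. A m) = UNIV"
  proof -
    have "\<exists>m. x \<in> A m" for x
    proof -
      have "Bseq (\<lambda>n. S n x)" using S_lim[of x] by (intro convergent_imp_Bseq) (auto simp: convergent_def)
      then obtain K where "\<And>n. norm (S n x) \<le> K" unfolding Bseq_def by blast
      moreover obtain m where "K \<le> real m" using real_arch_simple by blast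
      ultimately show ?thesis unfolding A_def by (auto intro: order_trans)
    qed
    then show ?thesis by blast
  qed
  obtain m where m: "interior (closure (A m)) \<noteq> {}"
  proof (rule ccontr)
    assume "\<not> thesis"
    then have "interior (closure (A m)) = {}" for m using that by blast
    then have "euclidean interior_of \<Union>(range (\<lambda>m. closure (A m))) = {}"
      by (intro Baire_category_alt) (auto simp: completely_metrizable_space_euclidean)
    moreover have "\<Union>(range (\<lambda>m. closure (A m))) = UNIV"
      using A_Un closure_subset by blast
    ultimately show False by simp
  qed
  then obtain z r where r: "0 < r" and zr: "ball z r \<subseteq> closure (A m)"
    using mem_interior by blast
  \<comment> \<open>\<open>A m\<close> is symmetric and convex, so half the difference of points
    near \<open>z + x\<close> and \<open>z - x\<close> stays in it. This moves the ball from
    \<open>z\<close> to the origin.\<close>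
  have A_half: "(1/2) *\<^sub>R (x - y) \<in> A m" if "x \<in> A m" "y \<in> A m" for x y
  proof -
    have "norm (S n ((1/2) *\<^sub>R (x - y))) \<le> real m" for n
      using norm_triangle_ineq4[of "S n x" "S n y"] that unfolding A_def S_scale S_diff by simp
        (smt (verit, best))
    then show ?thesis unfolding A_def by blast
  qed
  have cl: "x \<in> closure (A m)" if x: "norm x < r" for x
  proof -
    have "z + x \<in> closure (A m)" "z - x \<in> closure (A m)"
      using x zr by (auto intro!: subsetD[OF zr] simp: dist_norm)
    then obtain p q where p: "\<And>n. p n \<in> A m" "p \<longlonglongrightarrow> z + x" and q: "\<And>n. q n \<in> A m" "q \<longlonglongrightarrow> z - x"
      unfolding closure_sequential by blast
    have "(\<lambda>n. (1/2) *\<^sub>R (p n - q n)) \<longlonglongrightarrow> (1/2) *\<^sub>R ((z + x) - (z - x))"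
      by (intro tendsto_intros p q)
    also have "(1/2) *\<^sub>R ((z + x) - (z - x)) = x"
      by (simp add: algebra_simps flip: scaleR_2)
    finally show ?thesis using A_half[OF p(1) q(1)] unfolding closure_sequential
      by (intro exI[of _ "\<lambda>n. (1/2) *\<^sub>R (p n - q n)"]) simp
  qed
  have bound: "norm (S n x) \<le> 2 * real m" if x: "norm x < r" for n x
  proof -
    obtain a where a: "\<And>j. a j \<in> A m" and sums: "(\<lambda>j. (1/2)^j *\<^sub>R a j) sums x"
      using geometric_approximation[OF cl r x] by blast
    have aS: "norm (S n (a j)) \<le> real m" for n j using a unfolding A_def by blast
    \<comment> \<open>Candidate coordinates of \<open>x\<close>, summed term by term along the
      approximating series. They cannot be identified with \<open>c x\<close> by continuity, which
      is what is being proved; uniqueness of the expansion does it once their partial sums are known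
      to tend to \<open>x\<close>.\<close>
    define d where "d k = (\<Sum>j. (1/2)^j * c (a j) k)" for k
    have geo: "(\<lambda>j. (1/2)^j * K) sums (2 * K)" for K :: real
      using sums_mult2[OF geometric_sums[of "1/2::real"], of K] by simp
    have cbound: "\<bar>c (a j) k\<bar> \<le> 2 * real m / norm (e k)" for j k
    proof -
      have "c (a j) k *\<^sub>R e k = S (Suc k) (a j) - S k (a j)" by (simp add: S_def)
      then have "\<bar>c (a j) k\<bar> * norm (e k) \<le> 2 * real m"
        using norm_triangle_ineq4[of "S (Suc k) (a j)" "S k (a j)"] aS[of "Suc k" j] aS[of k j]
        by (metis (no_types, opaque_lifting) add_mono dual_order.trans mult_2 norm_scaleR)
      then show ?thesis using e_nz[of k] by (simp add: field_simps)
    qed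
    have dsum: "(\<lambda>j. (1/2)^j * c (a j) k) sums d k" for k
      unfolding d_def
    proof (rule summable_sums, rule summable_comparison_test'[where N=0])
      show "summable (\<lambda>j. (1/2)^j * (2 * real m / norm (e k)))" using geo by (rule sums_summable)
      show "norm ((1/2)^j * c (a j) k) \<le> (1/2)^j * (2 * real m / norm (e k))" for j
        using mult_left_mono[OF cbound[of j k], of "(1/2)^j"] by (simp add: abs_mult)
    qed
    define T where "T n = (\<Sum>k<n. d k *\<^sub>R e k)" for n
    have Tsum: "(\<lambda>j. (1/2)^j *\<^sub>R S n (a j)) sums T n" for n
    proof -
      have "(\<lambda>j. \<Sum>k<n. ((1/2)^j * c (a j) k) *\<^sub>R e k) sums T n"
        unfolding T_def by (intro sums_sum sums_scaleR_left dsum)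
      then show ?thesis by (simp add: S_def scaleR_sum_right)
    qed
    have Tb: "norm (T n) \<le> 2 * real m" for n
    proof -
      have "norm (T n) \<le> (\<Sum>j. (1/2)^j * real m)"
        unfolding sums_unique[OF Tsum]
        using aS sums_summable[OF geo] by (intro norm_suminf_le) (auto simp: divide_right_mono)
      then show ?thesis using sums_unique[OF geo, of "real m"] by simp
    qed
    \<comment> \<open>The limits in \<open>n\<close> and in the number of terms may be exchanged
      because \<open>real m\<close> bounds the partial sums of all \<open>a j\<close>
      uniformly.\<close>
    have "T \<longlonglongrightarrow> x"
    proof -
      have "(\<lambda>n. \<Sum>j. (1/2)^j *\<^sub>R S n (a j)) \<longlonglongrightarrow> (\<Sum>j. (1/2)^j *\<^sub>R a j)"
      proof (rule swap_uniform_limit'[where ?f = "\<lambda>N n. \<Sum>j<N. (1/2)^j *\<^sub>R S n (a j)" and ?g = "\<lambda>N. \<Sum>j<N. (1/2)^j *\<^sub>R a j"])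
        show "\<forall>\<^sub>F N in sequentially. ((\<lambda>n. \<Sum>j<N. (1/2)^j *\<^sub>R S n (a j)) \<longlongrightarrow> (\<Sum>j<N. (1/2)^j *\<^sub>R a j)) sequentially"
          by (intro always_eventually allI tendsto_intros S_lim)
        show "(\<lambda>N. \<Sum>j<N. (1/2)^j *\<^sub>R a j) \<longlonglongrightarrow> (\<Sum>j. (1/2)^j *\<^sub>R a j)"
          using sums sums_unique[OF sums] unfolding sums_def by simp
        show "uniform_limit UNIV (\<lambda>N n. \<Sum>j<N. (1/2)^j *\<^sub>R S n (a j)) (\<lambda>n. \<Sum>j. (1/2)^j *\<^sub>R S n (a j)) sequentially"
          using aS sums_summable[OF geo[of "real m"]]
          by (intro Weierstrass_m_test[where M = "\<lambda>j. (1/2)^j * real m"]) (auto simp: divide_right_mono)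
      qed auto
      moreover have "T = (\<lambda>n. \<Sum>j. (1/2)^j *\<^sub>R S n (a j))" using sums_unique[OF Tsum] by (intro ext)
      ultimately show ?thesis using sums_unique[OF sums] by simp
    qed
    then have "c x = d" by (intro uniq) (simp add: sums_def T_def[abs_def])
    then have "S n x = T n" by (simp add: S_def T_def)
    then show ?thesis using Tb by simp
  qed
  have bl: "bounded_linear (S n)" for n
  proof (rule bounded_linear_intro[where K = "4 * real m / r"])
    fix x
    show "norm (S n x) \<le> norm x * (4 * real m / r)"
    proof (cases "x = 0")
      case True then show ?thesis using S_scale[of n 0 x] by simp
    next
      case False
      define t where "t = r / (2 * norm x)"
      have t: "t > 0" using r False by (simp add: t_def)
      have "norm (t *\<^sub>R x) < r" using r False by (simp add: t_def)
      from bound[OF this, of n] have "t * norm (S n x) \<le> 2 * real m" using t by (simp add: S_scale)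
      then show ?thesis using r False by (simp add: t_def field_simps)
    qed
  qed (simp_all add: S_add S_scale)
  \<comment> \<open>A coordinate is a difference of consecutive partial sums, divided by the norm of
    the nonzero \<open>e k\<close>.\<close>
  have blc: "bounded_linear (\<lambda>x. c x k)" for k
  proof -
    have eq: "c x k *\<^sub>R e k = S (Suc k) x - S k x" for x by (simp add: S_def)
    have "bounded_linear (\<lambda>x. c x k *\<^sub>R e k)"
      unfolding eq by (intro bounded_linear_sub bl)
    then obtain K where K: "\<And>x. norm (c x k *\<^sub>R e k) \<le> norm x * K"
      using bounded_linear.bounded by blast
    show ?thesis
      by (rule bounded_linear_intro[where K = "K / norm (e k)"])
        (use K e_nz[of k] in \<open>simp_all add: c_add c_scale field_simps\<close>)
  qed
  show thesis
    by (rule that[of "\<lambda>k. Blinfun (\<lambda>x. c x k)"])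
      (auto simp: bounded_linear_Blinfun_apply[OF blc] c c_e)
qed

section \<open>Characteristic functions determine measures\<close>

text \<open>Levy's uniqueness theorem concerns probability measures. The characteristic function at
  0 yields equal masses, so both measures are normalised by the same constant; the null measure is
  set apart.\<close>

lemma finite_measure_eqI_char:
  fixes M N :: "real measure"
  assumes fin: "finite_measure M" "finite_measure N"
    and sets: "sets M = sets borel" "sets N = sets borel"
    and eq: "\<And>t. (CLINT x|M. iexp (t * x)) = (CLINT x|N. iexp (t * x))"
  shows "M = N"
proof -
  interpret M: finite_measure M by fact
  interpret N: finite_measure N by fact
  have mass: "measure M (space M) = measure N (space N)"
    using eq[of 0] by simp
  define m where "m = measure M (space M)"
  have mN: "measure N (space N) = m" using mass m_def by simp
  have space: "space M = UNIV" "space N = UNIV"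
    using sets[THEN sets_eq_imp_space_eq] by simp_all
  show ?thesis
  proof (cases "m = 0")
    case True
    have "emeasure M A = 0" for A
      using True M.emeasure_eq_measure[of "space M"] emeasure_space[of M A] by (simp add: m_def)
    moreover have "emeasure N A = 0" for A
      using True mN N.emeasure_eq_measure[of "space N"] emeasure_space[of N A] by (simp)
    ultimately show ?thesis
      using sets by (intro measure_eqI) auto
  next
    case False
    then have m: "m > 0" using measure_nonneg[of M "space M"] unfolding m_def by linarith
    define c where "c = 1 / m"
    have c: "c > 0" using m c_def by simp
    let ?D = "\<lambda>M. density M (\<lambda>_::real. ennreal c)"
    have em: "emeasure (?D L) A = ennreal c * emeasure L A" if "A \<in> sets L" for L and A :: "real set"
      using that by (simp add: emeasure_density nn_integral_cmult_indicator)
    have rd: "real_distribution (?D L)"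
      if L: "finite_measure L" "sets L = sets borel" "measure L (space L) = m" for L
    proof -
      interpret L: finite_measure L by fact
      have "emeasure (?D L) (space L) = ennreal c * ennreal m"
        using em[of "space L" L] L.emeasure_eq_measure[of "space L"] L(3) by simp
      also have "\<dots> = 1" using m by (simp add: c_def flip: ennreal_mult)
      finally have "prob_space (?D L)" by (intro prob_spaceI) simp
      then show ?thesis using L(2) by (simp add: real_distribution_def real_distribution_axioms_def)
    qed
    have ch: "char (?D L) t = c * (CLINT x|L. iexp (t * x))" if "sets L = sets borel" for L t
    proof -
      have [measurable_cong]: "sets L = sets borel" by fact
      show ?thesis
        unfolding char_def
        using c by (subst integral_density) (auto simp: scaleR_conv_of_real)
    qed
    have "?D M = ?D N"
    proof (rule Levy_uniqueness)
      show "real_distribution (?D M)" "real_distribution (?D N)"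
        using fin sets mN by (auto intro!: rd simp: m_def)
      show "char (?D M) = char (?D N)" by (intro ext) (simp only: ch sets eq)
    qed
    then have "ennreal c * emeasure M A = ennreal c * emeasure N A" if "A \<in> sets borel" for A
      using em[of A M] em[of A N] sets that by simp
    then have "emeasure M A = emeasure N A" if "A \<in> sets borel" for A
      using that c by (simp add: ennreal_mult_cancel_left)
    then show ?thesis using sets by (intro measure_eqI) auto
  qed
qed

text \<open>Finite measures instead of probability measures, because the relation has to survive
  restriction to an event.\<close>

definition char_eq :: "('a \<Rightarrow> real) set \<Rightarrow> 'a measure \<Rightarrow> 'a measure \<Rightarrow> bool" where
  "char_eq V M N \<longleftrightarrow> finite_measure M \<and> finite_measure N \<and> sets N = sets M \<and>
     (\<forall>v\<in>V. v \<in> borel_measurable M \<and> (CLINT x|M. iexp (v x)) = (CLINT x|N. iexp (v x)))"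

definition linear_closed :: "('a \<Rightarrow> real) set \<Rightarrow> bool" where
  "linear_closed V \<longleftrightarrow> V \<noteq> {} \<and> (\<forall>v\<in>V. \<forall>w\<in>V. (\<lambda>x. v x + w x) \<in> V) \<and> (\<forall>c. \<forall>v\<in>V. (\<lambda>x. c * v x) \<in> V)"

lemma linear_closed_zero: "linear_closed V \<Longrightarrow> (\<lambda>x. 0) \<in> V"
proof -
  assume V: "linear_closed V"
  then obtain v where "v \<in> V" unfolding linear_closed_def by blast
  then have "(\<lambda>x. 0 * v x) \<in> V" using V unfolding linear_closed_def by blast
  then show ?thesis by simp
qed

lemma linear_closed_comb: "linear_closed V \<Longrightarrow> v \<in> V \<Longrightarrow> w \<in> V \<Longrightarrow> (\<lambda>x. a * v x + b * w x) \<in> V"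
  unfolding linear_closed_def by fastforce

section \<open>Trigonometric tilts of a measure\<close>

lemma Re_iexp_tilt:
  "complex_of_real (1 + Re (c * iexp a)) * iexp b =
     iexp b + c / 2 * iexp (a + b) + cnj c / 2 * iexp (- a + b)"
proof -
  have "complex_of_real (Re (c * iexp a)) = (c * iexp a + cnj (c * iexp a)) / 2"
    by (simp only: complex_add_cnj) simp
  also have "cnj (c * iexp a) = cnj c * iexp (- a)"
    by (simp add: exp_cnj)
  finally have *: "complex_of_real (Re (c * iexp a)) = (c * iexp a + cnj c * iexp (-a)) / 2" .
  have **: "iexp (x + y) = iexp x * iexp y" for x y
    by (simp add: exp_add[symmetric] ring_distribs)
  show ?thesis
    unfolding ** unfolding of_real_add of_real_1 * by (simp add: ring_distribs)
qed

lemma (in finite_measure) integrable_iexp_comp: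
  "v \<in> borel_measurable M \<Longrightarrow> complex_integrable M (\<lambda>x. iexp (v x))"
  by (intro integrable_const_bound[where B=1]) auto

text \<open>Densities \<open>1 + Re (c * iexp (v x))\<close> with \<open>cmod c \<le> 1\<close> are nonnegative, so the uniqueness theorem on the line
  applies to them; varying \<open>c\<close> recovers the complex density \<open>iexp (v x)\<close>.\<close>

lemma abs_Re_iexp_le: "norm c \<le> 1 \<Longrightarrow> \<bar>Re (c * iexp a)\<bar> \<le> 1"
  using abs_Re_le_cmod[of "c * iexp a"] by (simp add: norm_mult)

context finite_measure
begin

lemma tilted_finite:
  assumes [measurable]: "v \<in> borel_measurable M" "w \<in> borel_measurable M" and c: "norm c \<le> 1"
  shows "finite_measure (distr (density M (\<lambda>x. ennreal (1 + Re (c * iexp (v x))))) borel w)"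
proof -
  have "1 + Re (c * iexp (v x)) \<le> 2" for x
    using abs_Re_iexp_le[OF c, of "v x"] by linarith
  then have "ennreal (1 + Re (c * iexp (v x))) \<le> ennreal 2" for x
    by (intro ennreal_leI)
  then have "(\<integral>\<^sup>+x. ennreal (1 + Re (c * iexp (v x))) \<partial>M) \<le> (\<integral>\<^sup>+x. ennreal 2 \<partial>M)"
    by (intro nn_integral_mono)
  also have "\<dots> < \<infinity>" by (simp add: emeasure_eq_measure ennreal_mult_less_top)
  finally have "emeasure (density M (\<lambda>x. ennreal (1 + Re (c * iexp (v x))))) (space M) < \<infinity>"
    by (subst emeasure_density) (auto cong: nn_integral_cong)
  then have "finite_measure (density M (\<lambda>x. ennreal (1 + Re (c * iexp (v x)))))"
    by (intro finite_measureI) simp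
  then show ?thesis
    by (rule finite_measure.finite_measure_distr) simp
qed

lemma tilted_char:
  assumes v [measurable]: "v \<in> borel_measurable M" and w [measurable]: "w \<in> borel_measurable M"
    and c: "norm c \<le> 1"
  shows "(CLINT y|distr (density M (\<lambda>x. ennreal (1 + Re (c * iexp (v x))))) borel w. iexp (t * y)) =
    (CLINT x|M. iexp (t * w x)) + c / 2 * (CLINT x|M. iexp (v x + t * w x))
      + cnj c / 2 * (CLINT x|M. iexp (- v x + t * w x))"
proof -
  let ?f = "\<lambda>x. 1 + Re (c * iexp (v x))"
  have nn: "0 \<le> ?f x" for x using abs_Re_iexp_le[OF c, of "v x"] by linarith
  have f [measurable]: "?f \<in> borel_measurable M" by measurable
  have i1: "complex_integrable M (\<lambda>x. iexp (t * w x))"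
    by (intro integrable_iexp_comp) measurable
  have i2: "complex_integrable M (\<lambda>x. c / 2 * iexp (v x + t * w x))"
    by (intro integrable_mult_right integrable_iexp_comp) measurable
  have i3: "complex_integrable M (\<lambda>x. cnj c / 2 * iexp (- v x + t * w x))"
    by (intro integrable_mult_right integrable_iexp_comp) measurable
  have "(CLINT y|distr (density M ?f) borel w. iexp (t * y)) = (CLINT x|density M ?f. iexp (t * w x))"
    by (rule integral_distr) simp_all
  also have "\<dots> = (CLINT x|M. ?f x *\<^sub>R iexp (t * w x))"
    using nn by (intro integral_density) auto
  also have "\<dots> = (CLINT x|M. iexp (t * w x) + c / 2 * iexp (v x + t * w x) + cnj c / 2 * iexp (- v x + t * w x))"
    by (simp only: scaleR_conv_of_real Re_iexp_tilt)
  also have "\<dots> = (CLINT x|M. iexp (t * w x)) + (CLINT x|M. c / 2 * iexp (v x + t * w x))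
      + (CLINT x|M. cnj c / 2 * iexp (- v x + t * w x))"
    by (simp only: Bochner_Integration.integral_add Bochner_Integration.integrable_add i1 i2 i3)
  finally show ?thesis by (simp only: integral_mult_right_zero)
qed

lemma tilted_measure:
  assumes v [measurable]: "v \<in> borel_measurable M" and w [measurable]: "w \<in> borel_measurable M"
    and c: "norm c \<le> 1" and A [measurable]: "A \<in> sets borel"
  defines "B \<equiv> w -` A \<inter> space M"
  shows "measure (distr (density M (\<lambda>x. ennreal (1 + Re (c * iexp (v x))))) borel w) A
    = measure M B + Re (c * (CLINT x|M. indicator B x *\<^sub>R iexp (v x)))"
proof -
  let ?f = "\<lambda>x. 1 + Re (c * iexp (v x))"
  have B [measurable]: "B \<in> sets M" unfolding B_def by (rule measurable_sets[OF w A])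
  have nn: "0 \<le> ?f x" for x using abs_Re_iexp_le[OF c, of "v x"] by linarith
  have le2: "?f x \<le> 2" for x using abs_Re_iexp_le[OF c, of "v x"] by linarith
  have f [measurable]: "?f \<in> borel_measurable M" by measurable
  have i1: "complex_integrable M (\<lambda>x. indicator B x *\<^sub>R iexp (v x))"
    by (intro integrable_const_bound[where B=1] AE_I2) (auto simp: indicator_def)
  have i2: "integrable M (\<lambda>x. indicator B x :: real)"
    by (intro integrable_const_bound[where B=1] AE_I2) (auto simp: indicator_def)
  have i3: "integrable M (\<lambda>x. ?f x * indicator B x)"
  proof (rule integrable_const_bound[where B=2])
    show "AE x in M. norm (?f x * indicator B x) \<le> 2"
      using nn le2 by (intro AE_I2) (auto simp del: plus_complex.sel split: split_indicator)
  qed measurable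
  have "emeasure (distr (density M ?f) borel w) A = emeasure (density M ?f) B"
    unfolding B_def by (subst emeasure_distr) auto
  also have "\<dots> = (\<integral>\<^sup>+x. ennreal (?f x) * indicator B x \<partial>M)"
    by (rule emeasure_density) auto
  also have "\<dots> = (\<integral>\<^sup>+x. ennreal (?f x * indicator B x) \<partial>M)"
    by (intro nn_integral_cong) (auto split: split_indicator)
  also have "\<dots> = ennreal (LINT x|M. ?f x * indicator B x)"
    using nn by (intro nn_integral_eq_integral i3) auto
  finally have "measure (distr (density M ?f) borel w) A = (LINT x|M. ?f x * indicator B x)"
    using nn by (simp add: measure_def integral_nonneg_AE)
  also have "\<dots> = (LINT x|M. indicator B x + Re (c * (indicator B x *\<^sub>R iexp (v x))))"
    by (intro Bochner_Integration.integral_cong) (auto split: split_indicator)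
  also have "\<dots> = (LINT x|M. indicator B x) + (LINT x|M. Re (c * (indicator B x *\<^sub>R iexp (v x))))"
    by (intro Bochner_Integration.integral_add i2 integrable_Re integrable_mult_right i1)
  also have "(LINT x|M. Re (c * (indicator B x *\<^sub>R iexp (v x)))) = Re (CLINT x|M. c * (indicator B x *\<^sub>R iexp (v x)))"
    by (intro integral_Re integrable_mult_right i1)
  also have "(CLINT x|M. c * (indicator B x *\<^sub>R iexp (v x))) = c * (CLINT x|M. indicator B x *\<^sub>R iexp (v x))"
    by (rule integral_mult_right_zero)
  also have "(LINT x|M. indicator B x) = measure M B"
    using sets.sets_into_space[OF B] by (simp add: Int_absorb2)
  finally show ?thesis .
qed

lemma finite_measure_density_indicator:
  "B \<in> sets M \<Longrightarrow> finite_measure (density M (indicator B))"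
  by (intro finite_measureI) (simp add: emeasure_restricted[OF _ sets.top] emeasure_eq_measure)

lemma integral_density_indicator:
  fixes f :: "'a \<Rightarrow> complex"
  assumes [measurable]: "B \<in> sets M" "f \<in> borel_measurable M"
  shows "integral\<^sup>L (density M (indicator B)) f = (\<integral>x. indicator B x *\<^sub>R f x \<partial>M)"
proof -
  have "density M (indicator B) = density M (\<lambda>x. ennreal (indicator B x))"
    by (intro arg_cong2[where f=density] refl) (auto split: split_indicator)
  then show ?thesis by (simp only:) (rule integral_density, auto)
qed

end

text \<open>The images under \<open>w\<close> of the two measures tilted by \<open>v\<close> have
  characteristic functions built from \<open>t * w\<close>, \<open>v + t * w\<close> and
  \<open>- v + t * w\<close>, all in \<open>V\<close>. So these images agree, in particular on
  \<open>A\<close>, and this determines the restricted characteristic function at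
  \<open>v\<close>.\<close>

lemma char_eq_restrict:
  assumes ce: "char_eq V M N" and lin: "linear_closed V" and w: "w \<in> V" and A: "A \<in> sets borel"
  shows "char_eq V (density M (indicator (w -` A \<inter> space M))) (density N (indicator (w -` A \<inter> space M)))"
proof -
  from ce interpret M: finite_measure M unfolding char_eq_def by blast
  from ce interpret N: finite_measure N unfolding char_eq_def by blast
  have setsN: "sets N = sets M" using ce unfolding char_eq_def by blast
  have sp: "space N = space M" using setsN by (rule sets_eq_imp_space_eq)
  have meas: "v \<in> borel_measurable M" if "v \<in> V" for v using ce that unfolding char_eq_def by blast
  have measN: "v \<in> borel_measurable N" if "v \<in> V" for v
    using meas[OF that] measurable_cong_sets[OF setsN refl] by blast
  have eq: "(CLINT x|M. iexp (v x)) = (CLINT x|N. iexp (v x))" if "v \<in> V" for v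
    using ce that unfolding char_eq_def by blast
  let ?B = "w -` A \<inter> space M"
  have B: "?B \<in> sets M" by (rule measurable_sets[OF meas[OF w] A])
  have *: "(CLINT x|M. indicator ?B x *\<^sub>R iexp (v x)) = (CLINT x|N. indicator ?B x *\<^sub>R iexp (v x))" if v: "v \<in> V" for v
  proof -
    have eq': "measure M ?B + Re (c * (CLINT x|M. indicator ?B x *\<^sub>R iexp (v x)))
        = measure N ?B + Re (c * (CLINT x|N. indicator ?B x *\<^sub>R iexp (v x)))" if c: "norm c \<le> 1" for c
    proof -
      have cl: "(\<lambda>x. t * w x) \<in> V" "(\<lambda>x. v x + t * w x) \<in> V" "(\<lambda>x. - v x + t * w x) \<in> V" for t
        using linear_closed_comb[OF lin v w, of 0 t] linear_closed_comb[OF lin v w, of 1 t]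
          linear_closed_comb[OF lin v w, of "-1" t] by simp_all
      have "distr (density M (\<lambda>x. ennreal (1 + Re (c * iexp (v x))))) borel w
          = distr (density N (\<lambda>x. ennreal (1 + Re (c * iexp (v x))))) borel w"
        by (intro finite_measure_eqI_char M.tilted_finite N.tilted_finite)
          (simp_all only: c meas[OF v] meas[OF w] measN[OF v] measN[OF w] sets_distr
             M.tilted_char N.tilted_char eq[OF cl(1)] eq[OF cl(2)] eq[OF cl(3)])
      then show ?thesis
        using M.tilted_measure[OF meas[OF v] meas[OF w] c A] N.tilted_measure[OF measN[OF v] measN[OF w] c A]
        by (simp only: sp)
    qed
    \<comment> \<open>\<open>c = 0\<close> compares the masses; then \<open>c = 1\<close> and
      \<open>c = - \<i>\<close> compare the real and the imaginary parts.\<close>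
    show ?thesis
      using eq'[of 0] eq'[of 1] eq'[of "-\<i>"] by (intro complex_eqI) auto
  qed
  show ?thesis
    unfolding char_eq_def
    using M.finite_measure_density_indicator[OF B] N.finite_measure_density_indicator B setsN meas measN *
    by (auto simp: M.integral_density_indicator N.integral_density_indicator)
qed

section \<open>Cylinder events\<close>

definition cyl_events :: "'a set \<Rightarrow> ('a \<Rightarrow> real) set \<Rightarrow> 'a set set" where
  "cyl_events \<Omega> V = sigma_sets \<Omega> {v -` A \<inter> \<Omega> |v A. v \<in> V \<and> A \<in> sets borel}"

text \<open>Finite intersections of generators form an intersection-stable class, and the inductive
  form lets a measure be restricted by one functional at a time.\<close>

inductive_set cylinders :: "'a set \<Rightarrow> ('a \<Rightarrow> real) set \<Rightarrow> 'a set set" for \<Omega> V where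
  top: "\<Omega> \<in> cylinders \<Omega> V"
| step: "C \<in> cylinders \<Omega> V \<Longrightarrow> w \<in> V \<Longrightarrow> A \<in> sets borel \<Longrightarrow> (w -` A \<inter> \<Omega>) \<inter> C \<in> cylinders \<Omega> V"

lemma cylinders_subset: "C \<in> cylinders \<Omega> V \<Longrightarrow> C \<subseteq> \<Omega>"
  by (induction rule: cylinders.induct) auto

lemma cylinders_Int: "C \<in> cylinders \<Omega> V \<Longrightarrow> D \<in> cylinders \<Omega> V \<Longrightarrow> C \<inter> D \<in> cylinders \<Omega> V"
proof (induction rule: cylinders.induct)
  case top
  then show ?case using cylinders_subset[of D \<Omega> V] by (simp add: Int_absorb1)
next
  case (step C w A)
  then show ?case using cylinders.step[of "C \<inter> D" \<Omega> V w A] by (simp add: Int_assoc)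
qed

lemma cyl_events_eq: "cyl_events \<Omega> V = sigma_sets \<Omega> (cylinders \<Omega> V)"
proof
  show "cyl_events \<Omega> V \<subseteq> sigma_sets \<Omega> (cylinders \<Omega> V)"
    unfolding cyl_events_def
  proof (rule sigma_sets_mono, safe)
    fix v and A :: "real set" assume "v \<in> V" "A \<in> sets borel"
    then have "(v -` A \<inter> \<Omega>) \<inter> \<Omega> \<in> cylinders \<Omega> V"
      by (intro cylinders.intros)
    then show "v -` A \<inter> \<Omega> \<in> sigma_sets \<Omega> (cylinders \<Omega> V)"
      by (intro sigma_sets.Basic) simp
  qed
  have "C \<in> cyl_events \<Omega> V" if "C \<in> cylinders \<Omega> V" for C
    using that
  proof induction
    case top
    show ?case unfolding cyl_events_def by (rule sigma_sets_top)
  next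
    case (step C w A)
    interpret sigma_algebra \<Omega> "cyl_events \<Omega> V"
      unfolding cyl_events_def by (intro sigma_algebra_sigma_sets) auto
    have "w -` A \<inter> \<Omega> \<in> cyl_events \<Omega> V"
      unfolding cyl_events_def using step by (intro sigma_sets.Basic) auto
    then show ?case using step by blast
  qed
  then show "sigma_sets \<Omega> (cylinders \<Omega> V) \<subseteq> cyl_events \<Omega> V"
    unfolding cyl_events_def by (intro sigma_sets_mono) auto
qed

lemma char_eq_cylinder:
  assumes "C \<in> cylinders (space M) V" "char_eq V M N" "linear_closed V"
  shows "C \<in> sets M \<and> char_eq V (density M (indicator C)) (density N (indicator C))"
  using assms(1)
proof induction
  case top
  have sp: "space N = space M" using assms(2) unfolding char_eq_def by (metis sets_eq_imp_space_eq)
  have "density L (indicator (space L)) = L" for L :: "'a measure"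
    by (intro measure_eqI) (auto simp: emeasure_restricted Int_absorb1 sets.sets_into_space)
  from this[of M] this[of N] assms(2) show ?case by (simp add: sp)
next
  case (step C w A)
  let ?B = "w -` A \<inter> space M"
  have wm: "w \<in> borel_measurable M" using step assms(2) unfolding char_eq_def by blast
  have setsN: "sets N = sets M" using assms(2) unfolding char_eq_def by blast
  then have sp: "space N = space M" by (rule sets_eq_imp_space_eq)
  have B: "?B \<in> sets M" using wm step(3) by (rule measurable_sets)
  have C: "C \<in> sets M" using step by blast
  have dd: "density (density L (indicator C)) (indicator ?B) = density L (indicator (?B \<inter> C))" if "sets L = sets M" for L
    using that B C by (subst density_density_eq) (auto intro!: arg_cong2[where f=density] simp: fun_eq_iff split: split_indicator)
  have "char_eq V (density (density M (indicator C)) (indicator ?B)) (density (density N (indicator C)) (indicator ?B))"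
    using char_eq_restrict[OF conjunct2[OF step.IH] assms(3) step(2,3)] by (simp add: sp)
  then show ?case using B C dd[OF refl] dd[OF setsN] by auto
qed

text \<open>The Cramer-Wold principle for the \<sigma>-algebra generated by a linear space of
  functions of any dimension. Cylinders are treated by successive restriction, the rest by Dynkin's
  argument.\<close>

theorem char_eq_cyl_events:
  assumes ce: "char_eq V M N" and lin: "linear_closed V" and C: "C \<in> cyl_events (space M) V"
  shows "measure M C = measure N C"
proof -
  have fin: "finite_measure M" "finite_measure N" and setsN: "sets N = sets M"
    using ce unfolding char_eq_def by blast+
  interpret M: finite_measure M by fact
  interpret N: finite_measure N by fact
  have sp: "space N = space M" using setsN by (rule sets_eq_imp_space_eq)
  have zero: "(\<lambda>x. 0) \<in> V" by (rule linear_closed_zero[OF lin])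
  have eqc: "measure M D = measure N D" if D: "D \<in> cylinders (space M) V" for D
  proof -
    have DM: "D \<in> sets M" and cD: "char_eq V (density M (indicator D)) (density N (indicator D))"
      using char_eq_cylinder[OF D ce lin] by auto
    \<comment> \<open>The zero functional lies in \<open>V\<close>, and its characteristic function
      is the total mass of the restricted measure.\<close>
    have "measure (density M (indicator D)) (space M) = measure (density N (indicator D)) (space N)"
      using cD zero unfolding char_eq_def by (auto dest!: bspec[OF _ zero])
    moreover have "measure (density L (indicator D)) (space L) = measure L D" if "sets L = sets M" for L
    proof -
      have DL: "D \<in> sets L" using DM that by simp
      show ?thesis
        using emeasure_restricted[OF DL sets.top] sets.sets_into_space[OF DL] by (simp add: measure_def Int_absorb2)
    qed
    ultimately show ?thesis using setsN by simp
  qed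
  have sM: "sigma_sets (space M) (cylinders (space M) V) \<subseteq> sets M"
    using char_eq_cylinder[OF _ ce lin] by (intro sets.sigma_sets_subset) auto
  have C': "C \<in> sigma_sets (space M) (cylinders (space M) V)" using C cyl_events_eq by metis
  have "Int_stable (cylinders (space M) V)" using cylinders_Int by (auto simp: Int_stable_def)
  moreover have "cylinders (space M) V \<subseteq> Pow (space M)" using cylinders_subset by auto
  ultimately show ?thesis using C'
  proof (induction rule: sigma_sets_induct_disjoint)
    case (basic A) then show ?case by (rule eqc)
  next
    case empty show ?case by simp
  next
    case (compl A)
    then have "A \<in> sets M" using sM by auto
    then show ?case using compl M.finite_measure_compl[of A] N.finite_measure_compl[of A] setsN sp eqc[OF cylinders.top] by simp
  next
    case (union A)
    then have r: "range A \<subseteq> sets M" using sM by auto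
    have "(\<lambda>i. measure M (A i)) sums measure M (\<Union>i. A i)" "(\<lambda>i. measure N (A i)) sums measure N (\<Union>i. A i)"
      using r union(1) setsN by (auto intro!: M.finite_measure_UNION N.finite_measure_UNION)
    then show ?case using union(3) by (simp add: sums_iff)
  qed
qed

section \<open>Gaussian measures and bases\<close>

lemma char_eq_measure_eq:
  assumes ce: "char_eq V M N" and lin: "linear_closed V" and gen: "sets M \<subseteq> cyl_events (space M) V"
  shows "M = N"
proof (rule measure_eqI)
  have fin: "finite_measure M" "finite_measure N" and s: "sets N = sets M"
    using ce unfolding char_eq_def by blast+
  interpret M: finite_measure M by fact
  interpret N: finite_measure N by fact
  show "sets M = sets N" using s by simp
  fix A assume "A \<in> sets M"
  then show "emeasure M A = emeasure N A"
    using char_eq_cyl_events[OF ce lin, of A] gen by (auto simp: M.emeasure_eq_measure N.emeasure_eq_measure)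
qed

lemma sigma_algebra_cyl_events: "sigma_algebra \<Omega> (cyl_events \<Omega> V)"
  unfolding cyl_events_def by (intro sigma_algebra_sigma_sets) auto

lemma cyl_events_basic: "v \<in> V \<Longrightarrow> A \<in> sets borel \<Longrightarrow> v -` A \<inter> \<Omega> \<in> cyl_events \<Omega> V"
  unfolding cyl_events_def by (intro sigma_sets.Basic) auto

lemma cyl_events_vimage:
  assumes T: "T \<in> \<Omega> \<rightarrow> \<Omega>'" and V: "\<And>v. v \<in> V' \<Longrightarrow> (\<lambda>x. v (T x)) \<in> V" and C: "C \<in> cyl_events \<Omega>' V'"
  shows "T -` C \<inter> \<Omega> \<in> cyl_events \<Omega> V"
proof -
  have "T -` C \<inter> \<Omega> \<in> {T -` A \<inter> \<Omega> |A. A \<in> sigma_sets \<Omega>' {v -` A \<inter> \<Omega>' |v A. v \<in> V' \<and> A \<in> sets borel}}"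
    using C unfolding cyl_events_def by blast
  also have "\<dots> = sigma_sets \<Omega> {T -` A \<inter> \<Omega> |A. A \<in> {v -` A \<inter> \<Omega>' |v A. v \<in> V' \<and> A \<in> sets borel}}"
    by (rule sigma_sets_vimage_commute[OF T])
  also have "\<dots> \<subseteq> cyl_events \<Omega> V"
    unfolding cyl_events_def
  proof (intro sigma_sets_mono', safe)
    fix v and A :: "real set" assume "v \<in> V'" "A \<in> sets borel"
    then show "\<exists>v' A'. T -` (v -` A \<inter> \<Omega>') \<inter> \<Omega> = v' -` A' \<inter> \<Omega> \<and> v' \<in> V \<and> A' \<in> sets borel"
      using T V[of v] by (intro exI[of _ "\<lambda>x. v (T x)"] exI[of _ A]) auto
  qed
  finally show ?thesis .
qed

lemma cyl_events_sets:
  assumes "V \<subseteq> borel_measurable M"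
  shows "cyl_events (space M) V \<subseteq> sets M"
  unfolding cyl_events_def
proof (intro sets.sigma_sets_subset subsetI)
  fix B assume "B \<in> {v -` A \<inter> space M |v A. v \<in> V \<and> A \<in> sets borel}"
  then obtain v and A :: "real set" where "v \<in> V" "A \<in> sets borel" "B = v -` A \<inter> space M" by blast
  then show "B \<in> sets M" using assms measurable_sets[of v M borel A] by blast
qed

text \<open>Both sides of the factorisation are characteristic functions of linear combinations on the
  product space, of the diagonal image of \<open>M\<close> and of \<open>M \<Otimes>\<^sub>M M\<close>.\<close>

lemma (in prob_space) char_indep:
  assumes lin: "linear_closed V1" "linear_closed V2"
    and meas: "V1 \<subseteq> borel_measurable M" "V2 \<subseteq> borel_measurable M"
    and fac: "\<And>v w. v \<in> V1 \<Longrightarrow> w \<in> V2 \<Longrightarrow>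
       (CLINT x|M. iexp (v x + w x)) = (CLINT x|M. iexp (v x)) * (CLINT x|M. iexp (w x))"
    and C: "C \<in> cyl_events (space M) V1" and D: "D \<in> cyl_events (space M) V2"
  shows "prob (C \<inter> D) = prob C * prob D"
proof -
  interpret P: pair_prob_space M M ..
  define V where "V = (\<lambda>(v, w) (x, y). v x + w y :: real) ` (V1 \<times> V2)"
  let ?D = "distr M (M \<Otimes>\<^sub>M M) (\<lambda>x. (x, x))"
  have m1: "v \<in> borel_measurable M" if "v \<in> V1" for v using that meas by blast
  have m2: "v \<in> borel_measurable M" if "v \<in> V2" for v using that meas by blast
  have inV: "(\<lambda>(x, y). v x + w y) \<in> V" if "v \<in> V1" "w \<in> V2" for v w
    using that unfolding V_def by force
  have linV: "linear_closed V"
    unfolding linear_closed_def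
  proof (intro conjI ballI allI)
    show "V \<noteq> {}" using lin unfolding linear_closed_def V_def by auto
  next
    fix p q assume "p \<in> V" "q \<in> V"
    then obtain v w v' w' where *: "p = (\<lambda>(x, y). v x + w y)" "q = (\<lambda>(x, y). v' x + w' y)"
      "v \<in> V1" "v' \<in> V1" "w \<in> V2" "w' \<in> V2" unfolding V_def by auto
    then have "(\<lambda>(x, y). (v x + v' x) + (w y + w' y)) \<in> V"
      using lin by (intro inV) (auto simp: linear_closed_def)
    also have "(\<lambda>(x, y). (v x + v' x) + (w y + w' y)) = (\<lambda>z. p z + q z)"
      by (auto simp: *)
    finally show "(\<lambda>z. p z + q z) \<in> V" .
  next
    fix c p assume "p \<in> V"
    then obtain v w where *: "p = (\<lambda>(x, y). v x + w y)" "v \<in> V1" "w \<in> V2" unfolding V_def by auto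
    then have "(\<lambda>(x, y). (c * v x) + (c * w y)) \<in> V"
      using lin by (intro inV) (auto simp: linear_closed_def)
    also have "(\<lambda>(x, y). (c * v x) + (c * w y)) = (\<lambda>z. c * p z)"
      by (auto simp: * ring_distribs)
    finally show "(\<lambda>z. c * p z) \<in> V" .
  qed
  have ce: "char_eq V ?D (M \<Otimes>\<^sub>M M)"
    unfolding char_eq_def
  proof (intro conjI ballI)
    show "finite_measure ?D" by (rule finite_measure_distr) simp
    show "finite_measure (M \<Otimes>\<^sub>M M)" by (rule P.finite_measure_axioms)
    show "sets (M \<Otimes>\<^sub>M M) = sets ?D" by simp
    fix p assume "p \<in> V"
    then obtain v w where p: "p = (\<lambda>(x, y). v x + w y)" and v: "v \<in> V1" and w: "w \<in> V2" unfolding V_def by auto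
    note [measurable] = m1[OF v] m2[OF w]
    have pm: "p \<in> borel_measurable (M \<Otimes>\<^sub>M M)" unfolding p by measurable
    then show "p \<in> borel_measurable ?D" by simp
    have ie: "iexp (a + b) = iexp a * iexp b" for a b :: real
      by (simp add: exp_add ring_distribs)
    have "(CLINT z|?D. iexp (p z)) = (CLINT x|M. iexp (v x + w x))"
      using pm by (subst integral_distr) (auto simp: p)
    also have "\<dots> = (CLINT x|M. iexp (v x)) * (CLINT x|M. iexp (w x))" by (rule fac[OF v w])
    also have "\<dots> = (CLINT x|M. (CLINT y|M. iexp (v x) * iexp (w y)))"
      by (simp only: integral_mult_right_zero integral_mult_left_zero)
    also have "\<dots> = (CLINT z|M \<Otimes>\<^sub>M M. case z of (x, y) \<Rightarrow> iexp (v x) * iexp (w y))"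
    proof (rule P.integral_fst)
      show "complex_integrable (M \<Otimes>\<^sub>M M) (\<lambda>(x, y). iexp (v x) * iexp (w y))"
      proof (rule P.integrable_const_bound[where B=1])
        show "AE z in M \<Otimes>\<^sub>M M. norm (case z of (x, y) \<Rightarrow> iexp (v x) * iexp (w y)) \<le> 1"
          by (intro AE_I2) (auto simp: norm_mult)
      qed measurable
    qed
    also have "\<dots> = (CLINT z|M \<Otimes>\<^sub>M M. iexp (p z))"
      by (intro Bochner_Integration.integral_cong) (auto simp: p exp_add ring_distribs)
    finally show "(CLINT z|?D. iexp (p z)) = (CLINT z|M \<Otimes>\<^sub>M M. iexp (p z))" .
  qed
  let ?\<Omega> = "space (M \<Otimes>\<^sub>M M)"
  interpret S: sigma_algebra ?\<Omega> "cyl_events ?\<Omega> V" by (rule sigma_algebra_cyl_events)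
  have z: "(\<lambda>x. 0) \<in> V1" "(\<lambda>x. 0) \<in> V2" using lin linear_closed_zero by blast+
  have c1: "fst -` C \<inter> ?\<Omega> \<in> cyl_events ?\<Omega> V"
    using inV[OF _ z(2)] by (intro cyl_events_vimage[OF _ _ C]) (auto simp: space_pair_measure split_beta')
  have c2: "snd -` D \<inter> ?\<Omega> \<in> cyl_events ?\<Omega> V"
    using inV[OF z(1)] by (intro cyl_events_vimage[OF _ _ D]) (auto simp: space_pair_measure split_beta')
  have CM: "C \<in> sets M" "D \<in> sets M"
    using C D cyl_events_sets meas by blast+
  have "C \<subseteq> space M" "D \<subseteq> space M" using CM sets.sets_into_space by auto
  \<comment> \<open>The diagonal image of \<open>M\<close> gives this rectangle the mass of
    \<open>C \<inter> D\<close>, the product measure gives it the product of the masses.\<close>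
  then have CD: "(fst -` C \<inter> ?\<Omega>) \<inter> (snd -` D \<inter> ?\<Omega>) = C \<times> D" by (auto simp: space_pair_measure)
  have "C \<times> D \<in> cyl_events (space ?D) V" using S.Int[OF c1 c2] unfolding CD space_distr .
  from char_eq_cyl_events[OF ce linV this]
  have "measure ?D (C \<times> D) = measure (M \<Otimes>\<^sub>M M) (C \<times> D)" .
  also have "measure ?D (C \<times> D) = prob (C \<inter> D)"
    using CM \<open>C \<subseteq> space M\<close> \<open>D \<subseteq> space M\<close> by (subst measure_distr) (auto intro!: arg_cong[where f=prob])
  also have "measure (M \<Otimes>\<^sub>M M) (C \<times> D) = prob C * prob D"
    using CM by (simp add: measure_def emeasure_pair_measure_Times enn2real_mult)
  finally show ?thesis .
qed

section \<open>Gaussian laws on the line\<close>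

lemma centered_gaussian_real_facts:
  assumes "centered_gaussian_real \<nu>"
  shows "prob_space \<nu>" "sets \<nu> = sets borel" "integrable \<nu> (\<lambda>x. x\<^sup>2)"
    "(CLINT x|\<nu>. iexp (t * x)) = exp (- (t\<^sup>2 * (LINT x|\<nu>. x\<^sup>2)) / 2)"
    "(LINT x|\<nu>. x\<^sup>2) = 0 \<Longrightarrow> \<nu> = return borel 0"
proof -
  have "prob_space \<nu> \<and> sets \<nu> = sets borel \<and> integrable \<nu> (\<lambda>x. x\<^sup>2) \<and>
    (CLINT x|\<nu>. iexp (t * x)) = exp (- (t\<^sup>2 * (LINT x|\<nu>. x\<^sup>2)) / 2) \<and>
    ((LINT x|\<nu>. x\<^sup>2) = 0 \<longrightarrow> \<nu> = return borel 0)"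
    using assms unfolding centered_gaussian_real_def
  proof (elim disjE exE conjE)
    assume \<nu>: "\<nu> = return borel 0"
    have "integrable (return borel 0) (\<lambda>x::real. x\<^sup>2)"
      by (rule finite_measure.integrable_const_bound[where B=0])
        (auto simp: AE_return intro!: prob_space.finite_measure prob_space_return)
    then show ?thesis
      by (auto simp: \<nu> prob_space_return integral_return)
  next
    fix \<sigma> :: real assume \<sigma>: "\<sigma> > 0" and \<nu>: "\<nu> = density lborel (normal_density 0 \<sigma>)"
    interpret S: prob_space std_normal_distribution by (rule real_dist_normal_dist[THEN real_distribution.axioms(1)])
    \<comment> \<open>The law is the image of the standard one under multiplication by \<sigma>, so
      moments and characteristic function are rescaled from there.\<close>
    have "distributed std_normal_distribution lborel (\<lambda>x. x) std_normal_density"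
      by (auto simp: distributed_def distr_id2)
    from S.normal_density_affine[OF this, of \<sigma> 0]
    have d: "\<nu> = distr std_normal_distribution lborel (\<lambda>x. \<sigma> * x)"
      using \<sigma> by (simp add: \<nu> distributed_def)
    have int: "integrable std_normal_distribution (\<lambda>x. x\<^sup>2)"
      using integrable_std_normal_moment[of 2] by (subst integrable_density) auto
    have "(LINT x|std_normal_distribution. x\<^sup>2) = 1"
      using integral_std_normal_moment_even[of 1] by (subst integral_density) (auto)
    then have v: "(LINT x|\<nu>. x\<^sup>2) = \<sigma>\<^sup>2"
      unfolding d using int by (subst integral_distr) (auto simp: power_mult_distrib)
    have "(CLINT x|\<nu>. iexp (t * x)) = (CLINT x|std_normal_distribution. iexp (t * (\<sigma> * x)))"
      unfolding d by (subst integral_distr) auto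
    also have "\<dots> = char std_normal_distribution (t * \<sigma>)"
      unfolding char_def by (simp add: mult_ac)
    also have "\<dots> = exp (- (t\<^sup>2 * \<sigma>\<^sup>2) / 2)"
      by (simp add: char_std_normal_distribution power_mult_distrib)
    finally have c: "(CLINT x|\<nu>. iexp (t * x)) = exp (- (t\<^sup>2 * (LINT x|\<nu>. x\<^sup>2)) / 2)" by (simp add: v)
    show ?thesis
      using \<sigma> int c v by (auto simp: \<nu> prob_space_normal_density intro: prob_space_normal_density)
        (simp add: d integrable_distr_eq power_mult_distrib flip: \<nu>)
  qed
  then show "prob_space \<nu>" "sets \<nu> = sets borel" "integrable \<nu> (\<lambda>x. x\<^sup>2)"
    "(CLINT x|\<nu>. iexp (t * x)) = exp (- (t\<^sup>2 * (LINT x|\<nu>. x\<^sup>2)) / 2)"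
    "(LINT x|\<nu>. x\<^sup>2) = 0 \<Longrightarrow> \<nu> = return borel 0" by blast+
qed

lemma borel_measurable_blinfun_apply [measurable]: "blinfun_apply l \<in> borel_measurable borel"
  by (intro borel_measurable_continuous_onI continuous_intros)

section \<open>Banach spaces with a basis\<close>

locale basis =
  fixes e :: "nat \<Rightarrow> 'w::{banach, second_countable_topology}" and f :: "nat \<Rightarrow> 'w \<Rightarrow>\<^sub>L real"
  assumes expansion: "\<And>x. (\<lambda>k. f k x *\<^sub>R e k) sums x"
    and biorthogonal: "\<And>j k. f j (e k) = (if j = k then 1 else 0)"
begin

text \<open>The basis expansion exhibits \<open>X\<close> as a pointwise limit of combinations of
  its coordinates, so measurability of the coordinates is enough. This is why functionals generate
  the Borel sets and decide equality of measures.\<close>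

lemma vimage_cyl_events:
  assumes V: "\<And>k. (\<lambda>\<omega>. f k (X \<omega>)) \<in> V" and A: "A \<in> sets borel"
  shows "X -` A \<inter> \<Omega> \<in> cyl_events \<Omega> V"
proof -
  interpret S: sigma_algebra \<Omega> "cyl_events \<Omega> V" by (rule sigma_algebra_cyl_events)
  let ?N = "sigma \<Omega> (cyl_events \<Omega> V)"
  have sN: "sets ?N = cyl_events \<Omega> V" "space ?N = \<Omega>"
    by (simp_all add: S.space_closed S.sigma_sets_eq)
  have [measurable]: "(\<lambda>\<omega>. f k (X \<omega>)) \<in> borel_measurable ?N" for k
    by (rule measurableI) (auto simp: sN intro: cyl_events_basic[OF V])
  have "X \<in> borel_measurable ?N"
  proof (rule borel_measurable_LIMSEQ_metric)
    show "(\<lambda>\<omega>. \<Sum>k<n. f k (X \<omega>) *\<^sub>R e k) \<in> borel_measurable ?N" for n by measurable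
    show "(\<lambda>n. \<Sum>k<n. f k (X \<omega>) *\<^sub>R e k) \<longlonglongrightarrow> X \<omega>" for \<omega>
      using expansion[of "X \<omega>"] unfolding sums_def .
  qed
  from measurable_sets[OF this A] show ?thesis by (simp add: sN)
qed

lemma eqI_functionals: "(\<And>k. f k x = f k y) \<Longrightarrow> x = y"
  using sums_unique2[OF expansion[of x]] expansion[of y] by simp

lemma linear_closed_functionals: "linear_closed (range (blinfun_apply :: ('w \<Rightarrow>\<^sub>L real) \<Rightarrow> _))"
  unfolding linear_closed_def
proof (intro conjI ballI allI)
  fix v w assume "v \<in> range (blinfun_apply :: ('w \<Rightarrow>\<^sub>L real) \<Rightarrow> _)" "w \<in> range (blinfun_apply :: ('w \<Rightarrow>\<^sub>L real) \<Rightarrow> _)"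
  then obtain l l' where "v = blinfun_apply l" "w = blinfun_apply l'" by blast
  then show "(\<lambda>x. v x + w x) \<in> range blinfun_apply"
    by (intro image_eqI[of _ _ "l + l'"]) (auto simp: blinfun.add_left)
next
  fix c v assume "v \<in> range (blinfun_apply :: ('w \<Rightarrow>\<^sub>L real) \<Rightarrow> _)"
  then obtain l where "v = blinfun_apply l" by blast
  then show "(\<lambda>x. c * v x) \<in> range blinfun_apply"
    by (intro image_eqI[of _ _ "c *\<^sub>R l"]) (auto simp: blinfun.scaleR_left)
qed auto

lemma measure_eqI_functionals:
  fixes M N :: "'w measure"
  assumes fin: "finite_measure M" "finite_measure N" and sets: "sets M = sets borel" "sets N = sets borel"
    and eq: "\<And>l :: 'w \<Rightarrow>\<^sub>L real. (CLINT x|M. iexp (l x)) = (CLINT x|N. iexp (l x))"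
  shows "M = N"
proof (rule char_eq_measure_eq[OF _ linear_closed_functionals])
  show "char_eq (range blinfun_apply) M N"
    unfolding char_eq_def using assms by (auto simp: measurable_cong_sets[OF sets(1) refl])
  show "sets M \<subseteq> cyl_events (space M) (range (blinfun_apply :: ('w \<Rightarrow>\<^sub>L real) \<Rightarrow> _))"
  proof
    fix A assume "A \<in> sets M"
    then show "A \<in> cyl_events (space M) (range (blinfun_apply :: ('w \<Rightarrow>\<^sub>L real) \<Rightarrow> _))"
      using vimage_cyl_events[of "\<lambda>x. x" "range (blinfun_apply :: ('w \<Rightarrow>\<^sub>L real) \<Rightarrow> _)" A "space M"] sets
        sets.sets_into_space[of A M]
      by (auto simp: Int_absorb2)
  qed
qed

end

section \<open>Covariance of a Gaussian measure\<close>

locale gaussian_measure =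
  fixes \<mu> :: "'w::{banach, second_countable_topology} measure"
  assumes gaussian: "centered_gaussian_measure \<mu>" and nondegenerate: "nondegenerate_gaussian \<mu>"

sublocale gaussian_measure \<subseteq> prob_space \<mu>
  using gaussian unfolding centered_gaussian_measure_def by blast

context gaussian_measure
begin

lemma sets_mu [measurable_cong, simp]: "sets \<mu> = sets borel"
  using gaussian unfolding centered_gaussian_measure_def by blast

lemma space_mu [simp]: "space \<mu> = UNIV"
  using sets_eq_imp_space_eq[OF sets_mu] by simp

lemma functional_gaussian: "centered_gaussian_real (distr \<mu> borel (blinfun_apply l))" for l :: "'w \<Rightarrow>\<^sub>L real"
  using gaussian unfolding centered_gaussian_measure_def by blast

lemma integrable_functional_square: "integrable \<mu> (\<lambda>w. (blinfun_apply l w)\<^sup>2)" for l :: "'w \<Rightarrow>\<^sub>L real"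
  using centered_gaussian_real_facts(3)[OF functional_gaussian[of l]]
  by (subst (asm) integrable_distr_eq) auto

text \<open>By polarisation from the squares.\<close>

lemma integrable_functional_mult: "integrable \<mu> (\<lambda>w. blinfun_apply l w * blinfun_apply l' w)" for l l' :: "'w \<Rightarrow>\<^sub>L real"
proof -
  have "integrable \<mu> (\<lambda>w. ((blinfun_apply (l + l') w)\<^sup>2 - (blinfun_apply l w)\<^sup>2 - (blinfun_apply l' w)\<^sup>2) / 2)"
    by (intro Bochner_Integration.integrable_diff integrable_functional_square integrable_divide)
  then show ?thesis by (simp add: blinfun.add_left power2_eq_square algebra_simps)
qed

lemma Cov_commute: "Cov \<mu> l l' = Cov \<mu> l' l"
  unfolding Cov_def by (simp add: mult.commute)

lemma Cov_add_left: "Cov \<mu> (l + l') k = Cov \<mu> l k + Cov \<mu> l' k"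
  unfolding Cov_def by (simp add: blinfun.add_left ring_distribs integrable_functional_mult)

lemma Cov_scaleR_left: "Cov \<mu> (c *\<^sub>R l) k = c * Cov \<mu> l k"
  unfolding Cov_def by (simp add: blinfun.scaleR_left mult.assoc)

lemma Cov_add_right: "Cov \<mu> k (l + l') = Cov \<mu> k l + Cov \<mu> k l'"
  using Cov_add_left Cov_commute by metis

lemma Cov_scaleR_right: "Cov \<mu> k (c *\<^sub>R l) = c * Cov \<mu> k l"
  using Cov_scaleR_left Cov_commute by metis

lemma Cov_diff_left: "Cov \<mu> (l - l') k = Cov \<mu> l k - Cov \<mu> l' k"
  using Cov_add_left[of l "- 1 *\<^sub>R l'" k] Cov_scaleR_left[of "-1" l' k] by simp

lemma Cov_diff_right: "Cov \<mu> k (l - l') = Cov \<mu> k l - Cov \<mu> k l'"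
  using Cov_diff_left Cov_commute by metis

lemma Cov_zero_left [simp]: "Cov \<mu> 0 k = 0" and Cov_zero_right [simp]: "Cov \<mu> k 0 = 0"
  by (simp_all add: Cov_def)

lemma Cov_sum_left: "Cov \<mu> (\<Sum>i\<in>I. l i) k = (\<Sum>i\<in>I. Cov \<mu> (l i) k)"
  by (induction I rule: infinite_finite_induct) (auto simp: Cov_add_left)

lemma Cov_nonneg: "0 \<le> Cov \<mu> l l"
  unfolding Cov_def by simp

text \<open>Here nondegeneracy enters: variance 0 forces the image law to be the point mass at 0. It
  makes the covariance an inner product on the dual.\<close>

lemma Cov_eq_0D: "Cov \<mu> l l = 0 \<Longrightarrow> l = 0"
proof (rule ccontr)
  assume "Cov \<mu> l l = 0" "l \<noteq> 0"
  have "(LINT x|distr \<mu> borel (blinfun_apply l). x\<^sup>2) = Cov \<mu> l l"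
    by (subst integral_distr) (auto simp: Cov_def power2_eq_square)
  then have "distr \<mu> borel (blinfun_apply l) = return borel 0"
    using centered_gaussian_real_facts(5)[OF functional_gaussian[of l]] \<open>Cov \<mu> l l = 0\<close> by simp
  then show False
    using nondegenerate \<open>l \<noteq> 0\<close> unfolding nondegenerate_gaussian_def by blast
qed

lemma Cov_eqI: "(\<And>k. Cov \<mu> l k = Cov \<mu> l' k) \<Longrightarrow> l = l'"
  using Cov_eq_0D[of "l - l'"] by (simp add: Cov_diff_left)

lemma char_functional: "(CLINT w|\<mu>. iexp (blinfun_apply l w)) = exp (- Cov \<mu> l l / 2)"
proof -
  have "(LINT x|distr \<mu> borel (blinfun_apply l). x\<^sup>2) = Cov \<mu> l l"
    by (subst integral_distr) (auto simp: Cov_def power2_eq_square)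
  then have "(CLINT x|distr \<mu> borel (blinfun_apply l). iexp (1 * x)) = exp (- Cov \<mu> l l / 2)"
    using centered_gaussian_real_facts(4)[OF functional_gaussian[of l], of 1] by simp
  then show ?thesis by (subst (asm) integral_distr) auto
qed

lemma Cov_Cauchy_Schwarz: "\<bar>Cov \<mu> l k\<bar> \<le> sqrt (Cov \<mu> l l) * sqrt (Cov \<mu> k k)"
proof (cases "k = 0")
  case False
  then have k: "Cov \<mu> k k > 0" using Cov_eq_0D Cov_nonneg[of k] by (metis less_eq_real_def)
  define t where "t = Cov \<mu> l k / Cov \<mu> k k"
  have "0 \<le> Cov \<mu> (l - t *\<^sub>R k) (l - t *\<^sub>R k)" by (rule Cov_nonneg)
  also have "\<dots> = Cov \<mu> l l - 2 * t * Cov \<mu> l k + t * t * Cov \<mu> k k"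
    by (simp add: Cov_diff_left Cov_diff_right Cov_scaleR_left Cov_scaleR_right Cov_commute[of k l] algebra_simps)
  also have "\<dots> = Cov \<mu> l l - (Cov \<mu> l k)\<^sup>2 / Cov \<mu> k k"
    using k by (simp add: t_def power2_eq_square)
  finally have "(Cov \<mu> l k)\<^sup>2 \<le> Cov \<mu> l l * Cov \<mu> k k" using k by (simp add: field_simps)
  then have "sqrt ((Cov \<mu> l k)\<^sup>2) \<le> sqrt (Cov \<mu> l l * Cov \<mu> k k)" by (rule real_sqrt_le_mono)
  then show ?thesis by (simp add: real_sqrt_mult)
qed simp

end

section \<open>Fernique's tail estimate\<close>

locale gaussian_basis = gaussian_measure \<mu> + basis e f
  for \<mu> :: "'w::{banach, second_countable_topology} measure"
    and e :: "nat \<Rightarrow> 'w" and f :: "nat \<Rightarrow> 'w \<Rightarrow>\<^sub>L real"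

context gaussian_basis
begin

definition pair_functionals :: "('w \<times> 'w \<Rightarrow> real) set" where
  "pair_functionals = {\<lambda>z. blinfun_apply l (fst z) + blinfun_apply l' (snd z) |l l'. True}"

lemma char_pair_functional:
  "(CLINT z|\<mu> \<Otimes>\<^sub>M \<mu>. iexp (blinfun_apply l (fst z) + blinfun_apply l' (snd z))) =
    exp (- Cov \<mu> l l / 2) * exp (- Cov \<mu> l' l' / 2)"
proof -
  interpret P: pair_prob_space \<mu> \<mu> ..
  have "(CLINT z|\<mu> \<Otimes>\<^sub>M \<mu>. iexp (blinfun_apply l (fst z) + blinfun_apply l' (snd z)))
      = (CLINT z|\<mu> \<Otimes>\<^sub>M \<mu>. case z of (x, y) \<Rightarrow> iexp (blinfun_apply l x) * iexp (blinfun_apply l' y))"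
    by (intro Bochner_Integration.integral_cong) (auto simp: exp_add ring_distribs)
  also have "\<dots> = (CLINT x|\<mu>. (CLINT y|\<mu>. iexp (blinfun_apply l x) * iexp (blinfun_apply l' y)))"
  proof (rule P.integral_fst[symmetric])
    show "complex_integrable (\<mu> \<Otimes>\<^sub>M \<mu>) (\<lambda>(x, y). iexp (blinfun_apply l x) * iexp (blinfun_apply l' y))"
    proof (rule P.integrable_const_bound[where B=1])
      show "AE z in \<mu> \<Otimes>\<^sub>M \<mu>. norm (case z of (x, y) \<Rightarrow> iexp (blinfun_apply l x) * iexp (blinfun_apply l' y)) \<le> 1"
        by (intro AE_I2) (auto simp: norm_mult)
    qed measurable
  qed
  also have "\<dots> = (CLINT x|\<mu>. iexp (blinfun_apply l x)) * (CLINT x|\<mu>. iexp (blinfun_apply l' x))"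
    by (simp only: integral_mult_right_zero integral_mult_left_zero)
  finally show ?thesis by (simp only: char_functional of_real_mult)
qed

lemma linear_closed_pair_functionals: "linear_closed pair_functionals"
  unfolding linear_closed_def
proof (intro conjI ballI allI)
  show "pair_functionals \<noteq> {}" unfolding pair_functionals_def by blast
next
  fix v w assume "v \<in> pair_functionals" "w \<in> pair_functionals"
  then obtain l l' k k' where "v = (\<lambda>z. blinfun_apply l (fst z) + blinfun_apply l' (snd z))"
    "w = (\<lambda>z. blinfun_apply k (fst z) + blinfun_apply k' (snd z))"
    unfolding pair_functionals_def by blast
  then have "(\<lambda>z. v z + w z) = (\<lambda>z. blinfun_apply (l + k) (fst z) + blinfun_apply (l' + k') (snd z))"
    by (auto simp: blinfun.add_left)
  then show "(\<lambda>z. v z + w z) \<in> pair_functionals" unfolding pair_functionals_def by blast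
next
  fix c v assume "v \<in> pair_functionals"
  then obtain l l' where "v = (\<lambda>z. blinfun_apply l (fst z) + blinfun_apply l' (snd z))"
    unfolding pair_functionals_def by blast
  then have "(\<lambda>z. c * v z) = (\<lambda>z. blinfun_apply (c *\<^sub>R l) (fst z) + blinfun_apply (c *\<^sub>R l') (snd z))"
    by (auto simp: blinfun.scaleR_left ring_distribs)
  then show "(\<lambda>z. c * v z) \<in> pair_functionals" unfolding pair_functionals_def by blast
qed

lemma pair_functionals_generate:
  "sets (borel \<Otimes>\<^sub>M borel :: ('w \<times> 'w) measure) \<subseteq> cyl_events UNIV pair_functionals"
proof -
  interpret S: sigma_algebra UNIV "cyl_events UNIV pair_functionals" by (rule sigma_algebra_cyl_events)
  have in1: "(\<lambda>z. blinfun_apply l (fst z)) \<in> pair_functionals" for l :: "'w \<Rightarrow>\<^sub>L real"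
    unfolding pair_functionals_def by (rule CollectI, rule exI[of _ l], rule exI[of _ 0]) simp
  have in2: "(\<lambda>z. blinfun_apply l (snd z)) \<in> pair_functionals" for l :: "'w \<Rightarrow>\<^sub>L real"
    unfolding pair_functionals_def by (rule CollectI, rule exI[of _ 0], rule exI[of _ l]) simp
  have "A \<times> B \<in> cyl_events UNIV pair_functionals" if "A \<in> sets borel" "B \<in> sets borel" for A B :: "'w set"
  proof -
    have "fst -` A \<inter> UNIV \<in> cyl_events UNIV pair_functionals"
      by (intro vimage_cyl_events[where X=fst] in1 that)
    moreover have "snd -` B \<inter> UNIV \<in> cyl_events UNIV pair_functionals"
      by (intro vimage_cyl_events[where X=snd] in2 that)
    ultimately have "(fst -` A \<inter> UNIV) \<inter> (snd -` B \<inter> UNIV) \<in> cyl_events UNIV pair_functionals"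
      by (rule S.Int)
    also have "(fst -` A \<inter> UNIV) \<inter> (snd -` B \<inter> UNIV) = A \<times> B" by auto
    finally show ?thesis .
  qed
  then have "{a \<times> b |a b. a \<in> sets borel \<and> b \<in> sets borel} \<subseteq> cyl_events UNIV (pair_functionals)"
    by blast
  then show ?thesis
    unfolding sets_pair_measure using S.sigma_sets_subset by simp
qed

text \<open>Rotation by 45 degrees turns the pair of functionals l, l' into (l + l') / sqrt 2, (l' -
  l) / sqrt 2, and by the parallelogram law the sum of the two variances is unchanged.\<close>

lemma rotation_invariant:
  "distr (\<mu> \<Otimes>\<^sub>M \<mu>) (borel \<Otimes>\<^sub>M borel) (\<lambda>(x, y). ((1 / sqrt 2) *\<^sub>R (x - y), (1 / sqrt 2) *\<^sub>R (x + y))) = \<mu> \<Otimes>\<^sub>M \<mu>"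
    (is "distr _ _ ?R = _")
proof (rule char_eq_measure_eq[OF _ linear_closed_pair_functionals])
  interpret P: pair_prob_space \<mu> \<mu> ..
  have R: "?R \<in> \<mu> \<Otimes>\<^sub>M \<mu> \<rightarrow>\<^sub>M borel \<Otimes>\<^sub>M borel" by measurable
  show "char_eq pair_functionals (distr (\<mu> \<Otimes>\<^sub>M \<mu>) (borel \<Otimes>\<^sub>M borel) ?R) (\<mu> \<Otimes>\<^sub>M \<mu>)"
    unfolding char_eq_def
  proof (intro conjI ballI)
    show "finite_measure (distr (\<mu> \<Otimes>\<^sub>M \<mu>) (borel \<Otimes>\<^sub>M borel) ?R)" by (rule P.finite_measure_distr[OF R])
    show "finite_measure (\<mu> \<Otimes>\<^sub>M \<mu>)" by (rule P.finite_measure_axioms)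
    show "sets (\<mu> \<Otimes>\<^sub>M \<mu>) = sets (distr (\<mu> \<Otimes>\<^sub>M \<mu>) (borel \<Otimes>\<^sub>M borel) ?R)"
      by (simp only: sets_distr sets_pair_measure_cong[OF sets_mu sets_mu])
    fix v assume "v \<in> pair_functionals"
    then obtain l l' where v: "v = (\<lambda>z. blinfun_apply l (fst z) + blinfun_apply l' (snd z))"
      unfolding pair_functionals_def by blast
    have vm: "v \<in> borel_measurable (borel \<Otimes>\<^sub>M borel)" unfolding v by measurable
    then show "v \<in> borel_measurable (distr (\<mu> \<Otimes>\<^sub>M \<mu>) (borel \<Otimes>\<^sub>M borel) ?R)" by simp
    define c where "c = 1 / sqrt (2::real)"
    have c2: "c * c = 1 / 2" by (simp add: c_def)
    define k where "k = c *\<^sub>R (l + l')"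
    define k' where "k' = c *\<^sub>R (l' - l)"
    have "(CLINT z|distr (\<mu> \<Otimes>\<^sub>M \<mu>) (borel \<Otimes>\<^sub>M borel) ?R. iexp (v z)) = (CLINT z|\<mu> \<Otimes>\<^sub>M \<mu>. iexp (v (?R z)))"
      using vm by (intro integral_distr[OF R]) measurable
    also have "\<dots> = (CLINT z|\<mu> \<Otimes>\<^sub>M \<mu>. iexp (blinfun_apply k (fst z) + blinfun_apply k' (snd z)))"
      by (intro Bochner_Integration.integral_cong refl arg_cong[where f=iexp])
        (auto simp: v k_def k'_def c_def blinfun.add_left blinfun.diff_left blinfun.scaleR_left
           blinfun.add_right blinfun.diff_right blinfun.scaleR_right algebra_simps)
    also have "\<dots> = exp (- Cov \<mu> k k / 2) * exp (- Cov \<mu> k' k' / 2)" by (rule char_pair_functional)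
    also have "\<dots> = exp (- (Cov \<mu> k k + Cov \<mu> k' k') / 2)"
      by (simp add: exp_add[symmetric] add_divide_distrib del: of_real_exp flip: of_real_mult)
    also have "Cov \<mu> k k = (c * c) * (Cov \<mu> l l + 2 * Cov \<mu> l l' + Cov \<mu> l' l')"
      by (simp add: k_def Cov_add_left Cov_add_right Cov_scaleR_left Cov_scaleR_right Cov_commute[of l' l] algebra_simps)
    also have "Cov \<mu> k' k' = (c * c) * (Cov \<mu> l l - 2 * Cov \<mu> l l' + Cov \<mu> l' l')"
      by (simp add: k'_def Cov_diff_left Cov_diff_right Cov_scaleR_left Cov_scaleR_right Cov_commute[of l' l] algebra_simps)
    also have "(c * c) * (Cov \<mu> l l + 2 * Cov \<mu> l l' + Cov \<mu> l' l') + (c * c) * (Cov \<mu> l l - 2 * Cov \<mu> l l' + Cov \<mu> l' l') = Cov \<mu> l l + Cov \<mu> l' l'"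
      unfolding c2 by (simp add: field_simps)
    also have "exp (- (Cov \<mu> l l + Cov \<mu> l' l') / 2) = exp (- Cov \<mu> l l / 2) * exp (- Cov \<mu> l' l' / 2)"
      by (simp add: exp_add[symmetric] add_divide_distrib)
    also have "complex_of_real (exp (- Cov \<mu> l l / 2) * exp (- Cov \<mu> l' l' / 2)) = (CLINT z|\<mu> \<Otimes>\<^sub>M \<mu>. iexp (v z))"
      unfolding v char_pair_functional by (simp only: of_real_mult)
    finally show "(CLINT z|distr (\<mu> \<Otimes>\<^sub>M \<mu>) (borel \<Otimes>\<^sub>M borel) ?R. iexp (v z)) = (CLINT z|\<mu> \<Otimes>\<^sub>M \<mu>. iexp (v z))" .
  qed
  show "sets (distr (\<mu> \<Otimes>\<^sub>M \<mu>) (borel \<Otimes>\<^sub>M borel) ?R)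
     \<subseteq> cyl_events (space (distr (\<mu> \<Otimes>\<^sub>M \<mu>) (borel \<Otimes>\<^sub>M borel) ?R)) pair_functionals"
    using pair_functionals_generate by (simp add: space_pair_measure)
qed

text \<open>If the rotated pair has a first entry \<open>p\<close> of norm at most \<open>s\<close>
  and a second entry \<open>q\<close> of norm above \<open>t\<close>, then the original points (q +
  p) / sqrt 2 and (q - p) / sqrt 2 both have norm above (t - s) / sqrt 2, and these points are
  independent.\<close>

lemma tail_inequality:
  "prob {x. norm x \<le> s} * prob {x. t < norm x} \<le> (prob {x. (t - s) / sqrt 2 < norm x})\<^sup>2"
proof -
  interpret P: pair_prob_space \<mu> \<mu> ..
  let ?R = "\<lambda>(x::'w, y). ((1 / sqrt 2) *\<^sub>R (x - y), (1 / sqrt 2) *\<^sub>R (x + y))"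
  let ?L = "{x::'w. norm x \<le> s} \<times> {x. t < norm x}"
  let ?U = "{x::'w. (t - s) / sqrt 2 < norm x}"
  have R: "?R \<in> \<mu> \<Otimes>\<^sub>M \<mu> \<rightarrow>\<^sub>M borel \<Otimes>\<^sub>M borel" by measurable
  have m: "{x::'w. norm x \<le> s} \<in> sets borel" "{x::'w. t < norm x} \<in> sets borel" "?U \<in> sets borel"
    by measurable
  have times: "measure (\<mu> \<Otimes>\<^sub>M \<mu>) (A \<times> B) = prob A * prob B" if "A \<in> sets borel" "B \<in> sets borel" for A B
    using that by (simp add: measure_def emeasure_pair_measure_Times enn2real_mult)
  have sub: "?R -` ?L \<inter> space (\<mu> \<Otimes>\<^sub>M \<mu>) \<subseteq> ?U \<times> ?U"
  proof safe
    fix x y :: 'w assume a: "norm ((1 / sqrt 2) *\<^sub>R (x - y)) \<le> s" "t < norm ((1 / sqrt 2) *\<^sub>R (x + y))"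
    define p where "p = (1 / sqrt 2) *\<^sub>R (x - y)"
    define q where "q = (1 / sqrt 2) *\<^sub>R (x + y)"
    have x: "x = (1 / sqrt 2) *\<^sub>R (q + p)" and y: "y = (1 / sqrt 2) *\<^sub>R (q - p)"
      by (simp_all add: p_def q_def algebra_simps flip: scaleR_2 scaleR_add_left)
    have "t - s < norm q - norm p" using a by (simp add: p_def q_def)
    moreover have "norm q - norm p \<le> norm (q + p)" "norm q - norm p \<le> norm (q - p)"
      using norm_diff_ineq[of q p] norm_triangle_ineq2[of q p] by auto
    ultimately have "t - s < norm (q + p)" "t - s < norm (q - p)" by linarith+
    then show "(t - s) / sqrt 2 < norm x" "(t - s) / sqrt 2 < norm y"
      unfolding x y by (simp_all add: divide_strict_right_mono)
  qed
  have "prob {x. norm x \<le> s} * prob {x. t < norm x} = measure (distr (\<mu> \<Otimes>\<^sub>M \<mu>) (borel \<Otimes>\<^sub>M borel) ?R) ?L"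
    unfolding rotation_invariant using times[OF m(1,2)] by simp
  also have "\<dots> = measure (\<mu> \<Otimes>\<^sub>M \<mu>) (?R -` ?L \<inter> space (\<mu> \<Otimes>\<^sub>M \<mu>))"
    using m by (intro measure_distr[OF R]) auto
  also have "\<dots> \<le> measure (\<mu> \<Otimes>\<^sub>M \<mu>) (?U \<times> ?U)"
    using m by (intro P.finite_measure_mono sub) auto
  also have "\<dots> = (prob ?U)\<^sup>2" using times[OF m(3,3)] by (simp add: power2_eq_square)
  finally show ?thesis .
qed

text \<open>Doubling the threshold squares the tail, up to a constant; of this only a geometric rate
  is kept. The rate 1 / 512 beats the factor 2 ^ 8 by which an eighth power grows between
  consecutive thresholds.\<close>

lemma tail_decay:
  obtains T where "T > 0" "\<And>n. prob {x. 2^n * T < norm x} \<le> (1 / 512)^Suc n"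
proof -
  have lim: "(\<lambda>n. prob {x. real n < norm x}) \<longlonglongrightarrow> prob (\<Inter>n. {x. real n < norm x})"
    by (intro finite_Lim_measure_decseq) (auto simp: decseq_def)
  have "(\<Inter>n. {x::'w. real n < norm x}) = {}"
  proof -
    have "\<exists>n. \<not> real n < norm x" for x :: 'w
      using real_arch_simple[of "norm x"] by (auto simp: not_less)
    then show ?thesis by auto
  qed
  with lim have "(\<lambda>n. prob {x. real n < norm x}) \<longlonglongrightarrow> 0" by simp
  \<comment> \<open>The induction below is for twice the tail, which has to start at 1 /
    512.\<close>
  then have "\<forall>\<^sub>F n in sequentially. prob {x. real n < norm x} < 1 / 1024 \<and> n > 0"
    by (intro eventually_conj order_tendstoD(2) eventually_gt_at_top) auto
  then obtain n where n: "prob {x. real n < norm x} < 1 / 1024" "n > 0"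
    by (auto simp: eventually_sequentially)
  define s where "s = real n"
  have s: "s > 0" and ps: "prob {x. s < norm x} < 1 / 1024" using n by (auto simp: s_def)
  have q: "prob {x. norm x \<le> s} \<ge> 1 / 2"
  proof -
    have "{x::'w. norm x \<le> s} = space \<mu> - {x. s < norm x}" by auto
    then have "prob {x. norm x \<le> s} = 1 - prob {x. s < norm x}"
      by (simp only:) (rule prob_compl, simp)
    then show ?thesis using ps by simp
  qed
  define p where "p t = prob {x. t < norm x}" for t
  have mono: "p t' \<le> p t" if "t \<le> t'" for t t'
    unfolding p_def using that by (intro finite_measure_mono) auto
  have p0: "0 \<le> p t" for t unfolding p_def by simp
  \<comment> \<open>For t \<ge> 4 s the crude bound sqrt 2 \<le> 3 / 2 gives (t - s) / sqrt 2 \<ge>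
    t / 2. The factor 2 is the reciprocal of the lower bound on the probability of the ball of
    radius \<open>s\<close>.\<close>
  have double: "p t \<le> 2 * (p (t / 2))\<^sup>2" if t: "t \<ge> 4 * s" for t
  proof -
    have "sqrt 2 \<le> 3 / 2" by (rule real_le_lsqrt) (auto simp: power2_eq_square)
    have "t / 2 * sqrt 2 \<le> t / 2 * (3 / 2)"
      using t s \<open>sqrt 2 \<le> 3 / 2\<close> by (intro mult_left_mono) auto
    also have "\<dots> \<le> t - s" using t by simp
    finally have "t / 2 \<le> (t - s) / sqrt 2" by (simp add: field_simps)
    then have "p ((t - s) / sqrt 2) \<le> p (t / 2)" by (rule mono)
    then have "(p ((t - s) / sqrt 2))\<^sup>2 \<le> (p (t / 2))\<^sup>2" using p0 by (intro power_mono)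
    moreover have "prob {x. norm x \<le> s} * p t \<le> (p ((t - s) / sqrt 2))\<^sup>2"
      unfolding p_def by (rule tail_inequality)
    moreover have "1 / 2 * p t \<le> prob {x. norm x \<le> s} * p t" using q p0 by (intro mult_right_mono)
    ultimately show ?thesis by linarith
  qed
  have bnd: "2 * p (2^n * (4 * s)) \<le> (1 / 512)^Suc n" for n
  proof (induction n)
    case 0
    have "p (4 * s) \<le> p s" using s by (intro mono) simp
    then show ?case using ps by (simp add: p_def)
  next
    case (Suc n)
    have 1: "(1::real) * (4 * s) \<le> 2^Suc n * (4 * s)"
      using s one_le_power[of "2::real" "Suc n"] by (intro mult_right_mono) auto
    have "2 * p (2^Suc n * (4 * s)) \<le> 2 * (2 * (p (2^Suc n * (4 * s) / 2))\<^sup>2)"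
      using 1 by (intro mult_left_mono double) auto
    also have "\<dots> = (2 * p (2^n * (4 * s))) * (2 * p (2^n * (4 * s)))"
      by (simp add: power2_eq_square mult_ac)
    also have "\<dots> \<le> (1 / 512)^Suc n * (1 / 512)"
      using Suc p0 power_le_one[of "1/512::real" n] by (intro mult_mono) (auto intro: order_trans)
    finally show ?case by (simp add: mult.commute)
  qed
  have "p (2^n * (4 * s)) \<le> (1 / 512)^Suc n" for n
    using p0[of "2^n * (4 * s)"] bnd[of n] by linarith
  then show thesis using that[of "4 * s"] s unfolding p_def by simp
qed

text \<open>A sum over the dyadic shells between \<open>2 ^ n * T\<close> and
  \<open>2 ^ Suc n * T\<close>. The exponent 8 is the one that makes the later union bound summable,
  over \<open>2 ^ n\<close> noises and with threshold 2 ^ (n / 4).\<close>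

lemma integrable_norm_power8: "integrable \<mu> (\<lambda>x. norm x ^ 8)"
proof -
  obtain T where T: "T > 0" and tail: "\<And>n. prob {x. 2^n * T < norm x} \<le> (1 / 512)^Suc n"
    using tail_decay by blast
  define g where "g x = ennreal (T^8) + (\<Sum>n. ennreal ((2^Suc n * T)^8) * indicator {x. 2^n * T < norm x} x)" for x :: 'w
  have term_le: "F n \<le> suminf F" for F :: "nat \<Rightarrow> ennreal" and n
    using sum_le_suminf[OF summableI, of "{n}" F] by simp
  have le: "ennreal (norm x ^ 8) \<le> g x" for x :: 'w
  proof (cases "norm x \<le> T")
    case True
    then have "ennreal (norm x ^ 8) \<le> ennreal (T^8)" by (intro ennreal_leI power_mono) auto
    then show ?thesis unfolding g_def by (meson le_iff_add order_trans)
  next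
    case False
    obtain N where "norm x / T < 2^N" using real_arch_pow[of 2 "norm x / T"] by auto
    then have N: "norm x \<le> 2^N * T" using T by (simp add: field_simps)
    define m where "m = (LEAST m. norm x \<le> 2^m * T)"
    have m: "norm x \<le> 2^m * T" unfolding m_def by (rule LeastI[where P="\<lambda>m. norm x \<le> 2^m * T", OF N])
    have "m \<noteq> 0" using m False by (intro notI) simp
    then obtain n where n: "m = Suc n" using not0_implies_Suc by blast
    have "2^n * T < norm x" using not_less_Least[of n "\<lambda>m. norm x \<le> 2^m * T"] n m_def by (simp add: not_le)
    then have "ennreal (norm x ^ 8) \<le> ennreal ((2^Suc n * T)^8) * indicator {x. 2^n * T < norm x} x"
      using m n by (auto intro!: ennreal_leI power_mono)
    also have "\<dots> \<le> (\<Sum>n. ennreal ((2^Suc n * T)^8) * indicator {x. 2^n * T < norm x} x)"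
      by (rule term_le)
    also have "\<dots> \<le> g x" unfolding g_def by simp
    finally show ?thesis .
  qed
  have "(\<integral>\<^sup>+x. ennreal (norm x ^ 8) \<partial>\<mu>) \<le> (\<integral>\<^sup>+x. g x \<partial>\<mu>)" by (intro nn_integral_mono le)
  also have "\<dots> = ennreal (T^8) + (\<Sum>n. ennreal ((2^Suc n * T)^8) * emeasure \<mu> {x. 2^n * T < norm x})"
    unfolding g_def
    by (subst nn_integral_add; (subst nn_integral_suminf)?) (auto simp: emeasure_space_1[simplified] nn_integral_cmult_indicator)
  also have "\<dots> \<le> ennreal (T^8) + (\<Sum>n. ennreal (T^8 * (1/2)^Suc n))"
  proof (intro add_left_mono suminf_le summableI)
    fix n
    have "ennreal ((2^Suc n * T)^8) * emeasure \<mu> {x. 2^n * T < norm x} = ennreal ((2^Suc n * T)^8 * prob {x. 2^n * T < norm x})"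
      using T by (simp add: emeasure_eq_measure ennreal_mult)
    also have "\<dots> \<le> ennreal ((2^Suc n * T)^8 * (1 / 512)^Suc n)"
      using T by (intro ennreal_leI mult_left_mono tail) auto
    also have "(2^Suc n * T)^8 * (1 / 512)^Suc n = T^8 * ((2^8)^Suc n * (1/512)^Suc n)"
      by (simp only: power_mult_distrib power_mult[symmetric] mult.commute mult.left_commute)
    also have "(2^8)^Suc n * (1/512)^Suc n = ((1/2)^Suc n :: real)"
      by (simp only: power_mult_distrib[symmetric]) simp
    finally show "ennreal ((2^Suc n * T)^8) * emeasure \<mu> {x. 2^n * T < norm x} \<le> ennreal (T^8 * (1/2)^Suc n)" .
  qed
  also have "\<dots> < \<infinity>"
  proof -
    have "summable (\<lambda>n. T^8 * (1/2)^Suc n :: real)"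
      by (intro summable_mult) (simp add: summable_geometric)
    then have "(\<Sum>n. ennreal (T^8 * (1/2)^Suc n)) \<noteq> \<top>"
      using T by (intro ennreal_suminf_neq_top) auto
    then show ?thesis by (simp add: less_top[symmetric])
  qed
  finally show ?thesis by (intro integrableI_bounded) auto
qed

lemma integrable_norm_square: "integrable \<mu> (\<lambda>x. (norm x)\<^sup>2)"
proof (rule Bochner_Integration.integrable_bound)
  show "integrable \<mu> (\<lambda>x. 1 + norm x ^ 8)"
    by (intro Bochner_Integration.integrable_add integrable_norm_power8) simp
  have "r\<^sup>2 \<le> 1 + r ^ 8" if "r \<ge> 0" for r :: real
  proof (cases "r \<le> 1")
    case True then show ?thesis using that power_le_one[of r 2] by (smt (verit) zero_le_power)
  next
    case False then show ?thesis using power_increasing[of 2 8 r] by linarith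
  qed
  then show "AE x in \<mu>. norm ((norm x)\<^sup>2) \<le> norm (1 + norm x ^ 8)" by (intro AE_I2) simp
qed measurable

end

section \<open>The Cameron-Martin space\<close>

context gaussian_basis
begin

text \<open>The covariance operator as a Bochner integral, convergent by the second moment of the
  norm. Through it every functional is the \<open>cm_dual\<close> of some vector, so the pre-Hilbert
  space is a copy of the whole dual.\<close>

definition barycenter :: "('w \<Rightarrow>\<^sub>L real) \<Rightarrow> 'w" where
  "barycenter l = (\<integral>w. blinfun_apply l w *\<^sub>R w \<partial>\<mu>)"

lemma functional_barycenter: "blinfun_apply k (barycenter l) = Cov \<mu> l k"
proof -
  have int: "integrable \<mu> (\<lambda>w. blinfun_apply l w *\<^sub>R w)"
  proof (rule Bochner_Integration.integrable_bound)
    show "integrable \<mu> (\<lambda>w. norm l * (norm w)\<^sup>2)" by (intro integrable_mult_right integrable_norm_square)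
    have "\<bar>blinfun_apply l w\<bar> * norm w \<le> norm l * norm w * norm w" for w
      using norm_blinfun[of l w] by (intro mult_right_mono) auto
    then show "AE w in \<mu>. norm (blinfun_apply l w *\<^sub>R w) \<le> norm (norm l * (norm w)\<^sup>2)"
      by (intro AE_I2) (simp add: power2_eq_square mult.assoc)
  qed measurable
  have "blinfun_apply k (barycenter l) = (\<integral>w. blinfun_apply k (blinfun_apply l w *\<^sub>R w) \<partial>\<mu>)"
    unfolding barycenter_def
    by (rule integral_bounded_linear[OF blinfun.bounded_linear_right int, symmetric])
  then show ?thesis by (simp add: Cov_def blinfun.scaleR_right)
qed

lemma barycenter_unique: "(\<And>k. Cov \<mu> l k = blinfun_apply k h) \<Longrightarrow> h = barycenter l"
  by (rule eqI_functionals) (simp add: functional_barycenter)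

lemma barycenter_diff: "barycenter (l - l') = barycenter l - barycenter l'"
  by (rule barycenter_unique[symmetric]) (simp add: blinfun.diff_right functional_barycenter Cov_diff_left)

lemma barycenter_add: "barycenter (l + l') = barycenter l + barycenter l'"
  by (rule barycenter_unique[symmetric]) (simp add: blinfun.add_right functional_barycenter Cov_add_left)

lemma barycenter_scaleR: "barycenter (c *\<^sub>R l) = c *\<^sub>R barycenter l"
  by (rule barycenter_unique[symmetric]) (simp add: blinfun.scaleR_right functional_barycenter Cov_scaleR_left)

lemma cm_pre_eq: "cm_pre \<mu> = range barycenter"
proof
  show "cm_pre \<mu> \<subseteq> range barycenter"
  proof
    fix h assume "h \<in> cm_pre \<mu>"
    then obtain l where "\<And>k. Cov \<mu> l k = blinfun_apply k h" unfolding cm_pre_def by auto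
    then have "h = barycenter l" by (rule barycenter_unique)
    then show "h \<in> range barycenter" by simp
  qed
  show "range barycenter \<subseteq> cm_pre \<mu>"
    unfolding cm_pre_def by (auto simp: functional_barycenter)
qed

lemma cm_dual_barycenter: "cm_dual \<mu> (barycenter l) = l"
  unfolding cm_dual_def
proof (rule some_equality)
  show "\<forall>k. Cov \<mu> l k = blinfun_apply k (barycenter l)" by (simp add: functional_barycenter)
  fix h' assume "\<forall>k. Cov \<mu> h' k = blinfun_apply k (barycenter l)"
  then show "h' = l" by (intro Cov_eqI) (simp add: functional_barycenter)
qed

definition sd :: "('w \<Rightarrow>\<^sub>L real) \<Rightarrow> real" where "sd l = sqrt (Cov \<mu> l l)"

lemma sd_nonneg: "0 \<le> sd l" by (simp add: sd_def Cov_nonneg)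

lemma sd_power2: "(sd l)\<^sup>2 = Cov \<mu> l l" by (simp add: sd_def Cov_nonneg)

lemma Cov_le_sd: "\<bar>Cov \<mu> l k\<bar> \<le> sd l * sd k"
  using Cov_Cauchy_Schwarz by (simp add: sd_def)

lemma sd_add_le: "sd (l + k) \<le> sd l + sd k"
proof (rule power2_le_imp_le)
  show "(sd (l + k))\<^sup>2 \<le> (sd l + sd k)\<^sup>2"
    using Cov_le_sd[of l k]
    by (simp add: sd_power2 power2_sum Cov_add_left Cov_add_right Cov_commute[of k l])
qed (simp add: sd_nonneg)

definition sd_Cauchy :: "(nat \<Rightarrow> 'w \<Rightarrow>\<^sub>L real) \<Rightarrow> bool" where
  "sd_Cauchy a \<longleftrightarrow> (\<forall>\<epsilon>>0. \<exists>N. \<forall>m\<ge>N. \<forall>n\<ge>N. sd (a m - a n) < \<epsilon>)"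

text \<open>It moves the completion to the side of the functionals, where inner products are
  covariances.\<close>

lemma cm_approx_iff:
  "cm_approx \<mu> X h \<longleftrightarrow> (\<exists>a. X = (\<lambda>n. barycenter (a n)) \<and> sd_Cauchy a \<and> (\<lambda>n. barycenter (a n)) \<longlonglongrightarrow> h)"
proof
  have norm: "cm_pre_norm \<mu> (barycenter l - barycenter k) = sd (l - k)" for l k
    by (simp add: cm_pre_norm_def cm_pre_inner_def cm_dual_barycenter sd_def flip: barycenter_diff)
  {
    assume X: "cm_approx \<mu> X h"
    then have "\<forall>n. \<exists>l. X n = barycenter l" unfolding cm_approx_def cm_pre_eq by blast
    then obtain a where a: "\<And>n. X n = barycenter (a n)" by metis
    then have "X = (\<lambda>n. barycenter (a n))" by (intro ext)
    then show "\<exists>a. X = (\<lambda>n. barycenter (a n)) \<and> sd_Cauchy a \<and> (\<lambda>n. barycenter (a n)) \<longlonglongrightarrow> h"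
      using X unfolding cm_approx_def sd_Cauchy_def by (intro exI[of _ a]) (auto simp: norm)
  next
    assume "\<exists>a. X = (\<lambda>n. barycenter (a n)) \<and> sd_Cauchy a \<and> (\<lambda>n. barycenter (a n)) \<longlonglongrightarrow> h"
    then show "cm_approx \<mu> X h"
      unfolding cm_approx_def sd_Cauchy_def cm_pre_eq by (auto simp: norm)
  }
qed

lemma sd_Cauchy_bounded:
  assumes "sd_Cauchy a"
  obtains K where "K > 0" "\<And>n. sd (a n) \<le> K"
proof -
  obtain N where N: "\<And>m n. m \<ge> N \<Longrightarrow> n \<ge> N \<Longrightarrow> sd (a m - a n) < 1"
    using assms unfolding sd_Cauchy_def by (meson zero_less_one)
  define K where "K = Max ((\<lambda>n. sd (a n)) ` {..N}) + 1"
  have le: "sd (a n) + 1 \<le> K" if "n \<le> N" for n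
    unfolding K_def using that by (intro add_right_mono Max_ge) auto
  have "sd (a n) \<le> K" for n
  proof (cases "n \<le> N")
    case False
    then show ?thesis using sd_add_le[of "a n - a N" "a N"] N[of n N] le[of N] by simp
  qed (use le[of n] in simp)
  moreover have "K > 0" using le[of N] sd_nonneg[of "a N"] by simp
  ultimately show thesis using that by blast
qed

lemma sd_Cauchy_comb:
  assumes "sd_Cauchy a" "sd_Cauchy b"
  shows "sd_Cauchy (\<lambda>n. a n + c *\<^sub>R b n)"
  unfolding sd_Cauchy_def
proof (intro allI impI)
  fix \<epsilon> :: real assume \<epsilon>: "\<epsilon> > 0"
  have sc: "sd (c *\<^sub>R l) = \<bar>c\<bar> * sd l" for l
    by (simp add: sd_def Cov_scaleR_left Cov_scaleR_right real_sqrt_mult flip: mult.assoc)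
  have "\<epsilon> / 2 > 0" "\<epsilon> / (2 * (\<bar>c\<bar> + 1)) > 0" using \<epsilon> by auto
  then obtain N N' where N: "\<And>m n. m \<ge> N \<Longrightarrow> n \<ge> N \<Longrightarrow> sd (a m - a n) < \<epsilon> / 2"
    and N': "\<And>m n. m \<ge> N' \<Longrightarrow> n \<ge> N' \<Longrightarrow> sd (b m - b n) < \<epsilon> / (2 * (\<bar>c\<bar> + 1))"
    using assms unfolding sd_Cauchy_def by meson
  have "sd (a m + c *\<^sub>R b m - (a n + c *\<^sub>R b n)) < \<epsilon>" if "m \<ge> max N N'" "n \<ge> max N N'" for m n
  proof -
    have "sd (a m + c *\<^sub>R b m - (a n + c *\<^sub>R b n)) \<le> sd (a m - a n) + \<bar>c\<bar> * sd (b m - b n)"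
    proof -
      have "a m + c *\<^sub>R b m - (a n + c *\<^sub>R b n) = (a m - a n) + c *\<^sub>R (b m - b n)"
        by (simp add: algebra_simps)
      then show ?thesis using sd_add_le[of "a m - a n" "c *\<^sub>R (b m - b n)"] by (simp only: sc)
    qed
    also have "\<dots> < \<epsilon> / 2 + \<bar>c\<bar> * sd (b m - b n)" using N that by simp
    also have "\<bar>c\<bar> * sd (b m - b n) \<le> (\<bar>c\<bar> + 1) * (\<epsilon> / (2 * (\<bar>c\<bar> + 1)))"
      using N'[of m n] that sd_nonneg by (intro mult_mono) auto
    also have "(\<bar>c\<bar> + 1) * (\<epsilon> / (2 * (\<bar>c\<bar> + 1))) = \<epsilon> / 2"
      by (simp add: field_simps)
    finally show ?thesis by simp
  qed
  then show "\<exists>N. \<forall>m\<ge>N. \<forall>n\<ge>N. sd (a m + c *\<^sub>R b m - (a n + c *\<^sub>R b n)) < \<epsilon>" by blast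
qed

text \<open>Injectivity of the embedding of the completion.\<close>

lemma sd_Cauchy_null:
  assumes a: "sd_Cauchy a" and lim: "(\<lambda>n. barycenter (a n)) \<longlonglongrightarrow> 0"
  shows "(\<lambda>n. sd (a n)) \<longlonglongrightarrow> 0"
proof -
  obtain K where K: "K > 0" "\<And>n. sd (a n) \<le> K" using sd_Cauchy_bounded[OF a] by blast
  have "(\<lambda>n. Cov \<mu> (a n) (a n)) \<longlonglongrightarrow> 0"
  proof (rule LIMSEQ_I)
    fix \<epsilon> :: real assume \<epsilon>: "\<epsilon> > 0"
    then have "\<epsilon> / (2 * K) > 0" using K by simp
    then obtain N where N: "\<And>m n. m \<ge> N \<Longrightarrow> n \<ge> N \<Longrightarrow> sd (a m - a n) < \<epsilon> / (2 * K)"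
      using a unfolding sd_Cauchy_def by meson
    have "Cov \<mu> (a n) (a n) \<le> \<epsilon> / 2" if n: "n \<ge> N" for n
    proof -
      \<comment> \<open>With \<open>n\<close> fixed and \<open>m\<close> growing, the continuous
        functional \<open>a n\<close> sends \<open>barycenter (a m)\<close> to 0; only the Cauchy
        error remains.\<close>
      have "(\<lambda>m. \<epsilon> / 2 + blinfun_apply (a n) (barycenter (a m))) \<longlonglongrightarrow> \<epsilon> / 2 + blinfun_apply (a n) 0"
        by (intro tendsto_intros lim)
      moreover have "Cov \<mu> (a n) (a n) \<le> \<epsilon> / 2 + blinfun_apply (a n) (barycenter (a m))" if m: "m \<ge> N" for m
      proof -
        have "Cov \<mu> (a n) (a n) = Cov \<mu> (a n - a m) (a n) + Cov \<mu> (a m) (a n)" by (simp add: Cov_diff_left)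
        also have "Cov \<mu> (a n - a m) (a n) \<le> sd (a n - a m) * sd (a n)" using Cov_le_sd abs_le_D1 by blast
        also have "\<dots> \<le> \<epsilon> / (2 * K) * K" using N[OF n m] K \<epsilon> sd_nonneg by (intro mult_mono) auto
        also have "\<dots> = \<epsilon> / 2" using K by simp
        finally show ?thesis by (simp add: functional_barycenter)
      qed
      ultimately show ?thesis
        by (intro LIMSEQ_le_const[where X="\<lambda>m. \<epsilon> / 2 + blinfun_apply (a n) (barycenter (a m))"]) auto
    qed
    then show "\<exists>N. \<forall>n\<ge>N. norm (Cov \<mu> (a n) (a n) - 0) < \<epsilon>"
      using \<epsilon> Cov_nonneg by (intro exI[of _ N]) (smt (verit) field_sum_of_halves real_norm_def)
  qed
  then have "(\<lambda>n. sqrt (Cov \<mu> (a n) (a n))) \<longlonglongrightarrow> sqrt 0" by (rule tendsto_real_sqrt)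
  then show ?thesis by (simp add: sd_def)
qed

text \<open>This makes the inner product independent of the approximating sequences: two sequences
  with the same limit in the Banach space differ by an \<open>sd\<close>-null sequence, by
  injectivity.\<close>

lemma Cov_sequence_difference:
  assumes a: "sd_Cauchy a" and a': "sd_Cauchy a'" and b: "sd_Cauchy b" and b': "sd_Cauchy b'"
    and la: "(\<lambda>n. barycenter (a n)) \<longlonglongrightarrow> h" "(\<lambda>n. barycenter (a' n)) \<longlonglongrightarrow> h"
    and lb: "(\<lambda>n. barycenter (b n)) \<longlonglongrightarrow> k" "(\<lambda>n. barycenter (b' n)) \<longlonglongrightarrow> k"
  shows "(\<lambda>n. Cov \<mu> (a n) (b n) - Cov \<mu> (a' n) (b' n)) \<longlonglongrightarrow> 0"
proof -
  obtain K where K: "K > 0" "\<And>n. sd (b n) \<le> K" using sd_Cauchy_bounded[OF b] by blast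
  obtain K' where K': "K' > 0" "\<And>n. sd (a' n) \<le> K'" using sd_Cauchy_bounded[OF a'] by blast
  have null: "(\<lambda>n. sd (x n - y n)) \<longlonglongrightarrow> 0"
    if "sd_Cauchy x" "sd_Cauchy y" "(\<lambda>n. barycenter (x n)) \<longlonglongrightarrow> z" "(\<lambda>n. barycenter (y n)) \<longlonglongrightarrow> z" for x y z
  proof (rule sd_Cauchy_null)
    show "sd_Cauchy (\<lambda>n. x n - y n)" using sd_Cauchy_comb[OF that(1,2), of "-1"] by simp
    show "(\<lambda>n. barycenter (x n - y n)) \<longlonglongrightarrow> 0"
      unfolding barycenter_diff using tendsto_diff[OF that(3,4)] by simp
  qed
  show ?thesis
  proof (rule Lim_null_comparison)
    show "(\<lambda>n. sd (a n - a' n) * K + K' * sd (b n - b' n)) \<longlonglongrightarrow> 0"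
      using null[OF a a' la] null[OF b b' lb]
      by (auto intro!: tendsto_eq_intros)
    have "\<bar>Cov \<mu> (a n) (b n) - Cov \<mu> (a' n) (b' n)\<bar> \<le> sd (a n - a' n) * K + K' * sd (b n - b' n)" for n
    proof -
      have "Cov \<mu> (a n) (b n) - Cov \<mu> (a' n) (b' n) = Cov \<mu> (a n - a' n) (b n) + Cov \<mu> (a' n) (b n - b' n)"
        by (simp add: Cov_diff_left Cov_diff_right)
      also have "\<bar>\<dots>\<bar> \<le> sd (a n - a' n) * sd (b n) + sd (a' n) * sd (b n - b' n)"
        using Cov_le_sd[of "a n - a' n" "b n"] Cov_le_sd[of "a' n" "b n - b' n"] by linarith
      also have "\<dots> \<le> sd (a n - a' n) * K + K' * sd (b n - b' n)"
        using K K' sd_nonneg by (intro add_mono mult_mono) (auto simp: less_imp_le)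
      finally show ?thesis .
    qed
    then show "\<forall>\<^sub>F n in sequentially. norm (Cov \<mu> (a n) (b n) - Cov \<mu> (a' n) (b' n)) \<le> sd (a n - a' n) * K + K' * sd (b n - b' n)"
      by simp
  qed
qed

lemma convergent_Cov:
  assumes a: "sd_Cauchy a" and b: "sd_Cauchy b"
  shows "convergent (\<lambda>n. Cov \<mu> (a n) (b n))"
proof (rule Cauchy_convergent, rule CauchyI)
  fix \<epsilon> :: real assume \<epsilon>: "\<epsilon> > 0"
  obtain K where K: "K > 0" "\<And>n. sd (b n) \<le> K" using sd_Cauchy_bounded[OF b] by blast
  obtain K' where K': "K' > 0" "\<And>n. sd (a n) \<le> K'" using sd_Cauchy_bounded[OF a] by blast
  have "\<epsilon> / (2 * K) > 0" "\<epsilon> / (2 * K') > 0" using \<epsilon> K K' by auto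
  then obtain N N' where N: "\<And>m n. m \<ge> N \<Longrightarrow> n \<ge> N \<Longrightarrow> sd (a m - a n) < \<epsilon> / (2 * K)"
    and N': "\<And>m n. m \<ge> N' \<Longrightarrow> n \<ge> N' \<Longrightarrow> sd (b m - b n) < \<epsilon> / (2 * K')"
    using a b unfolding sd_Cauchy_def by meson
  have "norm (Cov \<mu> (a m) (b m) - Cov \<mu> (a n) (b n)) < \<epsilon>" if mn: "m \<ge> max N N'" "n \<ge> max N N'" for m n
  proof -
    have "Cov \<mu> (a m) (b m) - Cov \<mu> (a n) (b n) = Cov \<mu> (a m - a n) (b m) + Cov \<mu> (a n) (b m - b n)"
      by (simp add: Cov_diff_left Cov_diff_right)
    also have "\<bar>\<dots>\<bar> \<le> sd (a m - a n) * sd (b m) + sd (a n) * sd (b m - b n)"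
      using Cov_le_sd[of "a m - a n" "b m"] Cov_le_sd[of "a n" "b m - b n"] by linarith
    also have "\<dots> \<le> sd (a m - a n) * K + K' * sd (b m - b n)"
      using K K' sd_nonneg by (intro add_mono mult_mono) (auto simp: less_imp_le)
    also have "\<dots> < \<epsilon> / (2 * K) * K + K' * (\<epsilon> / (2 * K'))"
      using N[of m n] N'[of m n] mn K K' by (intro add_strict_mono mult_strict_right_mono mult_strict_left_mono) auto
    also have "\<dots> = \<epsilon>" using K K' by simp
    finally show ?thesis by simp
  qed
  then show "\<exists>N. \<forall>m\<ge>N. \<forall>n\<ge>N. norm (Cov \<mu> (a m) (b m) - Cov \<mu> (a n) (b n)) < \<epsilon>" by blast
qed

text \<open>It discharges the definite description in \<open>cm_inner\<close>; from here on any
  approximating sequences may be chosen.\<close>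

lemma cm_inner_tendsto:
  assumes a: "sd_Cauchy a" "(\<lambda>n. barycenter (a n)) \<longlonglongrightarrow> h"
    and b: "sd_Cauchy b" "(\<lambda>n. barycenter (b n)) \<longlonglongrightarrow> k"
  shows "(\<lambda>n. Cov \<mu> (a n) (b n)) \<longlonglongrightarrow> cm_inner \<mu> h k"
proof -
  obtain r where r: "(\<lambda>n. Cov \<mu> (a n) (b n)) \<longlonglongrightarrow> r"
    using convergent_Cov[OF a(1) b(1)] unfolding convergent_def by blast
  have "cm_inner \<mu> h k = r"
    unfolding cm_inner_def
  proof (rule the_equality)
    show "\<exists>X Y. cm_approx \<mu> X h \<and> cm_approx \<mu> Y k \<and> (\<lambda>n. cm_pre_inner \<mu> (X n) (Y n)) \<longlonglongrightarrow> r"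
      using a b r
      by (intro exI[of _ "\<lambda>n. barycenter (a n)"] exI[of _ "\<lambda>n. barycenter (b n)"])
         (auto simp: cm_approx_iff cm_pre_inner_def cm_dual_barycenter)
  next
    fix r' assume "\<exists>X Y. cm_approx \<mu> X h \<and> cm_approx \<mu> Y k \<and> (\<lambda>n. cm_pre_inner \<mu> (X n) (Y n)) \<longlonglongrightarrow> r'"
    then obtain a' b' where a': "sd_Cauchy a'" "(\<lambda>n. barycenter (a' n)) \<longlonglongrightarrow> h"
      and b': "sd_Cauchy b'" "(\<lambda>n. barycenter (b' n)) \<longlonglongrightarrow> k"
      and r': "(\<lambda>n. Cov \<mu> (a' n) (b' n)) \<longlonglongrightarrow> r'"
      unfolding cm_approx_iff cm_pre_inner_def by (auto simp: cm_dual_barycenter)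
    have "(\<lambda>n. Cov \<mu> (a' n) (b' n) - Cov \<mu> (a n) (b n)) \<longlonglongrightarrow> 0"
      by (rule Cov_sequence_difference[OF a'(1) a(1) b'(1) b(1) a'(2) a(2) b'(2) b(2)])
    moreover have "(\<lambda>n. Cov \<mu> (a' n) (b' n) - Cov \<mu> (a n) (b n)) \<longlonglongrightarrow> r' - r"
      by (intro tendsto_diff r r')
    ultimately have "r' - r = 0" using LIMSEQ_unique by blast
    then show "r' = r" by simp
  qed
  then show ?thesis using r by simp
qed

lemma cm_spaceE:
  assumes "h \<in> cm_space \<mu>"
  obtains a where "sd_Cauchy a" "(\<lambda>n. barycenter (a n)) \<longlonglongrightarrow> h"
  using assms unfolding cm_space_def cm_approx_iff by blast

lemma cm_spaceI: "sd_Cauchy a \<Longrightarrow> (\<lambda>n. barycenter (a n)) \<longlonglongrightarrow> h \<Longrightarrow> h \<in> cm_space \<mu>"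
  unfolding cm_space_def cm_approx_iff by blast

lemma sd_Cauchy_const: "sd_Cauchy (\<lambda>_. l)"
  by (auto simp: sd_Cauchy_def sd_def)

lemma barycenter_in_cm_space: "barycenter l \<in> cm_space \<mu>"
  by (rule cm_spaceI[OF sd_Cauchy_const[of l]]) simp

lemma cm_comb:
  assumes h: "h \<in> cm_space \<mu>" and g: "g \<in> cm_space \<mu>"
  shows "h + c *\<^sub>R g \<in> cm_space \<mu>"
    and "k \<in> cm_space \<mu> \<Longrightarrow> cm_inner \<mu> (h + c *\<^sub>R g) k = cm_inner \<mu> h k + c * cm_inner \<mu> g k"
proof -
  obtain a where a: "sd_Cauchy a" "(\<lambda>n. barycenter (a n)) \<longlonglongrightarrow> h" using cm_spaceE[OF h] by blast
  obtain b where b: "sd_Cauchy b" "(\<lambda>n. barycenter (b n)) \<longlonglongrightarrow> g" using cm_spaceE[OF g] by blast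
  have lim: "(\<lambda>n. barycenter (a n + c *\<^sub>R b n)) \<longlonglongrightarrow> h + c *\<^sub>R g"
    unfolding barycenter_add barycenter_scaleR by (intro tendsto_intros a b)
  show "h + c *\<^sub>R g \<in> cm_space \<mu>" by (rule cm_spaceI[OF sd_Cauchy_comb[OF a(1) b(1)] lim])
  assume k: "k \<in> cm_space \<mu>"
  obtain d where d: "sd_Cauchy d" "(\<lambda>n. barycenter (d n)) \<longlonglongrightarrow> k" using cm_spaceE[OF k] by blast
  have "(\<lambda>n. Cov \<mu> (a n + c *\<^sub>R b n) (d n)) \<longlonglongrightarrow> cm_inner \<mu> (h + c *\<^sub>R g) k"
    by (rule cm_inner_tendsto[OF sd_Cauchy_comb[OF a(1) b(1)] lim d])
  moreover have "(\<lambda>n. Cov \<mu> (a n + c *\<^sub>R b n) (d n)) \<longlonglongrightarrow> cm_inner \<mu> h k + c * cm_inner \<mu> g k"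
    unfolding Cov_add_left Cov_scaleR_left by (intro tendsto_intros cm_inner_tendsto a b d)
  ultimately show "cm_inner \<mu> (h + c *\<^sub>R g) k = cm_inner \<mu> h k + c * cm_inner \<mu> g k"
    using LIMSEQ_unique by blast
qed

text \<open>The reproducing property: evaluating a functional is taking an inner product, so
  functionals are continuous in the Cameron-Martin norm.\<close>

lemma cm_inner_barycenter:
  assumes h: "h \<in> cm_space \<mu>"
  shows "cm_inner \<mu> h (barycenter l) = blinfun_apply l h" "cm_inner \<mu> (barycenter l) h = blinfun_apply l h"
proof -
  obtain a where a: "sd_Cauchy a" "(\<lambda>n. barycenter (a n)) \<longlonglongrightarrow> h" using cm_spaceE[OF h] by blast
  have "(\<lambda>n. Cov \<mu> (a n) l) \<longlonglongrightarrow> blinfun_apply l h"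
    unfolding functional_barycenter[symmetric] by (intro tendsto_intros a)
  then show "cm_inner \<mu> h (barycenter l) = blinfun_apply l h" "cm_inner \<mu> (barycenter l) h = blinfun_apply l h"
    using cm_inner_tendsto[OF a sd_Cauchy_const, of l "barycenter l"]
      cm_inner_tendsto[OF sd_Cauchy_const _ a, of l "barycenter l"] LIMSEQ_unique
    by (auto simp: Cov_commute[of l])
qed

lemma cm_inner_le:
  assumes h: "h \<in> cm_space \<mu>" and k: "k \<in> cm_space \<mu>"
  shows "\<bar>cm_inner \<mu> h k\<bar> \<le> cm_norm \<mu> h * cm_norm \<mu> k"
proof -
  obtain a where a: "sd_Cauchy a" "(\<lambda>n. barycenter (a n)) \<longlonglongrightarrow> h" using cm_spaceE[OF h] by blast
  obtain b where b: "sd_Cauchy b" "(\<lambda>n. barycenter (b n)) \<longlonglongrightarrow> k" using cm_spaceE[OF k] by blast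
  have "(\<lambda>n. \<bar>Cov \<mu> (a n) (b n)\<bar>) \<longlonglongrightarrow> \<bar>cm_inner \<mu> h k\<bar>"
    by (intro tendsto_intros cm_inner_tendsto a b)
  moreover have "(\<lambda>n. sqrt (Cov \<mu> (a n) (a n)) * sqrt (Cov \<mu> (b n) (b n))) \<longlonglongrightarrow> cm_norm \<mu> h * cm_norm \<mu> k"
    unfolding cm_norm_def by (intro tendsto_intros cm_inner_tendsto a b)
  ultimately show ?thesis
    by (rule LIMSEQ_le) (use Cov_Cauchy_Schwarz in auto)
qed

text \<open>By biorthogonality and orthonormality, \<open>f k\<close> is the inner product with
  \<open>e k\<close> on the span of the basis. Both are continuous in the Cameron-Martin norm and
  the span is dense, so they agree on the whole space, in particular at \<open>barycenter l\<close>.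
  This links the Schauder coordinates to the covariance.\<close>

theorem Cov_coordinate:
  assumes onb: "cm_orthonormal_basis \<mu> e"
  shows "Cov \<mu> (f k) l = blinfun_apply l (e k)"
proof -
  have e: "e j \<in> cm_space \<mu>" for j using onb unfolding cm_orthonormal_basis_def by blast
  have orth: "cm_inner \<mu> (e j) (e k) = (if j = k then 1 else 0)" for j k
    using onb unfolding cm_orthonormal_basis_def by blast
  have "cm_norm \<mu> (e k) = 1" by (simp add: cm_norm_def orth)
  have span: "g \<in> cm_space \<mu> \<and> f k g = cm_inner \<mu> g (e k)" if "g \<in> span (range e)" for g
    using that
  proof (induction rule: span_induct_alt)
    case base
    have "0 \<in> cm_space \<mu>" using barycenter_in_cm_space[of 0] barycenter_diff[of 0 0] by simp
    then show ?case
      using cm_comb(2)[OF \<open>0 \<in> cm_space \<mu>\<close> \<open>0 \<in> cm_space \<mu>\<close> e, of 1 k] by simp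
  next
    case (step c x y)
    then obtain j where x: "x = e j" by blast
    show ?case
      using cm_comb(1)[OF conjunct1[OF step.IH] e, of c j] cm_comb(2)[OF conjunct1[OF step.IH] e e, of c j k] step.IH
      by (simp add: x add.commute blinfun.add_right blinfun.scaleR_right biorthogonal orth)
  qed
  define h where "h = barycenter l"
  have h: "h \<in> cm_space \<mu>" unfolding h_def by (rule barycenter_in_cm_space)
  have "\<bar>f k h - blinfun_apply l (e k)\<bar> \<le> \<epsilon> * (cm_norm \<mu> (barycenter (f k)) + 1)" if \<epsilon>: "\<epsilon> > 0" for \<epsilon>
  proof -
    obtain g where g: "g \<in> span (range e)" "cm_norm \<mu> (h - g) < \<epsilon>"
      using onb h \<epsilon> unfolding cm_orthonormal_basis_def by blast
    note gs = span[OF g(1)]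
    have d: "h - g \<in> cm_space \<mu>" using cm_comb(1)[OF h conjunct1[OF gs], of "-1"] by simp
    have i1: "cm_inner \<mu> (h - g) (e k) = cm_inner \<mu> h (e k) - cm_inner \<mu> g (e k)"
      using cm_comb(2)[OF h conjunct1[OF gs] e, of "-1" k] by simp
    have "f k h - blinfun_apply l (e k) = cm_inner \<mu> (h - g) (barycenter (f k)) - cm_inner \<mu> (h - g) (e k)"
      using gs unfolding i1 cm_inner_barycenter(1)[OF d] by (simp add: h_def cm_inner_barycenter(2)[OF e] blinfun.diff_right)
    also have "\<bar>\<dots>\<bar> \<le> cm_norm \<mu> (h - g) * cm_norm \<mu> (barycenter (f k)) + cm_norm \<mu> (h - g) * cm_norm \<mu> (e k)"
      using cm_inner_le[OF d barycenter_in_cm_space, of "f k"] cm_inner_le[OF d e, of k] by linarith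
    also have "\<dots> = cm_norm \<mu> (h - g) * (cm_norm \<mu> (barycenter (f k)) + 1)"
      by (simp add: \<open>cm_norm \<mu> (e k) = 1\<close> ring_distribs)
    also have "\<dots> \<le> \<epsilon> * (cm_norm \<mu> (barycenter (f k)) + 1)"
    proof (rule mult_right_mono)
      show "0 \<le> cm_norm \<mu> (barycenter (f k)) + 1"
        by (simp add: cm_norm_def cm_inner_barycenter[OF barycenter_in_cm_space] functional_barycenter Cov_nonneg)
    qed (use g in simp)
    finally show ?thesis .
  qed
  note * = this
  have "f k h - blinfun_apply l (e k) = 0"
  proof (rule ccontr)
    let ?d = "\<bar>f k h - blinfun_apply l (e k)\<bar>" and ?K = "cm_norm \<mu> (barycenter (f k)) + 1"
    assume "f k h - blinfun_apply l (e k) \<noteq> 0"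
    then have d: "?d > 0" by simp
    have K: "?K > 0"
      by (simp add: cm_norm_def cm_inner_barycenter[OF barycenter_in_cm_space] functional_barycenter Cov_nonneg add_nonneg_pos)
    \<comment> \<open>The choice \<epsilon> = d / (2 K) bounds the positive d by d / 2.\<close>
    have "?d \<le> ?d / (2 * ?K) * ?K" using d K by (intro *) simp
    moreover have "\<not> d \<le> d / (2 * K) * K" if "d > 0" "K > 0" for d K :: real using that by simp
    ultimately show False using d K by blast
  qed
  then show ?thesis by (simp add: h_def functional_barycenter Cov_commute)
qed

end

section \<open>The reflection coupling\<close>

definition unif :: "real measure" where "unif = uniform_measure lborel {0..1}"

lemma prob_space_unif: "prob_space unif"
  unfolding unif_def by (intro prob_space_uniform_measure) auto

interpretation unif: prob_space unif by (rule prob_space_unif)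

lemma sets_unif [measurable_cong, simp]: "sets unif = sets borel"
  by (simp add: unif_def)

lemma space_unif [simp]: "space unif = UNIV"
  by (simp add: unif_def)

lemma emeasure_unif_le:
  assumes "0 \<le> a"
  shows "emeasure unif {..a} = ennreal (min 1 a)" "emeasure unif {a<..} = ennreal (1 - min 1 a)"
proof -
  have "{0..1} \<inter> {..a} = {0..min 1 a}" by auto
  then have "emeasure unif {..a} = emeasure lborel {0..min 1 a}"
    by (simp add: unif_def divide_ennreal_def)
  then show 1: "emeasure unif {..a} = ennreal (min 1 a)" using assms by simp
  have "{a<..} = space unif - {..a}" by auto
  then have "emeasure unif {a<..} = emeasure unif (space unif) - emeasure unif {..a}"
    by (simp only:) (rule emeasure_compl, auto)
  then show "emeasure unif {a<..} = ennreal (1 - min 1 a)"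
    using assms unif.emeasure_space_1 by (simp add: 1 ennreal_minus[symmetric] del: ennreal_minus)
qed

text \<open>The maximal coupling of \<open>N(q, q)\<close> with \<open>N(0, q)\<close> by reflection: the translate \<open>t + q\<close> is accepted
  with probability \<open>min 1 (\<phi> (t + q) / \<phi> t)\<close>, which is \<open>min 1 (exp (- t - q / 2))\<close> for the density \<open>\<phi>\<close> of \<open>N(0, q)\<close>.\<close>

definition reflect_step :: "real \<Rightarrow> real \<Rightarrow> real \<Rightarrow> real" where
  "reflect_step q t u = (if u \<le> exp (- t - q / 2) then t + q else - t)"

lemma normal_shift: "0 < q \<Longrightarrow> normal_density 0 (sqrt q) (t + q) = normal_density 0 (sqrt q) t * exp (- t - q / 2)"
  unfolding normal_density_def by (simp add: exp_add[symmetric] power2_eq_square field_simps)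

lemma normal_even: "normal_density 0 \<sigma> (- t) = normal_density 0 \<sigma> t"
  unfolding normal_density_def by simp

text \<open>With m t the minimum of \<phi> t and \<phi> (t + q), the accepted mass m t travels to t
  + q and the rejected mass \<phi> t - m t to - t. By the symmetry of \<phi>, m (t - q) = m (- t),
  so the masses arriving at a point from either side add up to \<phi>.\<close>

lemma reflect_step_invariant:
  assumes q: "0 < q" and A [measurable]: "A \<in> sets borel"
  defines "\<nu> \<equiv> density lborel (normal_density 0 (sqrt q))"
  shows "(\<integral>\<^sup>+t. \<integral>\<^sup>+u. indicator A (reflect_step q t u) \<partial>unif \<partial>\<nu>) = emeasure \<nu> A"
proof -
  let ?\<phi> = "normal_density 0 (sqrt q)"
  define m where "m t = min (?\<phi> t) (?\<phi> (t + q))" for t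
  have m [measurable]: "m \<in> borel_measurable borel" unfolding m_def by measurable
  have m0: "0 \<le> m t" "m t \<le> ?\<phi> t" for t unfolding m_def by simp_all
  have m_acc: "?\<phi> t * min 1 (exp (- t - q / 2)) = m t" for t
    by (simp add: m_def normal_shift[OF q] min_mult_distrib_left)
  have m_sym: "m (t - q) = m (- t)" for t
    using normal_even[of "sqrt q" t] normal_even[of "sqrt q" "t - q"] by (simp add: m_def min.commute)
  have inner: "(\<integral>\<^sup>+u. indicator A (reflect_step q t u) \<partial>unif)
      = ennreal (min 1 (exp (- t - q / 2))) * indicator A (t + q) + ennreal (1 - min 1 (exp (- t - q / 2))) * indicator A (- t)" for t
  proof -
    have "(\<integral>\<^sup>+u. indicator A (reflect_step q t u) \<partial>unif)
        = (\<integral>\<^sup>+u. indicator A (t + q) * indicator {..exp (- t - q / 2)} u + indicator A (- t) * indicator {exp (- t - q / 2)<..} u \<partial>unif)"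
      by (intro nn_integral_cong) (auto simp: reflect_step_def split: split_indicator)
    also have "\<dots> = indicator A (t + q) * emeasure unif {..exp (- t - q / 2)} + indicator A (- t) * emeasure unif {exp (- t - q / 2)<..}"
      by (subst nn_integral_add) (auto simp: nn_integral_cmult_indicator)
    finally show ?thesis by (simp add: emeasure_unif_le mult.commute)
  qed
  have "(\<integral>\<^sup>+t. \<integral>\<^sup>+u. indicator A (reflect_step q t u) \<partial>unif \<partial>\<nu>)
      = (\<integral>\<^sup>+t. ennreal (?\<phi> t) * (ennreal (min 1 (exp (- t - q / 2))) * indicator A (t + q) + ennreal (1 - min 1 (exp (- t - q / 2))) * indicator A (- t)) \<partial>lborel)"
    unfolding inner \<nu>_def by (subst nn_integral_density) auto
  also have "\<dots> = (\<integral>\<^sup>+t. ennreal (m t) * indicator A (t + q) + ennreal (?\<phi> t - m t) * indicator A (- t) \<partial>lborel)"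
  proof (intro nn_integral_cong)
    fix t
    have "ennreal (?\<phi> t) * ennreal (min 1 (exp (- t - q / 2))) = ennreal (m t)"
      by (simp add: m_acc flip: ennreal_mult)
    moreover have "ennreal (?\<phi> t) * ennreal (1 - min 1 (exp (- t - q / 2))) = ennreal (?\<phi> t - m t)"
      by (simp add: right_diff_distrib m_acc flip: ennreal_mult)
    ultimately show "ennreal (?\<phi> t) * (ennreal (min 1 (exp (- t - q / 2))) * indicator A (t + q) + ennreal (1 - min 1 (exp (- t - q / 2))) * indicator A (- t))
        = ennreal (m t) * indicator A (t + q) + ennreal (?\<phi> t - m t) * indicator A (- t)"
      by (simp add: distrib_left mult.assoc[symmetric])
  qed
  also have "\<dots> = (\<integral>\<^sup>+t. ennreal (m t) * indicator A (t + q) \<partial>lborel) + (\<integral>\<^sup>+t. ennreal (?\<phi> t - m t) * indicator A (- t) \<partial>lborel)"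
    by (rule nn_integral_add) auto
  also have "(\<integral>\<^sup>+t. ennreal (m t) * indicator A (t + q) \<partial>lborel) = (\<integral>\<^sup>+t. ennreal (m (- t)) * indicator A t \<partial>lborel)"
    by (subst nn_integral_real_affine[where c=1 and t="-q"]) (auto simp: m_sym[symmetric])
  also have "(\<integral>\<^sup>+t. ennreal (?\<phi> t - m t) * indicator A (- t) \<partial>lborel) = (\<integral>\<^sup>+t. ennreal (?\<phi> t - m (- t)) * indicator A t \<partial>lborel)"
    by (subst nn_integral_real_affine[where c="-1" and t=0]) (auto simp: normal_even)
  also have "(\<integral>\<^sup>+t. ennreal (m (- t)) * indicator A t \<partial>lborel) + (\<integral>\<^sup>+t. ennreal (?\<phi> t - m (- t)) * indicator A t \<partial>lborel)
     = (\<integral>\<^sup>+t. ennreal (m (- t)) * indicator A t + ennreal (?\<phi> t - m (- t)) * indicator A t \<partial>lborel)"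
    by (rule nn_integral_add[symmetric]) auto
  also have "\<dots> = (\<integral>\<^sup>+t. ennreal (?\<phi> t) * indicator A t \<partial>lborel)"
    using m0 normal_even[of "sqrt q"] by (intro nn_integral_cong) (metis (no_types, lifting) add.commute diff_add_cancel diff_ge_0_iff_ge distrib_right ennreal_plus)
  also have "\<dots> = emeasure \<nu> A" unfolding \<nu>_def by (simp add: emeasure_density)
  finally show ?thesis .
qed

lemma centered_gaussian_real_variance:
  assumes "centered_gaussian_real \<nu>" "(LINT x|\<nu>. x\<^sup>2) = q" "q > 0"
  shows "\<nu> = density lborel (normal_density 0 (sqrt q))"
  using assms(1) unfolding centered_gaussian_real_def
proof (elim disjE exE conjE)
  assume "\<nu> = return borel 0"
  then have "(LINT x|\<nu>. x\<^sup>2) = 0" by (simp add: integral_return)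
  then show ?thesis using assms by simp
next
  fix \<sigma> :: real assume \<sigma>: "\<sigma> > 0" and \<nu>: "\<nu> = density lborel (normal_density 0 \<sigma>)"
  have "(LINT x|\<nu>. x\<^sup>2) = (LBINT x. normal_density 0 \<sigma> x * (x - 0) ^ (2 * 1))"
    unfolding \<nu> by (subst integral_density) auto
  also have "\<dots> = fact (2 * 1) / ((2 / \<sigma>\<^sup>2) ^ 1 * fact 1)"
    by (rule integral_normal_moment_even[OF \<sigma>])
  also have "\<dots> = \<sigma>\<^sup>2" by simp
  finally have "(LINT x|\<nu>. x\<^sup>2) = \<sigma>\<^sup>2" .
  then have "\<sigma> = sqrt q" using assms(2) \<sigma> by simp
  then show ?thesis using \<nu> by simp
qed

lemma emeasure_distr_nn_integral:
  assumes "F \<in> M \<rightarrow>\<^sub>M N" "A \<in> sets N"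
  shows "emeasure (distr M N F) A = (\<integral>\<^sup>+x. indicator A (F x) \<partial>M)"
proof -
  have "emeasure (distr M N F) A = (\<integral>\<^sup>+x. indicator A x \<partial>distr M N F)"
    using assms(2) by simp
  also have "\<dots> = (\<integral>\<^sup>+x. indicator A (F x) \<partial>M)"
    using assms by (intro nn_integral_distr) auto
  finally show ?thesis .
qed

section \<open>Reflection in one direction of the Banach space\<close>

context gaussian_basis
begin

text \<open>The component of \<open>z\<close> in the direction \<open>h\<close> is exchanged for
  that of an independent copy, which takes the place of conditioning on the rest of
  \<open>z\<close>. Each \<open>k\<close> splits into a multiple of \<open>l\<close> and a part
  uncorrelated with \<open>l\<close>, and the exchange preserves the sum of their variances.\<close>

lemma resample_direction:
  assumes dual: "\<And>k. Cov \<mu> l k = blinfun_apply k h" and q: "Cov \<mu> l l = q" "q \<noteq> 0"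
  shows "distr (\<mu> \<Otimes>\<^sub>M \<mu>) borel (\<lambda>(z, z'). z + ((blinfun_apply l z' - blinfun_apply l z) / q) *\<^sub>R h) = \<mu>"
    (is "distr _ _ ?R = _")
proof (rule measure_eqI_functionals)
  interpret P: pair_prob_space \<mu> \<mu> ..
  have R: "?R \<in> borel_measurable (\<mu> \<Otimes>\<^sub>M \<mu>)" by measurable
  show "finite_measure (distr (\<mu> \<Otimes>\<^sub>M \<mu>) borel ?R)" by (rule P.finite_measure_distr[OF R])
  show "finite_measure \<mu>" by (rule finite_measure_axioms)
  show "sets (distr (\<mu> \<Otimes>\<^sub>M \<mu>) borel ?R) = sets borel" "sets \<mu> = sets borel" by simp_all
  fix k :: "'w \<Rightarrow>\<^sub>L real"
  define c where "c = blinfun_apply k h / q"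
  have c: "blinfun_apply k h = c * q" using q by (simp add: c_def)
  have kl: "Cov \<mu> k l = c * q" "Cov \<mu> l k = c * q" using dual c Cov_commute by metis+
  have "(CLINT z|distr (\<mu> \<Otimes>\<^sub>M \<mu>) borel ?R. iexp (blinfun_apply k z)) = (CLINT z|\<mu> \<Otimes>\<^sub>M \<mu>. iexp (blinfun_apply k (?R z)))"
    by (rule integral_distr[OF R]) measurable
  also have "\<dots> = (CLINT z|\<mu> \<Otimes>\<^sub>M \<mu>. iexp (blinfun_apply (k - c *\<^sub>R l) (fst z) + blinfun_apply (c *\<^sub>R l) (snd z)))"
    using q by (intro Bochner_Integration.integral_cong refl arg_cong[where f=iexp])
      (auto simp: blinfun.add_right blinfun.scaleR_right blinfun.diff_left blinfun.scaleR_left c field_simps)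
  also have "\<dots> = exp (- Cov \<mu> (k - c *\<^sub>R l) (k - c *\<^sub>R l) / 2) * exp (- Cov \<mu> (c *\<^sub>R l) (c *\<^sub>R l) / 2)"
    by (rule char_pair_functional)
  also have "\<dots> = exp (- Cov \<mu> (k - c *\<^sub>R l) (k - c *\<^sub>R l) / 2 + - Cov \<mu> (c *\<^sub>R l) (c *\<^sub>R l) / 2)"
    by (simp only: exp_add of_real_mult)
  also have "- Cov \<mu> (k - c *\<^sub>R l) (k - c *\<^sub>R l) / 2 + - Cov \<mu> (c *\<^sub>R l) (c *\<^sub>R l) / 2 = - Cov \<mu> k k / 2"
    by (simp add: Cov_diff_left Cov_diff_right Cov_scaleR_left Cov_scaleR_right kl q field_simps)
  finally show "(CLINT z|distr (\<mu> \<Otimes>\<^sub>M \<mu>) borel ?R. iexp (blinfun_apply k z)) = (CLINT w|\<mu>. iexp (blinfun_apply k w))"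
    by (simp only: char_functional)
qed

text \<open>The reflection coupling in the direction \<open>h\<close>, which is the gradient of \<open>l\<close> in the Cameron-Martin space.\<close>

lemma reflect_direction:
  assumes dual: "\<And>k. Cov \<mu> l k = blinfun_apply k h" and q: "Cov \<mu> l l = q" "q \<noteq> 0"
  shows "distr (unif \<Otimes>\<^sub>M \<mu>) borel (\<lambda>(u, z). z + ((reflect_step q (blinfun_apply l z) u - blinfun_apply l z) / q) *\<^sub>R h) = \<mu>"
    (is "distr _ _ ?F = _")
proof (rule measure_eqI)
  interpret P: pair_prob_space \<mu> \<mu> ..
  interpret UM: pair_prob_space unif \<mu> ..
  show "sets (distr (unif \<Otimes>\<^sub>M \<mu>) borel ?F) = sets \<mu>" by simp
  fix A assume "A \<in> sets (distr (unif \<Otimes>\<^sub>M \<mu>) borel ?F)"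
  then have A [measurable]: "A \<in> sets borel" by simp
  have q0: "q > 0" using q Cov_nonneg[of l] by simp
  let ?R = "\<lambda>(z, z'). z + ((blinfun_apply l z' - blinfun_apply l z) / q) *\<^sub>R h"
  define Y where "Y z = z - (blinfun_apply l z / q) *\<^sub>R h" for z
  define \<nu> where "\<nu> = distr \<mu> borel (blinfun_apply l)"
  have [measurable]: "Y \<in> borel_measurable borel" unfolding Y_def by measurable
  have [measurable_cong]: "sets \<nu> = sets borel" by (simp add: \<nu>_def)
  interpret N: prob_space \<nu> unfolding \<nu>_def by (rule prob_space_distr) simp
  interpret UN: pair_prob_space \<nu> unif ..
  have lh: "blinfun_apply l h = q" using dual[of l] q by simp
  have [measurable]: "?F \<in> borel_measurable (unif \<Otimes>\<^sub>M \<mu>)" unfolding reflect_step_def by measurable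
  have [measurable]: "?R \<in> borel_measurable (\<mu> \<Otimes>\<^sub>M \<mu>)" by measurable
  have \<nu>: "\<nu> = density lborel (normal_density 0 (sqrt q))"
    unfolding \<nu>_def
  proof (rule centered_gaussian_real_variance[OF functional_gaussian _ q0])
    show "(LINT x|distr \<mu> borel (blinfun_apply l). x\<^sup>2) = q"
      using q by (subst integral_distr) (auto simp: Cov_def power2_eq_square)
  qed
  \<comment> \<open>After resampling, the reflection sees \<open>z\<close> only through the
    transversal part \<open>Y z\<close> and \<open>z'\<close> only through its value under
    \<open>l\<close>. With \<open>Y z\<close> frozen, the problem is one-dimensional.\<close>
  have FR: "?F (u, ?R (z, z')) = Y z + (reflect_step q (blinfun_apply l z') u / q) *\<^sub>R h" for u z z'
  proof -
    have "blinfun_apply l (?R (z, z')) = blinfun_apply l z'"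
      using q by (simp add: blinfun.add_right blinfun.scaleR_right lh)
    then show ?thesis by (simp add: Y_def algebra_simps diff_divide_distrib)
  qed
  have RY: "?R (z, z') = Y z + (blinfun_apply l z' / q) *\<^sub>R h" for z z'
    by (simp add: Y_def diff_divide_distrib algebra_simps)
  have slice: "(\<integral>\<^sup>+t. \<integral>\<^sup>+u. indicator A (y + (reflect_step q t u / q) *\<^sub>R h) \<partial>unif \<partial>\<nu>) = (\<integral>\<^sup>+t. indicator A (y + (t / q) *\<^sub>R h) \<partial>\<nu>)" for y
  proof -
    define B where "B = (\<lambda>t. y + (t / q) *\<^sub>R h) -` A"
    have "B = (\<lambda>t. y + (t / q) *\<^sub>R h) -` A \<inter> space borel" by (simp add: B_def)
    also have "\<dots> \<in> sets borel" by measurable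
    finally have B [measurable]: "B \<in> sets borel" .
    have "indicator A (y + (t / q) *\<^sub>R h) = (indicator B t :: ennreal)" for t
      by (auto simp: B_def split: split_indicator)
    then show ?thesis
      using reflect_step_invariant[OF q0 B] by (simp add: \<nu>)
  qed
  have "emeasure (distr (unif \<Otimes>\<^sub>M \<mu>) borel ?F) A = (\<integral>\<^sup>+p. indicator A (?F p) \<partial>(unif \<Otimes>\<^sub>M \<mu>))"
    by (rule emeasure_distr_nn_integral) measurable
  also have "\<dots> = (\<integral>\<^sup>+u. \<integral>\<^sup>+z. indicator A (?F (u, z)) \<partial>\<mu> \<partial>unif)"
    by (subst nn_integral_fst[symmetric]) auto
  also have "\<dots> = (\<integral>\<^sup>+u. \<integral>\<^sup>+p. indicator A (?F (u, ?R p)) \<partial>(\<mu> \<Otimes>\<^sub>M \<mu>) \<partial>unif)"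
  proof (intro nn_integral_cong)
    fix u
    have m: "(\<lambda>z. indicator A (?F (u, z)) :: ennreal) \<in> borel_measurable borel" by measurable
    have "(\<integral>\<^sup>+z. indicator A (?F (u, z)) \<partial>\<mu>) = (\<integral>\<^sup>+z. indicator A (?F (u, z)) \<partial>distr (\<mu> \<Otimes>\<^sub>M \<mu>) borel ?R)"
      by (simp only: resample_direction[OF dual q])
    also have "\<dots> = (\<integral>\<^sup>+p. indicator A (?F (u, ?R p)) \<partial>(\<mu> \<Otimes>\<^sub>M \<mu>))"
      using m by (intro nn_integral_distr) auto
    finally show "(\<integral>\<^sup>+z. indicator A (?F (u, z)) \<partial>\<mu>) = (\<integral>\<^sup>+p. indicator A (?F (u, ?R p)) \<partial>(\<mu> \<Otimes>\<^sub>M \<mu>))" .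
  qed
  also have "\<dots> = (\<integral>\<^sup>+u. \<integral>\<^sup>+z. \<integral>\<^sup>+z'. indicator A (Y z + (reflect_step q (blinfun_apply l z') u / q) *\<^sub>R h) \<partial>\<mu> \<partial>\<mu> \<partial>unif)"
    unfolding FR[symmetric] by (intro nn_integral_cong nn_integral_fst[symmetric]) measurable
  also have "\<dots> = (\<integral>\<^sup>+u. \<integral>\<^sup>+z. \<integral>\<^sup>+t. indicator A (Y z + (reflect_step q t u / q) *\<^sub>R h) \<partial>\<nu> \<partial>\<mu> \<partial>unif)"
    unfolding \<nu>_def by (intro nn_integral_cong, subst nn_integral_distr) (auto simp: reflect_step_def)
  also have "\<dots> = (\<integral>\<^sup>+z. \<integral>\<^sup>+u. \<integral>\<^sup>+t. indicator A (Y z + (reflect_step q t u / q) *\<^sub>R h) \<partial>\<nu> \<partial>unif \<partial>\<mu>)"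
    by (rule UM.Fubini'[symmetric]) (unfold reflect_step_def, measurable)
  also have "\<dots> = (\<integral>\<^sup>+z. \<integral>\<^sup>+t. \<integral>\<^sup>+u. indicator A (Y z + (reflect_step q t u / q) *\<^sub>R h) \<partial>unif \<partial>\<nu> \<partial>\<mu>)"
    by (intro nn_integral_cong UN.Fubini') (unfold reflect_step_def, measurable)
  also have "\<dots> = (\<integral>\<^sup>+z. \<integral>\<^sup>+t. indicator A (Y z + (t / q) *\<^sub>R h) \<partial>\<nu> \<partial>\<mu>)"
    by (simp only: slice)
  also have "\<dots> = (\<integral>\<^sup>+z. \<integral>\<^sup>+z'. indicator A (?R (z, z')) \<partial>\<mu> \<partial>\<mu>)"
    unfolding \<nu>_def RY by (intro nn_integral_cong, subst nn_integral_distr) auto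
  also have "\<dots> = (\<integral>\<^sup>+p. indicator A (?R p) \<partial>(\<mu> \<Otimes>\<^sub>M \<mu>))"
    by (rule nn_integral_fst) measurable
  also have "\<dots> = emeasure (distr (\<mu> \<Otimes>\<^sub>M \<mu>) borel ?R) A"
    by (rule emeasure_distr_nn_integral[symmetric]) measurable
  also have "\<dots> = emeasure \<mu> A" by (simp only: resample_direction[OF dual q])
  finally show "emeasure (distr (unif \<Otimes>\<^sub>M \<mu>) borel ?F) A = emeasure \<mu> A" .
qed

end

section \<open>Reflection of a finite-dimensional projection\<close>

locale orthonormal_basis = gaussian_basis \<mu> e f
  for \<mu> :: "'w::{banach, second_countable_topology} measure"
    and e :: "nat \<Rightarrow> 'w" and f :: "nat \<Rightarrow> 'w \<Rightarrow>\<^sub>L real" +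
  assumes coordinate_dual: "Cov \<mu> (f k) l = blinfun_apply l (e k)"
begin

definition proj :: "nat \<Rightarrow> 'w \<Rightarrow> 'w" where
  "proj n x = (\<Sum>k<n. f k x *\<^sub>R e k)"

text \<open>The dual of \<open>proj n x\<close>, by \<open>coordinate_dual\<close>.\<close>

definition form :: "nat \<Rightarrow> 'w \<Rightarrow> 'w \<Rightarrow>\<^sub>L real" where
  "form n x = (\<Sum>k<n. f k x *\<^sub>R f k)"

lemma form_apply: "blinfun_apply (form n x) z = (\<Sum>k<n. f k x * f k z)"
  by (simp add: form_def blinfun.sum_left blinfun.scaleR_left)

lemma Cov_form: "Cov \<mu> (form n x) l = blinfun_apply l (proj n x)"
  by (simp add: form_def proj_def Cov_sum_left Cov_scaleR_left coordinate_dual blinfun.sum_right blinfun.scaleR_right)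

lemma functional_proj: "f j (proj n x) = (if j < n then f j x else 0)"
  by (simp add: proj_def blinfun.sum_right blinfun.scaleR_right biorthogonal if_distrib cong: if_cong)

lemma Cov_form_form: "Cov \<mu> (form n x) (form n x) = (\<Sum>k<n. (f k x)\<^sup>2)"
  unfolding Cov_form form_apply by (intro sum.cong) (auto simp: functional_proj power2_eq_square)

text \<open>The exponential is the Cameron-Martin density, at \<open>z\<close>, of the translate of
  \<open>\<mu>\<close> by \<open>- proj n x\<close>. In the direction of \<open>proj n x\<close> it
  is the quotient of normal densities of \<open>reflect_step\<close>.\<close>

definition accept :: "nat \<Rightarrow> 'w \<Rightarrow> real \<Rightarrow> 'w \<Rightarrow> bool" where
  "accept n x u z \<longleftrightarrow> u \<le> exp (- blinfun_apply (form n x) z - (\<Sum>k<n. (f k x)\<^sup>2) / 2)"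

text \<open>If \<open>proj n x = 0\<close>, the division by zero is harmless.\<close>

definition kick :: "nat \<Rightarrow> 'w \<Rightarrow> real \<Rightarrow> 'w \<Rightarrow> 'w" where
  "kick n x u z = (if accept n x u z then z + proj n x
     else z - (2 * blinfun_apply (form n x) z / (\<Sum>k<n. (f k x)\<^sup>2)) *\<^sub>R proj n x)"

theorem kick_invariant: "distr (unif \<Otimes>\<^sub>M \<mu>) borel (\<lambda>(u, z). kick n x u z) = \<mu>"
proof (cases "(\<Sum>k<n. (f k x)\<^sup>2) = 0")
  case True
  then have "\<forall>k<n. f k x = 0" by (simp add: sum_nonneg_eq_0_iff)
  then have "kick n x u z = z" for u z by (simp add: kick_def proj_def)
  then have "distr (unif \<Otimes>\<^sub>M \<mu>) borel (\<lambda>(u, z). kick n x u z) = distr (unif \<Otimes>\<^sub>M \<mu>) borel snd"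
    by (simp add: case_prod_unfold)
  also have "\<dots> = distr (unif \<Otimes>\<^sub>M \<mu>) \<mu> snd" by (intro distr_cong) auto
  also have "\<dots> = \<mu>"
  proof (rule measure_eqI)
    fix A assume "A \<in> sets (distr (unif \<Otimes>\<^sub>M \<mu>) \<mu> snd)"
    then have A: "A \<in> sets \<mu>" by simp
    have "snd -` A \<inter> space (unif \<Otimes>\<^sub>M \<mu>) = space unif \<times> A" by (auto simp: space_pair_measure)
    then show "emeasure (distr (unif \<Otimes>\<^sub>M \<mu>) \<mu> snd) A = emeasure \<mu> A"
      using A unif.emeasure_space_1 by (simp add: emeasure_distr emeasure_pair_measure_Times)
  qed simp
  finally show ?thesis .
next
  case False
  let ?q = "\<Sum>k<n. (f k x)\<^sup>2"
  have "z + ((reflect_step ?q (blinfun_apply (form n x) z) u - blinfun_apply (form n x) z) / ?q) *\<^sub>R proj n x = kick n x u z" for u z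
    using False by (simp add: kick_def accept_def reflect_step_def scaleR_diff_left[symmetric])
  then show ?thesis using reflect_direction[OF Cov_form Cov_form_form False] by simp
qed

end

section \<open>Brownian motion as a Gaussian series\<close>

context gaussian_basis
begin

text \<open>Independence and the law \<open>\<mu>\<close> of the \<open>Z a\<close>, expressed by the joint characteristic functional.\<close>

definition iid_gaussian :: "'p measure \<Rightarrow> ('a \<Rightarrow> 'p \<Rightarrow> 'w) \<Rightarrow> bool" where
  "iid_gaussian M Z \<longleftrightarrow> prob_space M \<and> (\<forall>a. Z a \<in> borel_measurable M) \<and>
    (\<forall>A l. finite A \<longrightarrow>
      (CLINT \<omega>|M. iexp (\<Sum>a\<in>A. blinfun_apply (l a) (Z a \<omega>))) = exp (- (\<Sum>a\<in>A. Cov \<mu> (l a) (l a)) / 2))"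

end

text \<open>Levy's construction in general form: a series with i.i.d. Gaussian noises whose
  coefficients reproduce the kernel \<open>min s t\<close>. Both motions will be instances with the
  same coefficients and different noises.\<close>

locale gaussian_series = gaussian_basis \<mu> e f
  for \<mu> :: "'w::{banach, second_countable_topology} measure"
    and e :: "nat \<Rightarrow> 'w" and f :: "nat \<Rightarrow> 'w \<Rightarrow>\<^sub>L real" +
  fixes M :: "'p measure" and Z :: "'a \<Rightarrow> 'p \<Rightarrow> 'w" and A :: "nat \<Rightarrow> 'a set"
    and c :: "'a \<Rightarrow> real \<Rightarrow> real" and X :: "real \<Rightarrow> 'p \<Rightarrow> 'w"
  assumes iid: "iid_gaussian M Z"
    and finite_A: "\<And>N. finite (A N)"
    and X_lim: "\<And>\<omega> t. \<omega> \<in> space M \<Longrightarrow> 0 \<le> t \<Longrightarrow> (\<lambda>N. \<Sum>a\<in>A N. c a t *\<^sub>R Z a \<omega>) \<longlonglongrightarrow> X t \<omega>"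
    and c_lim: "\<And>s t. 0 \<le> s \<Longrightarrow> 0 \<le> t \<Longrightarrow> (\<lambda>N. \<Sum>a\<in>A N. c a s * c a t) \<longlonglongrightarrow> min s t"
    and X_cont: "\<And>\<omega>. \<omega> \<in> space M \<Longrightarrow> continuous_on {0..} (\<lambda>t. X t \<omega>)"
begin

sublocale M: prob_space M
  using iid unfolding iid_gaussian_def by blast

lemma Z_measurable [measurable]: "Z a \<in> borel_measurable M"
  using iid unfolding iid_gaussian_def by blast

lemma X_measurable: "0 \<le> t \<Longrightarrow> X t \<in> borel_measurable M"
  by (rule borel_measurable_LIMSEQ_metric[OF _ X_lim]) measurable

text \<open>A functional of the noise is kept together with its coefficients, since covariances are
  computed from these. The limit is taken at every point, so that measurability is
  immediate.\<close>

definition series_limit :: "('a \<Rightarrow> 'w \<Rightarrow>\<^sub>L real) \<Rightarrow> ('p \<Rightarrow> real) \<Rightarrow> bool" where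
  "series_limit l v \<longleftrightarrow> (\<forall>\<omega>\<in>space M. (\<lambda>N. \<Sum>a\<in>A N. blinfun_apply (l a) (Z a \<omega>)) \<longlonglongrightarrow> v \<omega>)"

lemma series_limit_measurable: "series_limit l v \<Longrightarrow> v \<in> borel_measurable M"
  unfolding series_limit_def by (rule borel_measurable_LIMSEQ_metric) auto

lemma series_limit_add:
  "series_limit l v \<Longrightarrow> series_limit l' v' \<Longrightarrow> series_limit (\<lambda>a. l a + l' a) (\<lambda>\<omega>. v \<omega> + v' \<omega>)"
  unfolding series_limit_def by (auto simp: blinfun.add_left sum.distrib intro!: tendsto_add)

lemma series_limit_scale: "series_limit l v \<Longrightarrow> series_limit (\<lambda>a. r *\<^sub>R l a) (\<lambda>\<omega>. r * v \<omega>)"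
  unfolding series_limit_def by (auto simp: blinfun.scaleR_left sum_distrib_left[symmetric] intro!: tendsto_mult_left)

lemma series_limit_X:
  assumes "0 \<le> t"
  shows "series_limit (\<lambda>a. c a t *\<^sub>R l) (\<lambda>\<omega>. blinfun_apply l (X t \<omega>))"
  unfolding series_limit_def
proof
  fix \<omega> assume "\<omega> \<in> space M"
  then have "(\<lambda>N. blinfun_apply l (\<Sum>a\<in>A N. c a t *\<^sub>R Z a \<omega>)) \<longlonglongrightarrow> blinfun_apply l (X t \<omega>)"
    using X_lim assms by (intro tendsto_intros)
  then show "(\<lambda>N. \<Sum>a\<in>A N. blinfun_apply (c a t *\<^sub>R l) (Z a \<omega>)) \<longlonglongrightarrow> blinfun_apply l (X t \<omega>)"
    by (simp add: blinfun.sum_right blinfun.scaleR_right blinfun.scaleR_left)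
qed

lemma series_limit_increment:
  assumes "0 \<le> s" "0 \<le> t"
  shows "series_limit (\<lambda>a. (c a t - c a s) *\<^sub>R l) (\<lambda>\<omega>. blinfun_apply l (X t \<omega> - X s \<omega>))"
  using series_limit_add[OF series_limit_X[OF assms(2), of l] series_limit_scale[OF series_limit_X[OF assms(1), of l], of "-1"]]
  by (simp add: blinfun.diff_right scaleR_diff_left)

lemma series_limit_char:
  assumes v: "series_limit l v"
  shows "(\<lambda>N. complex_of_real (exp (- (\<Sum>a\<in>A N. Cov \<mu> (l a) (l a)) / 2))) \<longlonglongrightarrow> (CLINT \<omega>|M. iexp (v \<omega>))"
proof -
  have [measurable]: "v \<in> borel_measurable M" using v by (rule series_limit_measurable)
  have "(\<lambda>N. CLINT \<omega>|M. iexp (\<Sum>a\<in>A N. blinfun_apply (l a) (Z a \<omega>))) \<longlonglongrightarrow> (CLINT \<omega>|M. iexp (v \<omega>))"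
  proof (rule integral_dominated_convergence[where w="\<lambda>_. 1"])
    show "AE \<omega> in M. (\<lambda>N. iexp (\<Sum>a\<in>A N. blinfun_apply (l a) (Z a \<omega>))) \<longlonglongrightarrow> iexp (v \<omega>)"
      using v unfolding series_limit_def by (intro AE_I2 tendsto_intros) auto
  qed auto
  then show ?thesis
    using iid finite_A unfolding iid_gaussian_def by simp
qed

lemma char_increment:
  assumes st: "0 \<le> s" "s < t"
  shows "(CLINT \<omega>|M. iexp (blinfun_apply l (X t \<omega> - X s \<omega>))) = exp (- ((t - s) * Cov \<mu> l l) / 2)"
proof (rule LIMSEQ_unique[OF series_limit_char[OF series_limit_increment]])
  have "(\<lambda>N. (\<Sum>a\<in>A N. c a t * c a t) - 2 * (\<Sum>a\<in>A N. c a s * c a t) + (\<Sum>a\<in>A N. c a s * c a s)) \<longlonglongrightarrow> min t t - 2 * min s t + min s s"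
    using st by (intro tendsto_intros c_lim) auto
  then have "(\<lambda>N. \<Sum>a\<in>A N. (c a t - c a s) * (c a t - c a s)) \<longlonglongrightarrow> t - s"
    using st by (simp add: sum_subtractf[symmetric] sum.distrib[symmetric] sum_distrib_left algebra_simps)
  then have "(\<lambda>N. (\<Sum>a\<in>A N. (c a t - c a s) * (c a t - c a s)) * Cov \<mu> l l) \<longlonglongrightarrow> (t - s) * Cov \<mu> l l"
    by (intro tendsto_intros)
  then have "(\<lambda>N. \<Sum>a\<in>A N. Cov \<mu> ((c a t - c a s) *\<^sub>R l) ((c a t - c a s) *\<^sub>R l)) \<longlonglongrightarrow> (t - s) * Cov \<mu> l l"
    by (simp add: Cov_scaleR_left Cov_scaleR_right sum_distrib_right mult.assoc)
  then show "(\<lambda>N. complex_of_real (exp (- (\<Sum>a\<in>A N. Cov \<mu> ((c a t - c a s) *\<^sub>R l) ((c a t - c a s) *\<^sub>R l)) / 2)))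
      \<longlonglongrightarrow> complex_of_real (exp (- ((t - s) * Cov \<mu> l l) / 2))"
    by (intro tendsto_intros) simp_all
qed (use st in auto)

text \<open>Defined by what independence asks for: the covariance with every functional of the
  increment vanishes in the limit. The set is linear and contains the functionals of
  \<open>X u\<close> for \<open>u \<le> s\<close>, so their span can be left undescribed.\<close>

definition past_functionals :: "real \<Rightarrow> real \<Rightarrow> ('p \<Rightarrow> real) set" where
  "past_functionals s t = {v. \<exists>l. series_limit l v \<and>
     (\<forall>k. (\<lambda>N. \<Sum>a\<in>A N. (c a t - c a s) * Cov \<mu> (l a) k) \<longlonglongrightarrow> 0)}"

definition increment_functionals :: "real \<Rightarrow> real \<Rightarrow> ('p \<Rightarrow> real) set" where
  "increment_functionals s t = {\<lambda>\<omega>. blinfun_apply l (X t \<omega> - X s \<omega>) |l. True}"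

lemma linear_closed_past: "linear_closed (past_functionals s t)"
  unfolding linear_closed_def
proof (intro conjI ballI allI)
  have "series_limit (\<lambda>_. 0) (\<lambda>_. 0)" by (simp add: series_limit_def)
  then show "past_functionals s t \<noteq> {}" unfolding past_functionals_def
    by (intro notI) (force dest: equalityD1 simp: subset_eq)
next
  fix v w assume "v \<in> past_functionals s t" "w \<in> past_functionals s t"
  then obtain l l' where l: "series_limit l v" "\<And>k. (\<lambda>N. \<Sum>a\<in>A N. (c a t - c a s) * Cov \<mu> (l a) k) \<longlonglongrightarrow> 0"
    and l': "series_limit l' w" "\<And>k. (\<lambda>N. \<Sum>a\<in>A N. (c a t - c a s) * Cov \<mu> (l' a) k) \<longlonglongrightarrow> 0"
    unfolding past_functionals_def by blast
  have "(\<lambda>N. \<Sum>a\<in>A N. (c a t - c a s) * Cov \<mu> (l a + l' a) k) \<longlonglongrightarrow> 0" for k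
    using tendsto_add[OF l(2) l'(2), of k k] by (simp add: Cov_add_left ring_distribs sum.distrib)
  then show "(\<lambda>x. v x + w x) \<in> past_functionals s t"
    unfolding past_functionals_def using series_limit_add[OF l(1) l'(1)] by blast
next
  fix r v assume "v \<in> past_functionals s t"
  then obtain l where l: "series_limit l v" "\<And>k. (\<lambda>N. \<Sum>a\<in>A N. (c a t - c a s) * Cov \<mu> (l a) k) \<longlonglongrightarrow> 0"
    unfolding past_functionals_def by blast
  have "(\<lambda>N. \<Sum>a\<in>A N. (c a t - c a s) * Cov \<mu> (r *\<^sub>R l a) k) \<longlonglongrightarrow> 0" for k
    using tendsto_mult_left[OF l(2), of r k] by (simp add: Cov_scaleR_left sum_distrib_left mult.left_commute)
  then show "(\<lambda>x. r * v x) \<in> past_functionals s t"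
    unfolding past_functionals_def using series_limit_scale[OF l(1)] by blast
qed

lemma linear_closed_increment: "linear_closed (increment_functionals s t)"
  unfolding linear_closed_def
proof (intro conjI ballI allI)
  show "increment_functionals s t \<noteq> {}" unfolding increment_functionals_def by blast
next
  fix v w assume "v \<in> increment_functionals s t" "w \<in> increment_functionals s t"
  then obtain l l' where "v = (\<lambda>\<omega>. blinfun_apply l (X t \<omega> - X s \<omega>))" "w = (\<lambda>\<omega>. blinfun_apply l' (X t \<omega> - X s \<omega>))"
    unfolding increment_functionals_def by blast
  then have "(\<lambda>x. v x + w x) = (\<lambda>\<omega>. blinfun_apply (l + l') (X t \<omega> - X s \<omega>))" by (simp add: blinfun.add_left)
  then show "(\<lambda>x. v x + w x) \<in> increment_functionals s t" unfolding increment_functionals_def by blast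
next
  fix r v assume "v \<in> increment_functionals s t"
  then obtain l where "v = (\<lambda>\<omega>. blinfun_apply l (X t \<omega> - X s \<omega>))" unfolding increment_functionals_def by blast
  then have "(\<lambda>x. r * v x) = (\<lambda>\<omega>. blinfun_apply (r *\<^sub>R l) (X t \<omega> - X s \<omega>))" by (simp add: blinfun.scaleR_left)
  then show "(\<lambda>x. r * v x) \<in> increment_functionals s t" unfolding increment_functionals_def by blast
qed

text \<open>The variance of the sum is the sum of the variances plus twice a cross term that tends
  to 0. Only the exponentials of the variances are passed to the limit.\<close>

lemma char_past_increment:
  assumes st: "0 \<le> s" "s < t" and v: "v \<in> past_functionals s t" and w: "w \<in> increment_functionals s t"
  shows "(CLINT \<omega>|M. iexp (v \<omega> + w \<omega>)) = (CLINT \<omega>|M. iexp (v \<omega>)) * (CLINT \<omega>|M. iexp (w \<omega>))"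
proof -
  obtain l where l: "series_limit l v" "\<And>k. (\<lambda>N. \<Sum>a\<in>A N. (c a t - c a s) * Cov \<mu> (l a) k) \<longlonglongrightarrow> 0"
    using v unfolding past_functionals_def by blast
  obtain k where k: "w = (\<lambda>\<omega>. blinfun_apply k (X t \<omega> - X s \<omega>))" using w unfolding increment_functionals_def by blast
  define l' where "l' a = (c a t - c a s) *\<^sub>R k" for a
  have l': "series_limit l' w"
    unfolding k l'_def using st by (intro series_limit_increment) auto
  define p q x where "p N = (\<Sum>a\<in>A N. Cov \<mu> (l a) (l a))" and "q N = (\<Sum>a\<in>A N. Cov \<mu> (l' a) (l' a))"
    and "x N = (\<Sum>a\<in>A N. Cov \<mu> (l a) (l' a))" for N
  have "x \<longlonglongrightarrow> 0"
    using l(2)[of k] by (simp add: x_def[abs_def] l'_def Cov_scaleR_right)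
  then have "(\<lambda>N. complex_of_real (exp (- x N))) \<longlonglongrightarrow> complex_of_real (exp (- 0))"
    by (intro tendsto_intros)
  moreover have "(\<lambda>N. complex_of_real (exp (- p N / 2))) \<longlonglongrightarrow> (CLINT \<omega>|M. iexp (v \<omega>))"
    unfolding p_def by (rule series_limit_char[OF l(1)])
  moreover have "(\<lambda>N. complex_of_real (exp (- q N / 2))) \<longlonglongrightarrow> (CLINT \<omega>|M. iexp (w \<omega>))"
    unfolding q_def by (rule series_limit_char[OF l'])
  ultimately have "(\<lambda>N. complex_of_real (exp (- p N / 2)) * complex_of_real (exp (- q N / 2)) * complex_of_real (exp (- x N)))
      \<longlonglongrightarrow> (CLINT \<omega>|M. iexp (v \<omega>)) * (CLINT \<omega>|M. iexp (w \<omega>)) * complex_of_real (exp (- 0))"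
    by (intro tendsto_mult)
  moreover have "complex_of_real (exp (- p N / 2)) * complex_of_real (exp (- q N / 2)) * complex_of_real (exp (- x N))
      = complex_of_real (exp (- (\<Sum>a\<in>A N. Cov \<mu> (l a + l' a) (l a + l' a)) / 2))" for N
  proof -
    have "(\<Sum>a\<in>A N. Cov \<mu> (l a + l' a) (l a + l' a)) = p N + q N + 2 * x N"
      unfolding p_def q_def x_def sum_distrib_left sum.distrib[symmetric]
      by (intro sum.cong refl) (simp add: Cov_add_left Cov_add_right Cov_commute[of "l' _" "l _"])
    then have "- (\<Sum>a\<in>A N. Cov \<mu> (l a + l' a) (l a + l' a)) / 2 = - p N / 2 + - q N / 2 + - x N" by simp
    then show ?thesis by (simp only: exp_add of_real_mult)
  qed
  ultimately have "(\<lambda>N. complex_of_real (exp (- (\<Sum>a\<in>A N. Cov \<mu> (l a + l' a) (l a + l' a)) / 2)))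
     \<longlonglongrightarrow> (CLINT \<omega>|M. iexp (v \<omega>)) * (CLINT \<omega>|M. iexp (w \<omega>))" by simp
  with series_limit_char[OF series_limit_add[OF l(1) l']] show ?thesis
    by (rule LIMSEQ_unique)
qed

lemma past_in_cyl_events:
  assumes st: "0 \<le> s" "s < t"
  shows "past_events M (\<lambda>t \<omega>. b + X t \<omega>) s \<subseteq> cyl_events (space M) (past_functionals s t)"
proof -
  interpret S: sigma_algebra "space M" "cyl_events (space M) (past_functionals s t)" by (rule sigma_algebra_cyl_events)
  have X: "(\<lambda>\<omega>. blinfun_apply l (X u \<omega>)) \<in> past_functionals s t" if u: "0 \<le> u" "u \<le> s" for l u
  proof -
    \<comment> \<open>For \<open>u \<le> s\<close> the limit kernel has
      \<open>min u t - min u s = 0\<close>: the increment is uncorrelated with the past.\<close>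
    have "(\<lambda>N. ((\<Sum>a\<in>A N. c a u * c a t) - (\<Sum>a\<in>A N. c a u * c a s)) * Cov \<mu> l k) \<longlonglongrightarrow> (min u t - min u s) * Cov \<mu> l k" for k
      using st u by (intro tendsto_intros c_lim) auto
    moreover have "((\<Sum>a\<in>A N. c a u * c a t) - (\<Sum>a\<in>A N. c a u * c a s)) * Cov \<mu> l k
        = (\<Sum>a\<in>A N. (c a t - c a s) * Cov \<mu> (c a u *\<^sub>R l) k)" for N k
      unfolding sum_subtractf[symmetric] sum_distrib_right
      by (intro sum.cong refl) (simp add: Cov_scaleR_left algebra_simps)
    ultimately have "(\<lambda>N. \<Sum>a\<in>A N. (c a t - c a s) * Cov \<mu> (c a u *\<^sub>R l) k) \<longlonglongrightarrow> 0" for k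
      using st u by simp
    then show ?thesis
      unfolding past_functionals_def using series_limit_X[OF u(1), of l] by blast
  qed
  show ?thesis
    unfolding past_events_def
  proof (rule S.sigma_sets_subset, safe)
    fix u and B :: "'w set" assume u: "u \<in> {0..s}" and B: "B \<in> sets borel"
    have "(\<lambda>x. b + x) -` B \<inter> space borel \<in> sets borel" by (rule measurable_sets[OF _ B]) measurable
    then have "X u -` ((\<lambda>x. b + x) -` B) \<inter> space M \<in> cyl_events (space M) (past_functionals s t)"
      using u by (intro vimage_cyl_events X) auto
    then show "(\<lambda>\<omega>. b + X u \<omega>) -` B \<inter> space M \<in> cyl_events (space M) (past_functionals s t)"
      by (simp add: vimage_comp comp_def vimage_def)
  qed
qed

lemma increment_in_cyl_events:
  "increment_events M (\<lambda>t \<omega>. b + X t \<omega>) s t \<subseteq> cyl_events (space M) (increment_functionals s t)"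
proof
  fix C assume "C \<in> increment_events M (\<lambda>t \<omega>. b + X t \<omega>) s t"
  then obtain B where B: "B \<in> sets borel" "C = (\<lambda>\<omega>. X t \<omega> - X s \<omega>) -` B \<inter> space M"
    unfolding increment_events_def by auto
  show "C \<in> cyl_events (space M) (increment_functionals s t)"
    unfolding B(2) using B(1) by (intro vimage_cyl_events) (auto simp: increment_functionals_def)
qed

theorem brownian_motion: "brownian_motion \<mu> M (\<lambda>t \<omega>. b + X t \<omega>)"
  unfolding brownian_motion_def
proof (intro conjI allI impI ballI)
  show "prob_space M" by (rule M.prob_space_axioms)
  show "(\<lambda>\<omega>. b + X t \<omega>) \<in> borel_measurable M" if "0 \<le> t" for t
    using X_measurable[OF that] by measurable
  show "continuous_on {0..} (\<lambda>t. b + X t \<omega>)" if "\<omega> \<in> space M" for \<omega>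
    using X_cont[OF that] by (intro continuous_intros)
  fix s t :: real assume "0 \<le> s \<and> s < t"
  then have st: "0 \<le> s" "s < t" by auto
  note [measurable] = X_measurable[OF st(1)]
  have [measurable]: "X t \<in> borel_measurable M" using st by (intro X_measurable) simp
  show "distr M borel (\<lambda>\<omega>. b + X t \<omega> - (b + X s \<omega>)) = distr \<mu> borel (\<lambda>z. sqrt (t - s) *\<^sub>R z)"
  proof (rule measure_eqI_functionals)
    show "finite_measure (distr M borel (\<lambda>\<omega>. b + X t \<omega> - (b + X s \<omega>)))"
      by (rule M.finite_measure_distr) measurable
    show "finite_measure (distr \<mu> borel (\<lambda>z. sqrt (t - s) *\<^sub>R z))"
      by (rule finite_measure_distr) measurable
    fix l :: "'w \<Rightarrow>\<^sub>L real"
    have "(CLINT x|distr M borel (\<lambda>\<omega>. b + X t \<omega> - (b + X s \<omega>)). iexp (blinfun_apply l x)) = (CLINT \<omega>|M. iexp (blinfun_apply l (X t \<omega> - X s \<omega>)))"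
      by (subst integral_distr) auto
    also have "\<dots> = exp (- ((t - s) * Cov \<mu> l l) / 2)" by (rule char_increment[OF st])
    also have "\<dots> = exp (- Cov \<mu> (sqrt (t - s) *\<^sub>R l) (sqrt (t - s) *\<^sub>R l) / 2)"
      using st by (simp add: Cov_scaleR_left Cov_scaleR_right flip: mult.assoc)
    also have "\<dots> = (CLINT z|\<mu>. iexp (blinfun_apply l (sqrt (t - s) *\<^sub>R z)))"
      unfolding char_functional[symmetric] by (simp add: blinfun.scaleR_left blinfun.scaleR_right)
    also have "\<dots> = (CLINT x|distr \<mu> borel (\<lambda>z. sqrt (t - s) *\<^sub>R z). iexp (blinfun_apply l x))"
      by (subst integral_distr) auto
    finally show "(CLINT x|distr M borel (\<lambda>\<omega>. b + X t \<omega> - (b + X s \<omega>)). iexp (blinfun_apply l x)) =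
      (CLINT x|distr \<mu> borel (\<lambda>z. sqrt (t - s) *\<^sub>R z). iexp (blinfun_apply l x))" .
  qed auto
  have mp: "past_functionals s t \<subseteq> borel_measurable M"
    unfolding past_functionals_def using series_limit_measurable by blast
  have mi: "increment_functionals s t \<subseteq> borel_measurable M"
    unfolding increment_functionals_def by auto
  show "M.indep_set (past_events M (\<lambda>t \<omega>. b + X t \<omega>) s) (increment_events M (\<lambda>t \<omega>. b + X t \<omega>) s t)"
  proof (rule M.indep_setI)
    show "past_events M (\<lambda>t \<omega>. b + X t \<omega>) s \<subseteq> M.events"
      using past_in_cyl_events[OF st] cyl_events_sets[OF mp] by blast
    show "increment_events M (\<lambda>t \<omega>. b + X t \<omega>) s t \<subseteq> M.events"
      using increment_in_cyl_events cyl_events_sets[OF mi] by blast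
    fix C D assume C: "C \<in> past_events M (\<lambda>t \<omega>. b + X t \<omega>) s" and D: "D \<in> increment_events M (\<lambda>t \<omega>. b + X t \<omega>) s t"
    show "M.prob (C \<inter> D) = M.prob C * M.prob D"
      using C D past_in_cyl_events[OF st] increment_in_cyl_events
      by (intro M.char_indep[OF linear_closed_past linear_closed_increment mp mi char_past_increment[OF st]]) blast+
  qed
qed

end

section \<open>Schauder functions and paths\<close>

definition tent :: "real \<Rightarrow> real" where "tent x = max 0 (min x (1 - x))"

lemma tent_nonneg: "0 \<le> tent x" and tent_le: "tent x \<le> 1"
  by (auto simp: tent_def)

lemma tent_eq_0: "x \<le> 0 \<or> 1 \<le> x \<Longrightarrow> tent x = 0"
  by (auto simp: tent_def)

lemma continuous_on_tent [continuous_intros]: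
  "continuous_on S g \<Longrightarrow> continuous_on S (\<lambda>x. tent (g x))"
  unfolding tent_def by (intro continuous_intros)

text \<open>At \<open>y\<close> only the tent whose index is the integer part of \<open>y\<close>
  can differ from 0.\<close>

lemma sum_tent_le: "(\<Sum>j<m. tent (y - real j)) \<le> 1"
proof -
  have "tent (y - real j) \<le> (if j = nat \<lfloor>y\<rfloor> then 1 else 0)" for j
  proof (cases "j = nat \<lfloor>y\<rfloor>")
    case False
    have "y - real j \<le> 0 \<or> 1 \<le> y - real j"
    proof (rule ccontr)
      assume "\<not> ?thesis"
      then have "real j < y" "y < real j + 1" by auto
      then have "\<lfloor>y\<rfloor> = int j" by (intro floor_unique) auto
      then show False using False by simp
    qed
    then show ?thesis using False by (simp add: tent_eq_0)
  qed (simp add: tent_le)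
  then have "(\<Sum>j<m. tent (y - real j)) \<le> (\<Sum>j<m. if j = nat \<lfloor>y\<rfloor> then 1 else 0)"
    by (rule sum_mono)
  also have "\<dots> \<le> 1" by (simp add: sum.delta)
  finally show ?thesis .
qed

text \<open>The Schauder functions on \<open>[0, 1]\<close>, that is, the integrals of the Haar functions: level \<open>0\<close> has the
  identity only, level \<open>n + 1\<close> the \<open>2 ^ n\<close> tents of width \<open>2 ^ - n\<close>.\<close>

definition width :: "nat \<Rightarrow> nat" where "width n = (case n of 0 \<Rightarrow> 1 | Suc m \<Rightarrow> 2 ^ m)"

definition hat :: "nat \<Rightarrow> nat \<Rightarrow> real \<Rightarrow> real" where
  "hat n j x = (case n of 0 \<Rightarrow> x | Suc m \<Rightarrow> (1 / sqrt 2) ^ m * tent (2 ^ m * x - real j))"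

lemma width_simps [simp]: "width 0 = 1" "width (Suc m) = 2 ^ m"
  by (simp_all add: width_def)

lemma hat_simps [simp]: "hat 0 j x = x" "hat (Suc m) j x = (1 / sqrt 2) ^ m * tent (2 ^ m * x - real j)"
  by (simp_all add: hat_def)

lemma hat_0 [simp]: "hat n j 0 = 0"
  by (cases n) (auto simp: tent_eq_0)

lemma continuous_on_hat [continuous_intros]: "continuous_on S (hat n j)"
  by (cases n) (auto simp: hat_def intro!: continuous_intros)

definition tent_kernel :: "nat \<Rightarrow> real \<Rightarrow> real \<Rightarrow> real" where
  "tent_kernel n x y = (\<Sum>j<2^n. tent (2 ^ n * x - real j) * tent (2 ^ n * y - real j))"

lemma tent_kernel_commute: "tent_kernel n x y = tent_kernel n y x"
  by (simp add: tent_kernel_def mult.commute)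

lemma tent_kernel_0: "tent_kernel 0 x y = tent x * tent y"
  by (simp add: tent_kernel_def)

lemma sum_double: "(\<Sum>j<2 ^ Suc n. g j) = (\<Sum>j<2 ^ n. g j) + (\<Sum>j<2 ^ n. g (2 ^ n + j))" for g :: "nat \<Rightarrow> real"
proof -
  have "(\<Sum>j<2 ^ Suc n. g j) = (\<Sum>j<2 ^ n. g j) + (\<Sum>j=2 ^ n..<2 ^ n + 2 ^ n. g j)"
    using sum.atLeastLessThan_concat[of 0 "2 ^ n" "2 ^ n + 2 ^ n" g]
    by (simp add: lessThan_atLeast0 mult_2)
  also have "(\<Sum>j=2 ^ n..<2 ^ n + 2 ^ n. g j) = (\<Sum>j<2 ^ n. g (2 ^ n + j))"
    using sum.shift_bounds_nat_ivl[of g 0 "2 ^ n" "2 ^ n"] by (simp add: atLeast0LessThan add.commute)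
  finally show ?thesis .
qed

lemma tent_upper_half:
  assumes "x \<le> 1 / 2" shows "tent (2 ^ Suc n * x - real (2 ^ n + j)) = 0"
proof -
  have "2 ^ Suc n * x = 2 ^ n * (2 * x)" by simp
  also have "\<dots> \<le> 2 ^ n * 1" using assms by (intro mult_left_mono) auto
  finally have "2 ^ Suc n * x \<le> 2 ^ n" by simp
  then show ?thesis by (intro tent_eq_0 disjI1) (simp del: power_Suc)
qed

lemma tent_lower_half:
  assumes "1 / 2 \<le> x" "j < 2 ^ n" shows "tent (2 ^ Suc n * x - real j) = 0"
proof -
  have "2 ^ n * (1::real) \<le> 2 ^ n * (2 * x)" using assms by (intro mult_left_mono) auto
  also have "\<dots> = 2 ^ Suc n * x" by simp
  finally have "2 ^ n \<le> 2 ^ Suc n * x" by simp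
  moreover have "real (Suc j) \<le> real (2 ^ n)" unfolding of_nat_le_iff using assms(2) by simp
  ultimately show ?thesis by (intro tent_eq_0 disjI2) (simp del: power_Suc)
qed

lemma tent_kernel_lower:
  assumes "x \<le> 1 / 2" "y \<le> 1 / 2"
  shows "tent_kernel (Suc n) x y = tent_kernel n (2 * x) (2 * y)"
  unfolding tent_kernel_def sum_double using tent_upper_half[OF assms(1)]
  by (simp add: mult_ac del: power_Suc of_nat_add) (simp add: mult_ac)

lemma tent_kernel_upper:
  assumes "1 / 2 \<le> x" "1 / 2 \<le> y"
  shows "tent_kernel (Suc n) x y = tent_kernel n (2 * x - 1) (2 * y - 1)"
proof -
  have "(\<Sum>j<2 ^ n. tent (2 ^ Suc n * x - real j) * tent (2 ^ Suc n * y - real j)) = 0"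
    using tent_lower_half[OF assms(1)] by (intro sum.neutral) (auto simp del: power_Suc)
  then show ?thesis
    unfolding tent_kernel_def sum_double by (simp add: algebra_simps)
qed

lemma tent_kernel_split:
  assumes "x \<le> 1 / 2" "1 / 2 \<le> y"
  shows "tent_kernel (Suc n) x y = 0"
  unfolding tent_kernel_def sum_double using tent_upper_half[OF assms(1)] tent_lower_half[OF assms(2)]
  by (simp del: power_Suc of_nat_add)

text \<open>The covariance of the levels up to \<open>N\<close>, as \<open>sum_hat_hat\<close>
  shows.\<close>

definition haar_kernel :: "nat \<Rightarrow> real \<Rightarrow> real \<Rightarrow> real" where
  "haar_kernel N x y = x * y + (\<Sum>n<N. (1 / 2) ^ n * tent_kernel n x y)"

lemma haar_kernel_Suc:
  "haar_kernel (Suc N) x y = x * y + tent x * tent y + (1 / 2) * (\<Sum>n<N. (1 / 2) ^ n * tent_kernel (Suc n) x y)"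
  by (simp add: haar_kernel_def sum.lessThan_Suc_shift tent_kernel_0 sum_distrib_left mult.assoc del: sum.lessThan_Suc)

text \<open>Self-similarity takes the place of Parseval's identity for the Haar basis. If both
  points lie in the same half of the interval, kernel and minimum rescale alike by the factor 1 / 2,
  which halves the error; for points in different halves \<open>x * y + tent x * tent y\<close>
  already is the minimum.\<close>

lemma haar_kernel_error:
  assumes "x \<in> {0..1}" "y \<in> {0..1}"
  shows "\<bar>haar_kernel N x y - min x y\<bar> \<le> (1 / 2) ^ N"
  using assms
proof (induction N arbitrary: x y)
  case 0
  have "x * y \<le> x * 1" "x * y \<le> 1 * y" "0 \<le> x * y"
    using 0 by (intro mult_left_mono mult_right_mono mult_nonneg_nonneg; simp)+
  then show ?case using 0 by (auto simp: haar_kernel_def abs_if min_def)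
next
  case (Suc N)
  have split: "haar_kernel (Suc N) x y = x" if "x \<in> {0..1}" "y \<in> {0..1}" "x \<le> 1 / 2" "1 / 2 \<le> y" for x y
  proof -
    have t: "tent x = x" "tent y = 1 - y" using that by (auto simp: tent_def)
    show ?thesis unfolding haar_kernel_Suc t by (simp add: tent_kernel_split[OF that(3,4)] algebra_simps)
  qed
  consider "x \<le> 1 / 2" "y \<le> 1 / 2" | "1 / 2 \<le> x" "1 / 2 \<le> y" | "x \<le> 1 / 2" "1 / 2 \<le> y" | "1 / 2 \<le> x" "y \<le> 1 / 2"
    by linarith
  then show ?case
  proof cases
    case 1
    have t: "tent x = x" "tent y = y" using 1 Suc.prems by (auto simp: tent_def)
    have "haar_kernel (Suc N) x y = haar_kernel N (2 * x) (2 * y) / 2"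
      unfolding haar_kernel_Suc t tent_kernel_lower[OF 1] by (simp add: haar_kernel_def field_simps)
    moreover have "min x y = min (2 * x) (2 * y) / 2" by (auto simp: min_def)
    ultimately have "haar_kernel (Suc N) x y - min x y = (haar_kernel N (2 * x) (2 * y) - min (2 * x) (2 * y)) / 2"
      by (simp add: diff_divide_distrib)
    then have "\<bar>haar_kernel (Suc N) x y - min x y\<bar> = \<bar>haar_kernel N (2 * x) (2 * y) - min (2 * x) (2 * y)\<bar> / 2"
      by (simp only: abs_divide abs_numeral)
    then show ?thesis using Suc.IH[of "2 * x" "2 * y"] 1 Suc.prems by simp
  next
    case 2
    have t: "tent x = 1 - x" "tent y = 1 - y" using 2 Suc.prems by (auto simp: tent_def)
    have "haar_kernel (Suc N) x y = haar_kernel N (2 * x - 1) (2 * y - 1) / 2 + 1 / 2"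
      unfolding haar_kernel_Suc t tent_kernel_upper[OF 2] by (simp add: haar_kernel_def field_simps)
    moreover have "min x y = min (2 * x - 1) (2 * y - 1) / 2 + 1 / 2" by (auto simp: min_def field_simps)
    ultimately have "haar_kernel (Suc N) x y - min x y = (haar_kernel N (2 * x - 1) (2 * y - 1) - min (2 * x - 1) (2 * y - 1)) / 2"
      by (simp add: diff_divide_distrib)
    then have "\<bar>haar_kernel (Suc N) x y - min x y\<bar> = \<bar>haar_kernel N (2 * x - 1) (2 * y - 1) - min (2 * x - 1) (2 * y - 1)\<bar> / 2"
      by (simp only: abs_divide abs_numeral)
    then show ?thesis using Suc.IH[of "2 * x - 1" "2 * y - 1"] 2 Suc.prems by simp
  next
    case 3
    then show ?thesis using split[OF Suc.prems 3] by (simp add: min_def)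
  next
    case 4
    have "haar_kernel (Suc N) x y = haar_kernel (Suc N) y x"
      by (simp add: haar_kernel_def tent_kernel_commute[of _ x y] mult.commute[of x y])
    then show ?thesis using split[OF Suc.prems(2,1) 4(2,1)] 4 by (simp add: min_absorb2)
  qed
qed

lemma sum_hat_hat: "(\<Sum>n\<le>N. \<Sum>j<width n. hat n j x * hat n j y) = haar_kernel N x y"
proof -
  have "(1 / sqrt 2) ^ n * (1 / sqrt 2) ^ n = (1 / 2 :: real) ^ n" for n
    by (simp flip: power_mult_distrib)
  then have "(\<Sum>j<width (Suc n). hat (Suc n) j x * hat (Suc n) j y) = (1 / 2) ^ n * tent_kernel n x y" for n
    by (simp add: tent_kernel_def sum_distrib_left mult_ac) (simp add: mult.assoc[symmetric])
  then show ?thesis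
    by (simp add: haar_kernel_def sum.atMost_shift)
qed

lemma haar_kernel_tendsto:
  assumes "x \<in> {0..1}" "y \<in> {0..1}"
  shows "(\<lambda>N. haar_kernel N x y) \<longlonglongrightarrow> min x y"
proof -
  have "(\<lambda>N. haar_kernel N x y - min x y) \<longlonglongrightarrow> 0"
  proof (rule Lim_null_comparison)
    show "\<forall>\<^sub>F N in sequentially. norm (haar_kernel N x y - min x y) \<le> (1 / 2) ^ N"
      using haar_kernel_error[OF assms] by simp
    show "(\<lambda>N. (1 / 2) ^ N) \<longlonglongrightarrow> (0::real)" by (rule LIMSEQ_power_zero) simp
  qed
  then show ?thesis by (simp only: LIM_zero_iff)
qed

lemma haar_kernel_zero: "haar_kernel N 0 0 = 0"
  by (simp add: haar_kernel_def tent_kernel_def tent_eq_0)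

text \<open>The noise \<open>z (i, n, j)\<close> drives the window \<open>i\<close> on the level \<open>n\<close> of the Schauder functions; in
  particular \<open>z (i, 0, 0)\<close> is the normalised increment over the window.\<close>

definition level :: "(nat \<times> nat \<times> nat \<Rightarrow> 'a::real_normed_vector) \<Rightarrow> nat \<Rightarrow> nat \<Rightarrow> real \<Rightarrow> 'a" where
  "level z i n x = (\<Sum>j<width n. hat n j x *\<^sub>R z (i, n, j))"

text \<open>Level 0 is included, so this is a full Brownian path over a unit window with end value
  \<open>z (i, 0, 0)\<close>; the levels from 1 on form the part pinned at both ends.\<close>

definition bridge :: "(nat \<times> nat \<times> nat \<Rightarrow> 'a::real_normed_vector) \<Rightarrow> nat \<Rightarrow> real \<Rightarrow> 'a" where
  "bridge z i x = (\<Sum>n. level z i n x)"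

text \<open>The bound 2 ^ (n / 4) is weak enough to hold almost surely for Gaussian noises and
  strong enough to be summable against the decay 2 ^ (- n / 2) of the Schauder functions. It leaves
  level 0 free, so it depends only on the noises that the two motions share.\<close>

definition tame :: "(nat \<times> nat \<times> nat \<Rightarrow> 'a::real_normed_vector) \<Rightarrow> bool" where
  "tame z \<longleftrightarrow> (\<forall>i. \<forall>\<^sub>F n in sequentially. \<forall>j<2 ^ n. norm (z (i, Suc n, j)) \<le> sqrt (sqrt 2) ^ n)"

text \<open>At any point a single tent of the level is active, so a bound on the largest noise
  replaces a sum over \<open>2 ^ n\<close> of them.\<close>

lemma norm_level_le:
  assumes "\<And>j. j < 2 ^ n \<Longrightarrow> norm (z (i, Suc n, j)) \<le> B" "0 \<le> B"
  shows "norm (level z i (Suc n) x) \<le> (1 / sqrt 2) ^ n * B"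
proof -
  have "norm (level z i (Suc n) x) \<le> (\<Sum>j<2 ^ n. norm (hat (Suc n) j x *\<^sub>R z (i, Suc n, j)))"
    unfolding level_def width_simps by (rule norm_sum)
  also have "\<dots> \<le> (\<Sum>j<2 ^ n. (1 / sqrt 2) ^ n * B * tent (2 ^ n * x - real j))"
  proof (rule sum_mono)
    fix j :: nat assume "j \<in> {..<2 ^ n}"
    then have "(1 / sqrt 2) ^ n * tent (2 ^ n * x - real j) * norm (z (i, Suc n, j)) \<le> (1 / sqrt 2) ^ n * tent (2 ^ n * x - real j) * B"
      using assms(1) tent_nonneg by (intro mult_left_mono mult_nonneg_nonneg) auto
    then show "norm (hat (Suc n) j x *\<^sub>R z (i, Suc n, j)) \<le> (1 / sqrt 2) ^ n * B * tent (2 ^ n * x - real j)"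
      using tent_nonneg by (simp add: abs_mult mult_ac)
  qed
  also have "\<dots> = (1 / sqrt 2) ^ n * B * (\<Sum>j<2 ^ n. tent (2 ^ n * x - real j))"
    by (simp add: sum_distrib_left)
  also have "\<dots> \<le> (1 / sqrt 2) ^ n * B * 1"
    using assms(2) by (intro mult_left_mono sum_tent_le) auto
  finally show ?thesis by simp
qed

lemma level_zero [simp]: "level z i n 0 = 0"
  by (simp add: level_def)

lemma bridge_zero [simp]: "bridge z i 0 = 0"
  by (simp add: bridge_def)

context
  fixes z :: "nat \<times> nat \<times> nat \<Rightarrow> 'a::banach"
  assumes tame: "tame z"
begin

lemma uniform_limit_bridge:
  "uniform_limit UNIV (\<lambda>N x. \<Sum>n<N. level z i n x) (bridge z i) sequentially"
proof -
  \<comment> \<open>Level \<open>Suc n\<close> carries the scale \<open>n\<close>, hence the shift.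
    At 0 truncated subtraction gives 1, which is harmless because the bound is applied to large
    levels only.\<close>
  define M where "M n = (1 / sqrt (sqrt 2)) ^ (n - 1)" for n
  have "summable (\<lambda>n. M (Suc n))"
    unfolding M_def by (simp add: summable_geometric)
  then have M: "summable M" by (simp only: summable_Suc_iff)
  have "sqrt 2 = sqrt (sqrt 2) * sqrt (sqrt (2::real))" by simp
  then have e: "(1 / sqrt 2) * sqrt (sqrt 2) = 1 / sqrt (sqrt (2::real))"
    by (simp add: field_simps)
  have "\<forall>\<^sub>F n in sequentially. \<forall>x\<in>UNIV. norm (level z i (Suc n) x) \<le> M (Suc n)"
    using tame[unfolded tame_def, rule_format, of i]
  proof eventually_elim
    case (elim n)
    have "norm (level z i (Suc n) x) \<le> (1 / sqrt 2) ^ n * sqrt (sqrt 2) ^ n" for x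
      using elim by (intro norm_level_le) auto
    then show ?case by (simp only: M_def diff_Suc_1 power_mult_distrib[symmetric] e) simp
  qed
  then have "\<forall>\<^sub>F n in sequentially. \<forall>x\<in>UNIV. norm (level z i n x) \<le> M n"
    by (subst (asm) eventually_sequentially_Suc)
  then have "uniform_limit UNIV (\<lambda>N x. \<Sum>n<N. level z i n x) (\<lambda>x. \<Sum>n. level z i n x) sequentially"
    using M by (rule Weierstrass_m_test_ev)
  then show ?thesis by (simp only: bridge_def[abs_def])
qed

lemma level_sums_bridge: "(\<lambda>n. level z i n x) sums bridge z i x"
  unfolding sums_def by (rule tendsto_uniform_limitI[OF uniform_limit_bridge]) simp

lemma continuous_on_bridge: "continuous_on UNIV (bridge z i)"
proof (rule uniform_limit_theorem[OF _ uniform_limit_bridge])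
  show "\<forall>\<^sub>F N in sequentially. continuous_on UNIV (\<lambda>x. \<Sum>n<N. level z i n x)"
    unfolding level_def by (intro always_eventually allI continuous_intros)
qed simp

end

lemma bridge_diff:
  fixes z z' :: "nat \<times> nat \<times> nat \<Rightarrow> 'a::banach"
  assumes "tame z" "tame z'" and eq: "\<And>n j. z (i, Suc n, j) = z' (i, Suc n, j)"
  shows "bridge z i x - bridge z' i x = x *\<^sub>R (z (i, 0, 0) - z' (i, 0, 0))"
proof -
  have "(\<lambda>n. level z i n x - level z' i n x) sums (bridge z i x - bridge z' i x)"
    by (intro sums_diff level_sums_bridge assms)
  moreover have "(\<lambda>n. level z i n x - level z' i n x) = (\<lambda>n. if n = 0 then x *\<^sub>R (z (i, 0, 0) - z' (i, 0, 0)) else 0)"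
  proof
    fix n show "level z i n x - level z' i n x = (if n = 0 then x *\<^sub>R (z (i, 0, 0) - z' (i, 0, 0)) else 0)"
      by (cases n) (auto simp: level_def eq scaleR_diff_right)
  qed
  moreover have "(\<lambda>n. if n = 0 then x *\<^sub>R (z (i, 0, 0) - z' (i, 0, 0)) else 0) sums (x *\<^sub>R (z (i, 0, 0) - z' (i, 0, 0)))"
    using sums_single[of 0 "\<lambda>_. x *\<^sub>R (z (i, 0, 0) - z' (i, 0, 0))"] by simp
  ultimately show ?thesis using sums_unique2 by metis
qed

section \<open>Windows of time\<close>

locale windows =
  fixes r :: "nat \<Rightarrow> real"
  assumes r_ge_1: "1 \<le> r i"
begin

definition start :: "nat \<Rightarrow> real" where "start n = (\<Sum>i<n. (r i)\<^sup>2)"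

definition clock :: "nat \<Rightarrow> real \<Rightarrow> real" where
  "clock i t = max 0 (min 1 ((t - start i) / (r i)\<^sup>2))"

lemma r2: "1 \<le> (r i)\<^sup>2" "0 < (r i)\<^sup>2"
proof -
  show "1 \<le> (r i)\<^sup>2" using r_ge_1[of i] by (simp add: one_le_power)
  then show "0 < (r i)\<^sup>2" by linarith
qed

lemma start_Suc: "start (Suc n) = start n + (r n)\<^sup>2"
  by (simp add: start_def)

text \<open>The lower bound on the radii makes the windows exhaust the half-line, so by time
  \<open>t\<close> only the first \<open>horizon t\<close> of them can have begun.\<close>

lemma start_ge: "real n \<le> start n"
proof (induction n)
  case (Suc n) then show ?case using r2(1)[of n] by (simp add: start_Suc)
qed (simp add: start_def)

lemma start_mono: "m \<le> n \<Longrightarrow> start m \<le> start n"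
  unfolding start_def using r2 by (intro sum_mono2) (auto intro: less_imp_le)

lemma clock_range: "clock i t \<in> {0..1}"
  by (simp add: clock_def)

lemma clock_eq_0: "t \<le> start i \<Longrightarrow> clock i t = 0"
  using divide_nonpos_pos[OF _ r2(2), of "t - start i" i] by (simp add: clock_def)

lemma clock_eq_1: "start (Suc i) \<le> t \<Longrightarrow> clock i t = 1"
  using r2(2)[of i] by (simp add: clock_def start_Suc min_def)

lemma clock_min: "min (clock i s) (clock i t) = clock i (min s t)"
proof (cases "s \<le> t")
  case True
  then have "clock i s \<le> clock i t"
    using r2(2)[of i] unfolding clock_def by (intro max.mono min.mono divide_right_mono) auto
  then show ?thesis using True by simp
next
  case False
  then have "clock i t \<le> clock i s"
    using r2(2)[of i] unfolding clock_def by (intro max.mono min.mono divide_right_mono) auto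
  then show ?thesis using False by simp
qed

lemma r2_clock: "(r i)\<^sup>2 * clock i t = max 0 (min ((r i)\<^sup>2) (t - start i))"
proof -
  have "(r i)\<^sup>2 * clock i t = max ((r i)\<^sup>2 * 0) (min ((r i)\<^sup>2 * 1) ((r i)\<^sup>2 * ((t - start i) / (r i)\<^sup>2)))"
    unfolding clock_def by (simp add: max_mult_distrib_left min_mult_distrib_left)
  then show ?thesis using r2(2)[of i] by simp
qed

lemma sum_clock: "0 \<le> t \<Longrightarrow> (\<Sum>i<n. (r i)\<^sup>2 * clock i t) = min t (start n)"
proof (induction n)
  case (Suc n)
  have *: "min t s + max 0 (min q (t - s)) = min t (s + q)" if "0 < q" for q s :: real
    using that by (auto simp: max_def min_def)
  show ?case unfolding sum.lessThan_Suc Suc.IH[OF Suc.prems] r2_clock[of n] start_Suc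
    by (rule *[OF r2(2)])
qed (simp add: start_def)

lemma continuous_on_clock: "continuous_on S (clock i)"
  unfolding clock_def[abs_def] using r2(2)[of i] by (intro continuous_intros) auto

text \<open>Brownian scaling: in a window of length \<open>(r i)\<^sup>2\<close> the noise enters
  with the factor \<open>r i\<close>. A triple names window, level and position.\<close>

definition coeff :: "nat \<times> nat \<times> nat \<Rightarrow> real \<Rightarrow> real" where
  "coeff = (\<lambda>(i, n, j) t. r i * hat n j (clock i t))"

definition indices :: "nat \<Rightarrow> (nat \<times> nat \<times> nat) set" where
  "indices N = (SIGMA i:{..<N}. SIGMA n:{..N}. {..<width n})"

lemma finite_indices: "finite (indices N)"
  unfolding indices_def by (intro finite_SigmaI) auto

lemma sum_indices: "(\<Sum>a\<in>indices N. g a) = (\<Sum>i<N. \<Sum>n\<le>N. \<Sum>j<width n. g (i, n, j))"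
  unfolding indices_def by (simp add: sum.Sigma case_prod_unfold)

definition horizon :: "real \<Rightarrow> nat" where "horizon t = nat \<lceil>t\<rceil>"

lemma horizon_clock: "horizon t \<le> i \<Longrightarrow> clock i t = 0"
proof (rule clock_eq_0)
  assume "horizon t \<le> i"
  then have "t \<le> real i" unfolding horizon_def by linarith
  then show "t \<le> start i" using start_ge[of i] by simp
qed

text \<open>Distinct windows use distinct noises and contribute separately. In each of them the Haar
  kernel tends to the minimum of the two clocks, and weighted with the lengths these minima add up
  to the elapsed time.\<close>

lemma coeff_tendsto:
  assumes "0 \<le> s" "0 \<le> t"
  shows "(\<lambda>N. \<Sum>a\<in>indices N. coeff a s * coeff a t) \<longlonglongrightarrow> min s t"
proof -
  \<comment> \<open>The truncation grows in windows and levels together. From \<open>I\<close> on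
    further windows contribute nothing, so the limit concerns the levels in a fixed finite
    sum.\<close>
  define I where "I = max (horizon s) (horizon t)"
  have "(\<lambda>N. \<Sum>i<I. (r i)\<^sup>2 * haar_kernel N (clock i s) (clock i t)) \<longlonglongrightarrow> (\<Sum>i<I. (r i)\<^sup>2 * min (clock i s) (clock i t))"
    using clock_range by (intro tendsto_intros haar_kernel_tendsto)
  also have "(\<Sum>i<I. (r i)\<^sup>2 * min (clock i s) (clock i t)) = min (min s t) (start I)"
    using sum_clock[of "min s t" I] assms by (simp add: clock_min)
  also have "\<dots> = min s t"
  proof -
    have "t \<le> real I" unfolding I_def horizon_def by linarith
    then show ?thesis using start_ge[of I] by simp
  qed
  finally show ?thesis
  proof (rule Lim_transform_eventually)
    show "\<forall>\<^sub>F N in sequentially. (\<Sum>i<I. (r i)\<^sup>2 * haar_kernel N (clock i s) (clock i t)) = (\<Sum>a\<in>indices N. coeff a s * coeff a t)"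
      using eventually_ge_at_top[of I]
    proof eventually_elim
      case (elim N)
      have "(\<Sum>a\<in>indices N. coeff a s * coeff a t) = (\<Sum>i<N. (r i)\<^sup>2 * (\<Sum>n\<le>N. \<Sum>j<width n. hat n j (clock i s) * hat n j (clock i t)))"
        unfolding sum_indices sum_distrib_left coeff_def by (intro sum.cong refl) (simp add: power2_eq_square mult_ac)
      also have "\<dots> = (\<Sum>i<N. (r i)\<^sup>2 * haar_kernel N (clock i s) (clock i t))"
        by (simp only: sum_hat_hat)
      also have "\<dots> = (\<Sum>i<I. (r i)\<^sup>2 * haar_kernel N (clock i s) (clock i t))"
        using elim by (intro sum.mono_neutral_right) (auto simp: I_def horizon_clock haar_kernel_zero)
      finally show ?case by simp
    qed
  qed
qed

definition path :: "(nat \<times> nat \<times> nat \<Rightarrow> 'a::banach) \<Rightarrow> real \<Rightarrow> 'a" where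
  "path z t = (\<Sum>i<horizon t. r i *\<^sub>R bridge z i (clock i t))"

lemma path_eq: "horizon t \<le> I \<Longrightarrow> path z t = (\<Sum>i<I. r i *\<^sub>R bridge z i (clock i t))"
  unfolding path_def by (rule sum.mono_neutral_left) (auto simp: horizon_clock)

lemma path_0 [simp]: "path z 0 = 0"
  by (simp add: path_def horizon_def)

lemma path_tendsto:
  assumes z: "tame z"
  shows "(\<lambda>N. \<Sum>a\<in>indices N. coeff a t *\<^sub>R z a) \<longlonglongrightarrow> path z t"
proof -
  have "(\<lambda>N. \<Sum>i<horizon t. r i *\<^sub>R (\<Sum>n\<le>N. level z i n (clock i t))) \<longlonglongrightarrow> path z t"
    unfolding path_def using level_sums_bridge[OF z] unfolding sums_def_le by (intro tendsto_intros)
  then show ?thesis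
  proof (rule Lim_transform_eventually)
    show "\<forall>\<^sub>F N in sequentially. (\<Sum>i<horizon t. r i *\<^sub>R (\<Sum>n\<le>N. level z i n (clock i t))) = (\<Sum>a\<in>indices N. coeff a t *\<^sub>R z a)"
      using eventually_ge_at_top[of "horizon t"]
    proof eventually_elim
      case (elim N)
      have "(\<Sum>a\<in>indices N. coeff a t *\<^sub>R z a) = (\<Sum>i<N. r i *\<^sub>R (\<Sum>n\<le>N. level z i n (clock i t)))"
        unfolding sum_indices level_def scaleR_sum_right coeff_def by simp
      also have "\<dots> = (\<Sum>i<horizon t. r i *\<^sub>R (\<Sum>n\<le>N. level z i n (clock i t)))"
        using elim by (intro sum.mono_neutral_right) (auto simp: horizon_clock)
      finally show ?case by simp
    qed
  qed
qed

lemma continuous_on_path: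
  assumes z: "tame z"
  shows "continuous_on S (path z)"
proof -
  have "continuous (at t) (path z)" for t
  proof -
    define I where "I = Suc (horizon t)"
    have b: "continuous_on UNIV (\<lambda>s. bridge z i (clock i s))" for i
      using continuous_on_compose2[OF continuous_on_bridge[OF z] continuous_on_clock] by blast
    have "continuous_on UNIV (\<lambda>s. \<Sum>i<I. r i *\<^sub>R bridge z i (clock i s))"
      by (intro continuous_intros b)
    then have "continuous_on {..<real I} (path z)"
    proof (rule continuous_on_eq[OF continuous_on_subset])
      fix s assume "s \<in> {..<real I}"
      then have "s < real I" by simp
      then have "horizon s \<le> I" unfolding horizon_def by linarith
      then show "(\<Sum>i<I. r i *\<^sub>R bridge z i (clock i s)) = path z s" by (rule path_eq[symmetric])
    qed simp
    moreover have "t < real I" unfolding I_def horizon_def by linarith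
    ultimately show ?thesis by (simp add: continuous_on_eq_continuous_at)
  qed
  then show ?thesis by (simp add: continuous_at_imp_continuous_on)
qed

text \<open>Between the times \<open>start n\<close>, the difference of two paths with the same bridges is interpolated linearly.\<close>

lemma path_difference_tendsto:
  fixes z z' :: "nat \<times> nat \<times> nat \<Rightarrow> 'a::banach"
  assumes z: "tame z" "tame z'" and eq: "\<And>i n j. z (i, Suc n, j) = z' (i, Suc n, j)"
    and D: "\<And>n. D (Suc n) = D n + r n *\<^sub>R (z (n, 0, 0) - z' (n, 0, 0))" "D \<longlonglongrightarrow> 0"
  shows "((\<lambda>t. norm (D 0 + path z t - path z' t)) \<longlongrightarrow> 0) at_top"
proof -
  have interp: "D 0 + path z t - path z' t = (1 - clock n t) *\<^sub>R D n + clock n t *\<^sub>R D (Suc n)"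
    if n: "start n \<le> t" "t \<le> start (Suc n)" for n t
  proof -
    define I where "I = max (horizon t) (Suc n)"
    have "path z t - path z' t = (\<Sum>i<I. r i *\<^sub>R (bridge z i (clock i t) - bridge z' i (clock i t)))"
      by (simp add: path_eq[of t I] I_def sum_subtractf scaleR_diff_right)
    also have "\<dots> = (\<Sum>i<I. clock i t *\<^sub>R (D (Suc i) - D i))"
      by (intro sum.cong refl) (simp add: bridge_diff[OF z eq] D mult.commute)
    also have "\<dots> = (\<Sum>i<Suc n. clock i t *\<^sub>R (D (Suc i) - D i))"
    proof (rule sum.mono_neutral_right)
      show "\<forall>i\<in>{..<I} - {..<Suc n}. clock i t *\<^sub>R (D (Suc i) - D i) = 0"
        using n start_mono by (auto simp: not_less_eq intro!: clock_eq_0) (metis Suc_le_eq order_trans)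
    qed (auto simp: I_def)
    also have "\<dots> = (\<Sum>i<n. D (Suc i) - D i) + clock n t *\<^sub>R (D (Suc n) - D n)"
    proof -
      have "clock i t = 1" if "i < n" for i
        using n(1) start_mono[of "Suc i" n] that by (intro clock_eq_1) linarith
      then show ?thesis by simp
    qed
    also have "(\<Sum>i<n. D (Suc i) - D i) = D n - D 0" by (rule sum_lessThan_telescope)
    finally show ?thesis by (simp add: algebra_simps)
  qed
  show ?thesis
  proof (rule tendstoI)
    fix \<epsilon> :: real assume \<epsilon>: "\<epsilon> > 0"
    then have "\<forall>\<^sub>F n in sequentially. norm (D n) < \<epsilon>"
      using D(2) by (auto dest: tendstoD simp: dist_norm)
    then obtain N where N: "\<And>n. n \<ge> N \<Longrightarrow> norm (D n) < \<epsilon>" by (auto simp: eventually_sequentially)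
    have "norm (D 0 + path z t - path z' t) < \<epsilon>" if t: "t \<ge> start N" for t
    proof -
      have "t \<le> start (Suc (horizon t))" using start_ge[of "Suc (horizon t)"] unfolding horizon_def by simp linarith
      then have ex: "\<exists>n. t \<le> start (Suc n)" by blast
      define n where "n = (LEAST n. t \<le> start (Suc n))"
      have n1: "t \<le> start (Suc n)" unfolding n_def by (rule LeastI_ex[OF ex])
      show ?thesis
      \<comment> \<open>At \<open>t = start N\<close> with \<open>N > 0\<close> the least window
        found is the preceding one, and the bound does not cover the difference at its start.
        Interpolation in window \<open>N\<close> with clock 0 is used instead.\<close>
      proof (cases "t = start N")
        case True
        then show ?thesis
          using interp[of N t] start_mono[of N "Suc N"] N[of N] by (simp add: clock_eq_0)
      next
        case False
        have nN: "N \<le> n"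
        proof (rule ccontr)
          assume "\<not> N \<le> n"
          then have "start (Suc n) \<le> start N" by (intro start_mono) simp
          then show False using n1 t False by simp
        qed
        have "start n \<le> t"
        proof (cases n)
          case 0 then show ?thesis using t start_mono[of 0 N] by simp
        next
          case (Suc m)
          then have "\<not> t \<le> start (Suc m)" using not_less_Least[of m "\<lambda>n. t \<le> start (Suc n)"] n_def by simp
          then show ?thesis using Suc by simp
        qed
        from interp[OF this n1]
        have "norm (D 0 + path z t - path z' t) \<le> (1 - clock n t) * norm (D n) + clock n t * norm (D (Suc n))"
          using clock_range[of n t] by (simp add: norm_triangle_le)
        also have "\<dots> < \<epsilon>"
          using clock_range[of n t] N[OF nN] N[of "Suc n"] nN
          by (intro convex_bound_lt) auto
        finally show ?thesis .
      qed
    qed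
    then show "\<forall>\<^sub>F t in at_top. dist (norm (D 0 + path z t - path z' t)) 0 < \<epsilon>"
      by (intro eventually_mono[OF eventually_ge_at_top[of "start N"]]) simp
  qed
qed

end

section \<open>The coupling of the increments\<close>

text \<open>An i.i.d. family keeps its law when the coordinate \<open>a\<close> is drawn afresh. As
  \<open>G\<close> does not see that coordinate, averaging over it replaces \<open>\<psi>\<close> by
  a constant; this amounts to conditioning on all other coordinates.\<close>

lemma (in prob_space) integral_resample:
  fixes G \<psi> :: "('i \<Rightarrow> 'a) \<Rightarrow> complex" and a :: 'i
  defines "P \<equiv> PiM (UNIV :: 'i set) (\<lambda>_. M)"
  assumes meas [measurable]: "G \<in> borel_measurable P" "\<psi> \<in> borel_measurable P"
    and bounded: "\<And>\<omega>. norm (G \<omega>) \<le> 1" "\<And>\<omega>. norm (\<psi> \<omega>) \<le> 1"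
    and G: "\<And>\<omega> x. G (\<omega> (a := x)) = G \<omega>"
    and \<psi>: "\<And>\<omega>. \<omega> \<in> space P \<Longrightarrow> (\<integral>x. \<psi> (\<omega> (a := x)) \<partial>M) = c"
  shows "(\<integral>\<omega>. G \<omega> * \<psi> \<omega> \<partial>P) = (\<integral>\<omega>. G \<omega> \<partial>P) * c"
proof -
  interpret P: prob_space P unfolding P_def by (intro prob_space_PiM prob_space_axioms)
  interpret MP: pair_prob_space M P ..
  let ?u = "\<lambda>(x, \<omega>). \<omega> (a := x)"
  have u: "?u \<in> M \<Otimes>\<^sub>M P \<rightarrow>\<^sub>M P"
    unfolding P_def case_prod_unfold by (rule measurable_fun_upd[where J=UNIV]) auto
  have P: "distr (M \<Otimes>\<^sub>M P) P ?u = P"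
    using distr_pair_PiM_eq_PiM[of UNIV "\<lambda>_. M" a] prob_space_axioms by (simp add: P_def)
  have le: "norm (G \<omega> * \<psi> \<omega>) \<le> 1" for \<omega>
    using bounded[of \<omega>] by (simp add: norm_mult mult_le_one)
  have "(\<integral>\<omega>. G \<omega> * \<psi> \<omega> \<partial>P) = (\<integral>\<omega>. G \<omega> * \<psi> \<omega> \<partial>distr (M \<Otimes>\<^sub>M P) P ?u)" by (simp only: P)
  also have "\<dots> = (\<integral>z. G (?u z) * \<psi> (?u z) \<partial>(M \<Otimes>\<^sub>M P))"
    by (rule integral_distr[OF u]) measurable
  also have "\<dots> = (\<integral>z. (case z of (x, \<omega>) \<Rightarrow> G \<omega> * \<psi> (\<omega> (a := x))) \<partial>(M \<Otimes>\<^sub>M P))"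
    by (simp add: case_prod_unfold G)
  also have "\<dots> = (\<integral>\<omega>. \<integral>x. G \<omega> * \<psi> (\<omega> (a := x)) \<partial>M \<partial>P)"
  proof (rule MP.integral_snd[symmetric])
    have [measurable]: "(\<lambda>z. \<psi> (?u z)) \<in> borel_measurable (M \<Otimes>\<^sub>M P)"
      using u by (rule measurable_compose) measurable
    have "(\<lambda>(x, \<omega>). G \<omega> * \<psi> (\<omega> (a := x))) = (\<lambda>z. G (snd z) * \<psi> (?u z))" by auto
    also have "\<dots> \<in> borel_measurable (M \<Otimes>\<^sub>M P)" by measurable
    finally have m: "(\<lambda>(x, \<omega>). G \<omega> * \<psi> (\<omega> (a := x))) \<in> borel_measurable (M \<Otimes>\<^sub>M P)" .
    show "integrable (M \<Otimes>\<^sub>M P) (\<lambda>(x, \<omega>). G \<omega> * \<psi> (\<omega> (a := x)))"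
      using m
    proof (rule MP.integrable_const_bound[where B=1, rotated])
      show "AE z in M \<Otimes>\<^sub>M P. norm (case z of (x, \<omega>) \<Rightarrow> G \<omega> * \<psi> (\<omega> (a := x))) \<le> 1"
        using le[of "_(a := _)"] by (intro AE_I2) (auto simp: G)
    qed
  qed
  also have "\<dots> = (\<integral>\<omega>. G \<omega> * c \<partial>P)"
    using \<psi> by (intro Bochner_Integration.integral_cong) simp_all
  finally show ?thesis by simp
qed

section \<open>Adapted noises on a product space\<close>

context orthonormal_basis
begin

text \<open>The uniform entry decides acceptance, the Gaussian entry is the noise of the first
  motion.\<close>

definition noise :: "(real \<times> 'w) measure" where "noise = unif \<Otimes>\<^sub>M \<mu>"

definition noises :: "(nat \<times> nat \<times> nat \<Rightarrow> real \<times> 'w) measure" where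
  "noises = PiM UNIV (\<lambda>_. noise)"

lemma sets_noise [measurable_cong]: "sets noise = sets (borel \<Otimes>\<^sub>M borel)"
  unfolding noise_def by (rule sets_pair_measure_cong) simp_all

lemma space_noise: "space noise = UNIV"
  by (simp add: noise_def space_pair_measure)

lemma space_noises [simp]: "space noises = UNIV"
  by (simp add: noises_def space_PiM space_noise)

lemma prob_space_noise: "prob_space noise"
proof -
  interpret pair_prob_space unif \<mu> ..
  show ?thesis unfolding noise_def by (rule prob_space_axioms)
qed

lemma prob_space_noises: "prob_space noises"
  unfolding noises_def by (intro prob_space_PiM prob_space_noise)

lemma measurable_noises [measurable]: "(\<lambda>\<omega>. \<omega> a) \<in> noises \<rightarrow>\<^sub>M borel \<Otimes>\<^sub>M borel"
  unfolding noises_def using measurable_component_singleton[of a UNIV "\<lambda>_. noise"] by measurable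

lemma measurable_fst_noises [measurable]: "(\<lambda>\<omega>. fst (\<omega> a)) \<in> borel_measurable noises"
  by (rule measurable_compose[OF measurable_noises measurable_fst])

lemma measurable_snd_noises [measurable]: "(\<lambda>\<omega>. snd (\<omega> a)) \<in> borel_measurable noises"
  by (rule measurable_compose[OF measurable_noises measurable_snd])

lemma distr_snd_noise: "distr noise borel snd = \<mu>"
proof -
  \<comment> \<open>With no coordinate to couple, the kick is the identity, so its invariance yields
    the marginal.\<close>
  have "kick 0 x u z = z" for x u z by (simp add: kick_def proj_def)
  then show ?thesis using kick_invariant[of 0 0] by (simp add: noise_def case_prod_unfold)
qed

text \<open>A criterion for noises built adaptively. Every finite set of indices has a last one,
  whose own coordinate no other noise in the set consults, and given all other coordinates its law
  is \<open>\<mu>\<close>. Removing such indices one by one factorises the characteristic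
  function.\<close>

lemma iid_gaussianI:
  assumes meas: "\<And>a. Z a \<in> borel_measurable noises"
    and fresh: "\<And>A. finite A \<Longrightarrow> A \<noteq> {} \<Longrightarrow> \<exists>a\<in>A. \<forall>b\<in>A - {a}. \<forall>\<omega> x. Z b (\<omega> (a := x)) = Z b \<omega>"
    and law: "\<And>a \<omega>. distr noise borel (\<lambda>x. Z a (\<omega> (a := x))) = \<mu>"
  shows "iid_gaussian noises Z"
proof -
  interpret N: prob_space noise by (rule prob_space_noise)
  interpret P: prob_space noises by (rule prob_space_noises)
  note [measurable] = meas
  have "(CLINT \<omega>|noises. iexp (\<Sum>a\<in>A. blinfun_apply (l a) (Z a \<omega>))) = exp (- (\<Sum>a\<in>A. Cov \<mu> (l a) (l a)) / 2)"
    if "finite A" for A l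
    using that
  proof (induction A rule: finite_psubset_induct)
    case (psubset A)
    show ?case
    proof (cases "A = {}")
      case True
      then show ?thesis using P.prob_space by simp
    next
      case False
      then obtain a where a: "a \<in> A" and ind: "\<And>b \<omega> x. b \<in> A - {a} \<Longrightarrow> Z b (\<omega> (a := x)) = Z b \<omega>"
        using fresh[OF psubset.hyps(1)] by blast
      let ?G = "\<lambda>\<omega>. iexp (\<Sum>b\<in>A - {a}. blinfun_apply (l b) (Z b \<omega>))"
      let ?\<psi> = "\<lambda>\<omega>. iexp (blinfun_apply (l a) (Z a \<omega>))"
      have inner: "(\<integral>x. ?\<psi> (\<omega> (a := x)) \<partial>noise) = exp (- Cov \<mu> (l a) (l a) / 2)" for \<omega>
      proof -
        have "(\<lambda>x. \<omega> (a := x)) \<in> noise \<rightarrow>\<^sub>M noises"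
          unfolding noises_def by (rule measurable_fun_upd[where J=UNIV]) (auto simp: space_PiM space_noise)
        from measurable_compose[OF this meas[of a]]
        have m: "(\<lambda>x. Z a (\<omega> (a := x))) \<in> borel_measurable noise" .
        have "(\<integral>x. ?\<psi> (\<omega> (a := x)) \<partial>noise) = (CLINT z|distr noise borel (\<lambda>x. Z a (\<omega> (a := x))). iexp (blinfun_apply (l a) z))"
          by (rule integral_distr[OF m, symmetric]) measurable
        then show ?thesis by (simp only: law char_functional)
      qed
      have "(CLINT \<omega>|noises. iexp (\<Sum>a\<in>A. blinfun_apply (l a) (Z a \<omega>))) = (CLINT \<omega>|noises. ?G \<omega> * ?\<psi> \<omega>)"
        using psubset.hyps(1) a
        by (intro Bochner_Integration.integral_cong refl) (simp add: sum.remove[of A a] exp_add ring_distribs mult.commute)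
      also have "\<dots> = (CLINT \<omega>|noises. ?G \<omega>) * exp (- Cov \<mu> (l a) (l a) / 2)"
        unfolding noises_def
      proof (rule N.integral_resample)
        show "?G (\<omega> (a := x)) = ?G \<omega>" for \<omega> x using ind by simp
      qed (use inner in \<open>simp_all flip: noises_def\<close>)
      also have "(CLINT \<omega>|noises. ?G \<omega>) = exp (- (\<Sum>b\<in>A - {a}. Cov \<mu> (l b) (l b)) / 2)"
        using a by (intro psubset.IH) auto
      also have "complex_of_real (exp (- (\<Sum>b\<in>A - {a}. Cov \<mu> (l b) (l b)) / 2)) * complex_of_real (exp (- Cov \<mu> (l a) (l a) / 2))
         = complex_of_real (exp (- (\<Sum>b\<in>A - {a}. Cov \<mu> (l b) (l b)) / 2 + - Cov \<mu> (l a) (l a) / 2))"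
        by (simp only: exp_add of_real_mult)
      also have "- (\<Sum>b\<in>A - {a}. Cov \<mu> (l b) (l b)) / 2 + - Cov \<mu> (l a) (l a) / 2 = - (\<Sum>b\<in>A. Cov \<mu> (l b) (l b)) / 2"
        using psubset.hyps(1) a by (simp add: sum.remove[of A a] add_divide_distrib)
      finally show ?thesis .
    qed
  qed
  then show ?thesis
    unfolding iid_gaussian_def using meas prob_space_noises by blast
qed

lemma iid_gaussian_noises: "iid_gaussian noises (\<lambda>a \<omega>. snd (\<omega> a))"
proof (rule iid_gaussianI)
  show "(\<lambda>\<omega>. snd (\<omega> a)) \<in> borel_measurable noises" for a by measurable
  show "\<exists>a\<in>A. \<forall>b\<in>A - {a}. \<forall>\<omega> x. snd ((\<omega> (a := x)) b) = snd (\<omega> b)" if "A \<noteq> {}" for A :: "(nat \<times> nat \<times> nat) set"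
    using that by auto
  show "distr noise borel (\<lambda>x. snd ((\<omega> (a := x)) a)) = \<mu>" for \<omega> a
    using distr_snd_noise by (simp add: eta_contract_eq[symmetric])
qed

text \<open>In the window \<open>n\<close> of length \<open>\<rho> ^ 2\<close>, the first \<open>n\<close> coordinates of the current difference \<open>D\<close> are to be coupled.\<close>

definition rejected :: "nat \<Rightarrow> real \<Rightarrow> ((nat \<times> nat \<times> nat \<Rightarrow> real \<times> 'w) \<Rightarrow> 'w) \<Rightarrow> (nat \<times> nat \<times> nat \<Rightarrow> real \<times> 'w) set" where
  "rejected n \<rho> D = {\<omega>. \<not> accept n ((1 / \<rho>) *\<^sub>R D \<omega>) (fst (\<omega> (n, 0, 0))) (snd (\<omega> (n, 0, 0)))}"

text \<open>Over a window of length \<rho> ^ 2 the noise enters multiplied by \<rho>, so the shift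
  that cancels a difference has to be divided by \<rho>.\<close>

definition coupled :: "nat \<Rightarrow> real \<Rightarrow> ((nat \<times> nat \<times> nat \<Rightarrow> real \<times> 'w) \<Rightarrow> 'w) \<Rightarrow> (nat \<times> nat \<times> nat \<Rightarrow> real \<times> 'w) \<Rightarrow> 'w" where
  "coupled n \<rho> D \<omega> = kick n ((1 / \<rho>) *\<^sub>R D \<omega>) (fst (\<omega> (n, 0, 0))) (snd (\<omega> (n, 0, 0)))"

text \<open>It depends on the random variable \<open>D\<close> as a whole and not on the outcome, so
  the window lengths are deterministic. The cap on the failure probability is chosen to be summable
  over the windows.\<close>

definition scale :: "nat \<Rightarrow> ((nat \<times> nat \<times> nat \<Rightarrow> real \<times> 'w) \<Rightarrow> 'w) \<Rightarrow> real" where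
  "scale n D = (SOME \<rho>. 1 \<le> \<rho> \<and> measure noises (rejected n \<rho> D) \<le> (1 / 2) ^ n)"

text \<open>The difference of the motions at the start of window \<open>n\<close>. Each scale is
  chosen after the law of the gap at the start of its window is fixed, hence the joint
  recursion.\<close>

primrec gap :: "'w \<Rightarrow> nat \<Rightarrow> (nat \<times> nat \<times> nat \<Rightarrow> real \<times> 'w) \<Rightarrow> 'w" where
  "gap d 0 = (\<lambda>\<omega>. d)"
| "gap d (Suc n) = (\<lambda>\<omega>. gap d n \<omega> + scale n (gap d n) *\<^sub>R (snd (\<omega> (n, 0, 0)) - coupled n (scale n (gap d n)) (gap d n) \<omega>))"

lemma rejected_measurable:
  assumes [measurable]: "D \<in> borel_measurable noises"
  shows "rejected n \<rho> D \<in> sets noises"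
proof -
  have "{\<omega> \<in> space noises. exp (- (\<Sum>k<n. f k ((1 / \<rho>) *\<^sub>R D \<omega>) * f k (snd (\<omega> (n, 0, 0))))
      - (\<Sum>k<n. (f k ((1 / \<rho>) *\<^sub>R D \<omega>))\<^sup>2) / 2) < fst (\<omega> (n, 0, 0))} \<in> sets noises"
    by (rule borel_measurable_less; measurable)
  then show ?thesis by (simp add: rejected_def accept_def form_apply not_le)
qed

lemma coupled_measurable:
  assumes [measurable]: "D \<in> borel_measurable noises"
  shows "coupled n \<rho> D \<in> borel_measurable noises"
  unfolding coupled_def kick_def accept_def form_apply proj_def by measurable

lemma gap_measurable: "gap d n \<in> borel_measurable noises"
proof (induction n)
  case (Suc n)
  note [measurable] = Suc coupled_measurable[OF Suc]
  show ?case by simp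
qed simp

text \<open>For each outcome the exponent in the acceptance condition is of order 1 / \<rho>, so the
  threshold tends to 1. As \<open>D\<close> may be unbounded, no uniform rate is at hand, and
  dominated convergence takes over.\<close>

lemma rejected_tendsto:
  assumes D: "D \<in> borel_measurable noises"
  shows "(\<lambda>m. measure noises (rejected n (real (Suc m)) D)) \<longlonglongrightarrow> 0"
proof -
  interpret P: prob_space noises by (rule prob_space_noises)
  have r: "rejected n \<rho> D \<in> sets noises" for \<rho> by (rule rejected_measurable[OF D])
  have "(\<lambda>m. LINT \<omega>|noises. indicator (rejected n (real (Suc m)) D) \<omega> :: real) \<longlonglongrightarrow> (LINT \<omega>|noises. 0)"
  proof (rule integral_dominated_convergence[where w="\<lambda>_. 1"])
    \<comment> \<open>The threshold may approach 1 from below, so \<open>u < 1\<close> has to be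
      strict.\<close>
    have "AE u in unif. u \<noteq> 1"
    proof -
      have "AE u in lborel. u \<noteq> (1::real)" by (rule AE_lborel_singleton)
      then show ?thesis unfolding unif_def by (intro AE_uniform_measureI) auto
    qed
    moreover have "AE u in unif. u \<le> (1::real)" unfolding unif_def by (intro AE_uniform_measureI) auto
    ultimately have "AE u in unif. u < (1::real)" by eventually_elim simp
    then have "AE p in noise. fst p < 1"
    proof -
      interpret UM: pair_prob_space unif \<mu> ..
      assume "AE u in unif. u < (1::real)"
      then have "AE x in unif. AE y in \<mu>. fst (x, y) < 1" by simp
      moreover have "{p \<in> space (unif \<Otimes>\<^sub>M \<mu>). fst p < 1} \<in> sets (unif \<Otimes>\<^sub>M \<mu>)" by measurable
      ultimately show ?thesis
        unfolding noise_def by (rule UM.AE_pair_measure[rotated])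
    qed
    then have ae: "AE \<omega> in noises. fst (\<omega> (n, 0, 0)) < 1"
      unfolding noises_def by (intro AE_PiM_component) (auto simp: prob_space_noise)
    then show "AE \<omega> in noises. (\<lambda>m. indicator (rejected n (real (Suc m)) D) \<omega> :: real) \<longlonglongrightarrow> 0"
    proof eventually_elim
      case (elim \<omega>)
      let ?u = "fst (\<omega> (n, 0, 0))" and ?z = "snd (\<omega> (n, 0, 0))"
      define q where "q = (\<Sum>k<n. (f k (D \<omega>))\<^sup>2)"
      define p where "p = blinfun_apply (form n (D \<omega>)) ?z"
      have "accept n ((1 / \<rho>) *\<^sub>R D \<omega>) ?u ?z \<longleftrightarrow> ?u \<le> exp (- (1 / \<rho> * p) - (1 / \<rho>)\<^sup>2 * q / 2)" for \<rho>
        by (simp add: accept_def form_apply p_def q_def blinfun.scaleR_right sum_distrib_left power_divide sum_divide_distrib)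
      moreover have "(\<lambda>m. exp (- (1 / real (Suc m) * p) - (1 / real (Suc m))\<^sup>2 * q / 2)) \<longlonglongrightarrow> exp (- (0 * p) - 0\<^sup>2 * q / 2)"
        using LIMSEQ_inverse_real_of_nat by (intro tendsto_intros) (simp_all add: inverse_eq_divide)
      then have "\<forall>\<^sub>F m in sequentially. ?u < exp (- (1 / real (Suc m) * p) - (1 / real (Suc m))\<^sup>2 * q / 2)"
        using elim by (intro order_tendstoD(1)) auto
      ultimately have "\<forall>\<^sub>F m in sequentially. indicator (rejected n (real (Suc m)) D) \<omega> = (0::real)"
        by (auto simp: rejected_def elim!: eventually_mono)
      then show ?case by (rule tendsto_eventually)
    qed
  qed (use r in auto)
  then show ?thesis using r by simp
qed

lemma scale:
  assumes D: "D \<in> borel_measurable noises"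
  shows "1 \<le> scale n D" "measure noises (rejected n (scale n D) D) \<le> (1 / 2) ^ n"
proof -
  have "\<forall>\<^sub>F m in sequentially. measure noises (rejected n (real (Suc m)) D) < (1 / 2) ^ n"
    by (rule order_tendstoD(2)[OF rejected_tendsto[OF D]]) simp
  then obtain m where "measure noises (rejected n (real (Suc m)) D) < (1 / 2) ^ n"
    by (auto simp: eventually_sequentially)
  then have "\<exists>\<rho>. 1 \<le> \<rho> \<and> measure noises (rejected n \<rho> D) \<le> (1 / 2) ^ n"
    by (intro exI[of _ "real (Suc m)"]) simp
  then have "1 \<le> scale n D \<and> measure noises (rejected n (scale n D) D) \<le> (1 / 2) ^ n"
    unfolding scale_def by (rule someI_ex)
  then show "1 \<le> scale n D" "measure noises (rejected n (scale n D) D) \<le> (1 / 2) ^ n" by auto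
qed

definition radius :: "'w \<Rightarrow> nat \<Rightarrow> real" where "radius d n = scale n (gap d n)"

lemma radius_ge_1: "1 \<le> radius d n"
  unfolding radius_def by (rule scale[OF gap_measurable])

definition partner :: "'w \<Rightarrow> nat \<times> nat \<times> nat \<Rightarrow> (nat \<times> nat \<times> nat \<Rightarrow> real \<times> 'w) \<Rightarrow> 'w" where
  "partner d = (\<lambda>(n, m, j) \<omega>. if m = 0 \<and> j = 0 then coupled n (radius d n) (gap d n) \<omega> else snd (\<omega> (n, m, j)))"

lemma gap_fresh:
  assumes "\<And>i. i < n \<Longrightarrow> a \<noteq> (i, 0, 0)"
  shows "gap d n (\<omega> (a := x)) = gap d n \<omega>"
  using assms
proof (induction n)
  case (Suc n)
  have eq: "gap d n (\<omega> (a := x)) = gap d n \<omega>" by (rule Suc.IH) (use Suc.prems in auto)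
  have "(n, 0, 0) \<noteq> a" using Suc.prems[of n] by auto
  note ne = this
  show ?case by (simp only: gap.simps coupled_def fun_upd_other[OF ne] eq)
qed simp

lemma coupled_fresh:
  assumes "\<And>i. i \<le> n \<Longrightarrow> a \<noteq> (i, 0, 0)"
  shows "coupled n \<rho> (gap d n) (\<omega> (a := x)) = coupled n \<rho> (gap d n) \<omega>"
proof -
  have "gap d n (\<omega> (a := x)) = gap d n \<omega>" by (rule gap_fresh) (use assms in auto)
  moreover have "(n, 0, 0) \<noteq> a" using assms[of n] by auto
  ultimately show ?thesis by (simp add: coupled_def)
qed

text \<open>The last index of a finite set is a bridge index if there is one, since no other noise
  consults it, and otherwise the increment of the latest window. There the gap is fixed by the other
  coordinates, and \<open>kick_invariant\<close> applies with \<open>x\<close> frozen.\<close>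

lemma iid_gaussian_partner: "iid_gaussian noises (partner d)"
proof (rule iid_gaussianI)
  show "partner d a \<in> borel_measurable noises" for a
  proof -
    obtain n m j where a: "a = (n, m, j)" by (cases a)
    show ?thesis
    proof (cases "m = 0 \<and> j = 0")
      case True
      then show ?thesis using coupled_measurable[OF gap_measurable] by (simp add: a partner_def)
    next
      case False
      then have "partner d a = (\<lambda>\<omega>. snd (\<omega> a))" by (auto simp: a partner_def)
      then show ?thesis by simp
    qed
  qed
next
  fix A :: "(nat \<times> nat \<times> nat) set" assume A: "finite A" "A \<noteq> {}"
  show "\<exists>a\<in>A. \<forall>b\<in>A - {a}. \<forall>\<omega> x. partner d b (\<omega> (a := x)) = partner d b \<omega>"
  proof (cases "\<exists>a\<in>A. snd a \<noteq> (0, 0)")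
    case True
    then obtain a where a: "a \<in> A" "snd a \<noteq> (0, 0)" by blast
    then have "a \<noteq> (i, 0, 0)" for i by auto
    then have "partner d b (\<omega> (a := x)) = partner d b \<omega>" if "b \<in> A - {a}" for b \<omega> x
      using that by (cases b) (auto simp: partner_def coupled_fresh)
    then show ?thesis using a by blast
  next
    case False
    define n where "n = Max (fst ` A)"
    have "n \<in> fst ` A" unfolding n_def using A by (intro Max_in) auto
    then have nA: "(n, 0, 0) \<in> A" using False by force
    have "partner d b (\<omega> ((n, 0, 0) := x)) = partner d b \<omega>" if b: "b \<in> A - {(n, 0, 0)}" for b \<omega> x
    proof -
      obtain i where i: "b = (i, 0, 0)" using b False by (cases b) force
      have "i \<le> n" unfolding n_def using b i A by (intro Max_ge) force+
      then have "i < n" using b i by (cases "i = n") auto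
      then show ?thesis by (auto simp: i partner_def intro!: coupled_fresh)
    qed
    then show ?thesis using nA by blast
  qed
next
  fix a :: "nat \<times> nat \<times> nat" and \<omega>
  obtain n m j where a: "a = (n, m, j)" by (cases a)
  show "distr noise borel (\<lambda>x. partner d a (\<omega> (a := x))) = \<mu>"
  proof (cases "m = 0 \<and> j = 0")
    case True
    have "gap d n (\<omega> ((n, 0, 0) := x)) = gap d n \<omega>" for x by (rule gap_fresh) simp
    then show ?thesis
      using True kick_invariant[of n "(1 / radius d n) *\<^sub>R gap d n \<omega>"]
      by (simp add: a partner_def coupled_def noise_def case_prod_unfold)
  next
    case False
    then show ?thesis using distr_snd_noise by (auto simp: a partner_def)
  qed
qed

lemma gap_Suc: "gap d (Suc n) \<omega> = gap d n \<omega> + radius d n *\<^sub>R (snd (\<omega> (n, 0, 0)) - partner d (n, 0, 0) \<omega>)"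
  by (simp add: radius_def partner_def)

lemma functional_kick: "n \<le> k \<Longrightarrow> f k (kick n x u z) = f k z"
  by (simp add: kick_def blinfun.add_right blinfun.diff_right blinfun.scaleR_right functional_proj)

text \<open>A kick moves only along \<open>proj n x\<close>, also when it reflects. So the windows
  before \<open>n\<close> leave the coordinates from \<open>n\<close> on at their initial values,
  and a success in window \<open>n\<close> has only lower coordinates to repair.\<close>

lemma functional_gap: "n \<le> k \<Longrightarrow> f k (gap d n \<omega>) = f k d"
  by (induction n) (simp_all add: coupled_def blinfun.add_right blinfun.diff_right blinfun.scaleR_right functional_kick)

lemma proj_scaleR: "proj n (c *\<^sub>R x) = c *\<^sub>R proj n x"
  by (simp add: proj_def blinfun.scaleR_right scaleR_sum_right)

lemma gap_accepted:
  assumes "\<omega> \<notin> rejected n (radius d n) (gap d n)"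
  shows "gap d (Suc n) \<omega> = d - proj n d"
proof -
  have "partner d (n, 0, 0) \<omega> = snd (\<omega> (n, 0, 0)) + (1 / radius d n) *\<^sub>R proj n (gap d n \<omega>)"
    using assms by (simp add: rejected_def partner_def coupled_def kick_def proj_scaleR)
  then have step: "gap d (Suc n) \<omega> = gap d n \<omega> - proj n (gap d n \<omega>)"
    unfolding gap_Suc using radius_ge_1[of d n] by simp
  show ?thesis
  proof (rule eqI_functionals)
    fix k show "f k (gap d (Suc n) \<omega>) = f k (d - proj n d)"
      unfolding step using functional_gap[of n k d \<omega>]
      by (simp add: blinfun.diff_right functional_proj)
  qed
qed

lemma AE_gap_tendsto: "AE \<omega> in noises. (\<lambda>n. gap d n \<omega>) \<longlonglongrightarrow> 0"
proof -
  interpret P: prob_space noises by (rule prob_space_noises)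
  have "AE \<omega> in noises. \<forall>\<^sub>F n in sequentially. \<omega> \<in> space noises - rejected n (radius d n) (gap d n)"
  proof (rule borel_cantelli_AE1)
    show "rejected n (radius d n) (gap d n) \<in> sets noises" for n
      by (rule rejected_measurable[OF gap_measurable])
    show "emeasure noises (rejected n (radius d n) (gap d n)) < \<infinity>" for n
      by (simp add: P.emeasure_eq_measure)
    show "summable (\<lambda>n. measure noises (rejected n (radius d n) (gap d n)))"
    proof (rule summable_comparison_test')
      show "summable (\<lambda>n. (1 / 2 :: real) ^ n)" by (simp add: summable_geometric)
      show "norm (measure noises (rejected n (radius d n) (gap d n))) \<le> (1 / 2) ^ n" if "n \<ge> 0" for n
        using scale(2)[OF gap_measurable] by (simp add: radius_def)
    qed
  qed
  then show ?thesis
  proof eventually_elim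
    case (elim \<omega>)
    have "(\<lambda>n. d - proj n d) \<longlonglongrightarrow> d - d"
      using expansion[of d] unfolding sums_def proj_def by (intro tendsto_intros)
    then have "(\<lambda>n. d - proj n d) \<longlonglongrightarrow> 0" by simp
    then have "(\<lambda>n. gap d (Suc n) \<omega>) \<longlonglongrightarrow> 0"
    proof (rule Lim_transform_eventually)
      show "\<forall>\<^sub>F n in sequentially. d - proj n d = gap d (Suc n) \<omega>"
        using elim by eventually_elim (simp only: gap_accepted Diff_iff not_False_eq_True)
    qed
    then show ?case by (rule LIMSEQ_imp_Suc)
  qed
qed

text \<open>Markov's inequality with the eighth power: the threshold 2 ^ (n / 4) has eighth power 4
  ^ n, against \<open>2 ^ n\<close> noises on the level. The failure probabilities are of order
  \<open>(1 / 2) ^ n\<close>, and Borel-Cantelli applies in each of the countably many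
  windows.\<close>

lemma AE_tame: "AE \<omega> in noises. tame (\<lambda>a. snd (\<omega> a))"
proof -
  interpret P: prob_space noises by (rule prob_space_noises)
  define \<theta> where "\<theta> = sqrt (sqrt (2::real))"
  define C where "C = (\<integral>x. norm x ^ 8 \<partial>\<mu>)"
  have "\<theta> ^ 8 = ((\<theta>\<^sup>2)\<^sup>2)\<^sup>2" by (simp flip: power_mult)
  also have "\<theta>\<^sup>2 = sqrt 2" by (simp add: \<theta>_def)
  finally have \<theta>: "\<theta> > 0" "\<theta> ^ 8 = 4" by (simp_all add: \<theta>_def)
  define E where "E i n = (\<Union>j<2 ^ n. {\<omega> \<in> space noises. \<theta> ^ n < norm (snd (\<omega> (i, Suc n, j)))})" for i n
  have Ej: "{\<omega> \<in> space noises. \<theta> ^ n < norm (snd (\<omega> a))} \<in> sets noises" for n a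
    by measurable
  have "AE \<omega> in noises. \<forall>\<^sub>F n in sequentially. \<omega> \<in> space noises - E i n" for i
  proof (rule borel_cantelli_AE1)
    show E: "E i n \<in> sets noises" for n unfolding E_def using Ej by (intro sets.finite_UN) auto
    show "emeasure noises (E i n) < \<infinity>" for n by (simp add: P.emeasure_eq_measure)
    have single: "measure noises {\<omega> \<in> space noises. \<theta> ^ n < norm (snd (\<omega> a))} \<le> C / 4 ^ n" for n a
    proof -
      have s: "snd \<in> borel_measurable noise"
        unfolding measurable_cong_sets[OF sets_noise refl] by (rule measurable_snd)
      have c: "(\<lambda>\<omega>. \<omega> a) \<in> noises \<rightarrow>\<^sub>M noise"
        unfolding noises_def by (rule measurable_component_singleton) simp
      have "distr noises borel (\<lambda>\<omega>. snd (\<omega> a)) = distr (distr noises noise (\<lambda>\<omega>. \<omega> a)) borel snd"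
        using distr_distr[OF s c] by (simp add: comp_def)
      also have "distr noises noise (\<lambda>\<omega>. \<omega> a) = noise"
        unfolding noises_def by (rule distr_PiM_component) (auto simp: prob_space_noise)
      finally have d: "distr noises borel (\<lambda>\<omega>. snd (\<omega> a)) = \<mu>" by (simp only: distr_snd_noise)
      have "measure noises {\<omega> \<in> space noises. \<theta> ^ n < norm (snd (\<omega> a))} = measure (distr noises borel (\<lambda>\<omega>. snd (\<omega> a))) {x. \<theta> ^ n < norm x}"
        by (subst measure_distr) (auto intro!: arg_cong[where f="measure noises"])
      also have "\<dots> = prob {x. \<theta> ^ n < norm x}" by (simp only: d)
      also have "\<dots> \<le> prob {x \<in> space \<mu>. 4 ^ n \<le> norm x ^ 8}"
      proof (intro finite_measure_mono subsetI)
        fix x :: 'w assume "x \<in> {x. \<theta> ^ n < norm x}"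
        then have "(\<theta> ^ n) ^ 8 \<le> norm x ^ 8" using \<theta>(1) by (intro power_mono) auto
        moreover have "(\<theta> ^ n) ^ 8 = (\<theta> ^ 8) ^ n" by (simp only: power_mult[symmetric] mult.commute)
        ultimately show "x \<in> {x \<in> space \<mu>. 4 ^ n \<le> norm x ^ 8}" using \<theta>(2) by simp
      qed simp
      also have "\<dots> \<le> C / 4 ^ n"
        unfolding C_def by (rule integral_Markov_inequality_measure[OF integrable_norm_power8, of "{}"]) auto
      finally show ?thesis .
    qed
    show "summable (\<lambda>n. measure noises (E i n))"
    proof (rule summable_comparison_test')
      show "summable (\<lambda>n. C * (1 / 2) ^ n)" by (intro summable_mult) (simp add: summable_geometric)
      fix n :: nat assume "n \<ge> 0"
      have "measure noises (E i n) \<le> (\<Sum>j<2 ^ n. measure noises {\<omega> \<in> space noises. \<theta> ^ n < norm (snd (\<omega> (i, Suc n, j)))})"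
        unfolding E_def using Ej by (intro P.finite_measure_subadditive_finite) auto
      also have "\<dots> \<le> (\<Sum>j<(2::nat) ^ n. C / 4 ^ n)" by (intro sum_mono single)
      also have "\<dots> = C * (2 ^ n / 4 ^ n)" by simp
      also have "(2 ^ n / 4 ^ n :: real) = (1 / 2) ^ n" by (simp flip: power_divide)
      finally show "norm (measure noises (E i n)) \<le> C * (1 / 2) ^ n" by simp
    qed
  qed
  then have "AE \<omega> in noises. \<forall>i. \<forall>\<^sub>F n in sequentially. \<omega> \<in> space noises - E i n"
    by (simp add: AE_all_countable)
  then show ?thesis
  proof eventually_elim
    case (elim \<omega>)
    show ?case
      unfolding tame_def
    proof
      fix i
      from elim have "\<forall>\<^sub>F n in sequentially. \<omega> \<in> space noises - E i n" by blast
      then show "\<forall>\<^sub>F n in sequentially. \<forall>j<2 ^ n. norm (snd (\<omega> (i, Suc n, j))) \<le> sqrt (sqrt 2) ^ n"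
        by eventually_elim (auto simp: E_def not_less simp flip: \<theta>_def)
    qed
  qed
qed

text \<open>Continuity of paths is demanded at every point of the sample space, so exceptional null
  sets are cut out of it; characteristic functions do not notice.\<close>

lemma iid_gaussian_restrict:
  assumes Z: "iid_gaussian M Z" and G: "G \<in> sets M" "AE \<omega> in M. \<omega> \<in> G"
  shows "iid_gaussian (restrict_space M G) Z"
proof -
  interpret M: prob_space M using Z unfolding iid_gaussian_def by blast
  have Gs: "G \<inter> space M = G" using sets.sets_into_space[OF G(1)] by blast
  have [measurable]: "Z a \<in> borel_measurable M" for a using Z unfolding iid_gaussian_def by blast
  have "emeasure M G = 1" using M.emeasure_eq_1_AE[OF G] .
  then have "prob_space (restrict_space M G)"
    using G Gs by (intro prob_space_restrict_space) auto
  moreover have "(CLINT \<omega>|restrict_space M G. iexp (\<Sum>a\<in>A. blinfun_apply (l a) (Z a \<omega>)))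
      = (CLINT \<omega>|M. iexp (\<Sum>a\<in>A. blinfun_apply (l a) (Z a \<omega>)))" for A l
  proof -
    have "(CLINT \<omega>|restrict_space M G. iexp (\<Sum>a\<in>A. blinfun_apply (l a) (Z a \<omega>)))
       = (CLINT \<omega>|M. indicator G \<omega> *\<^sub>R iexp (\<Sum>a\<in>A. blinfun_apply (l a) (Z a \<omega>)))"
      using G Gs by (intro integral_restrict_space) simp
    also have "\<dots> = (CLINT \<omega>|M. iexp (\<Sum>a\<in>A. blinfun_apply (l a) (Z a \<omega>)))"
    proof (rule integral_cong_AE)
      show "AE \<omega> in M. indicator G \<omega> *\<^sub>R iexp (\<Sum>a\<in>A. blinfun_apply (l a) (Z a \<omega>)) = iexp (\<Sum>a\<in>A. blinfun_apply (l a) (Z a \<omega>))"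
        using G(2) by eventually_elim simp
    qed (use G in measurable)
    finally show ?thesis .
  qed
  ultimately show ?thesis
    using Z unfolding iid_gaussian_def by (auto intro: measurable_restrict_space1)
qed

end

section \<open>Transport to path space\<close>

text \<open>The image measure on the final \<sigma>-algebra of \<open>\<phi>\<close>: a function is
  measurable there as soon as its composition with \<open>\<phi>\<close> is. No product structure on
  path space has to be matched.\<close>

definition push :: "'p measure \<Rightarrow> ('p \<Rightarrow> 'q) \<Rightarrow> 'q measure" where
  "push M \<phi> = distr M (sigma (\<phi> ` space M) {S. S \<subseteq> \<phi> ` space M \<and> \<phi> -` S \<inter> space M \<in> sets M}) \<phi>"

lemma sigma_algebra_push:
  "sigma_algebra (\<phi> ` space M) {S. S \<subseteq> \<phi> ` space M \<and> \<phi> -` S \<inter> space M \<in> sets M}"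
proof (rule sigma_algebra_iff2[THEN iffD2], intro conjI ballI allI impI)
  fix S assume "S \<in> {S. S \<subseteq> \<phi> ` space M \<and> \<phi> -` S \<inter> space M \<in> sets M}"
  then have "space M - (\<phi> -` S \<inter> space M) \<in> sets M" by auto
  also have "space M - (\<phi> -` S \<inter> space M) = \<phi> -` (\<phi> ` space M - S) \<inter> space M" by auto
  finally show "\<phi> ` space M - S \<in> {S. S \<subseteq> \<phi> ` space M \<and> \<phi> -` S \<inter> space M \<in> sets M}" by auto
next
  fix A :: "nat \<Rightarrow> _" assume A: "range A \<subseteq> {S. S \<subseteq> \<phi> ` space M \<and> \<phi> -` S \<inter> space M \<in> sets M}"
  then have "(\<Union>i. \<phi> -` A i \<inter> space M) \<in> sets M" by (intro sets.countable_UN) auto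
  also have "(\<Union>i. \<phi> -` A i \<inter> space M) = \<phi> -` (\<Union>i. A i) \<inter> space M" by auto
  finally show "(\<Union>i. A i) \<in> {S. S \<subseteq> \<phi> ` space M \<and> \<phi> -` S \<inter> space M \<in> sets M}" using A by auto
qed auto

lemma space_push: "space (push M \<phi>) = \<phi> ` space M"
  unfolding push_def space_distr by (rule space_measure_of) auto

lemma sets_push: "sets (push M \<phi>) = {S. S \<subseteq> \<phi> ` space M \<and> \<phi> -` S \<inter> space M \<in> sets M}"
  unfolding push_def sets_distr by (rule sigma_algebra.sets_measure_of_eq[OF sigma_algebra_push])

lemma measurable_push_map: "\<phi> \<in> M \<rightarrow>\<^sub>M push M \<phi>"
  by (rule measurableI) (auto simp: space_push sets_push)

text \<open>Naming \<open>push M \<phi>\<close> itself as the target gives access to the facts on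
  image measures through \<open>measurable_push_map\<close>.\<close>

lemma push_eq_distr: "push M \<phi> = distr M (push M \<phi>) \<phi>"
proof -
  have "distr M (push M \<phi>) \<phi> = distr M (sigma (\<phi> ` space M) {S. S \<subseteq> \<phi> ` space M \<and> \<phi> -` S \<inter> space M \<in> sets M}) \<phi>"
    by (rule distr_cong) (simp_all add: push_def)
  then show ?thesis by (simp add: push_def)
qed

lemma measurable_push_iff:
  "(\<And>\<omega>. \<omega> \<in> space M \<Longrightarrow> g (\<phi> \<omega>) \<in> space N) \<Longrightarrow> (\<lambda>\<omega>. g (\<phi> \<omega>)) \<in> M \<rightarrow>\<^sub>M N \<Longrightarrow> g \<in> push M \<phi> \<rightarrow>\<^sub>M N"
proof (rule measurableI)
  fix A assume "(\<lambda>\<omega>. g (\<phi> \<omega>)) \<in> M \<rightarrow>\<^sub>M N" "A \<in> sets N"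
  then have "(\<lambda>\<omega>. g (\<phi> \<omega>)) -` A \<inter> space M \<in> sets M" by (rule measurable_sets)
  also have "(\<lambda>\<omega>. g (\<phi> \<omega>)) -` A \<inter> space M = \<phi> -` (g -` A \<inter> \<phi> ` space M) \<inter> space M" by auto
  finally show "g -` A \<inter> space (push M \<phi>) \<in> sets (push M \<phi>)" by (auto simp: space_push sets_push)
qed (auto simp: space_push)

lemma measure_push: "S \<in> sets (push M \<phi>) \<Longrightarrow> measure (push M \<phi>) S = measure M (\<phi> -` S \<inter> space M)"
  by (subst push_eq_distr) (rule measure_distr[OF measurable_push_map])

text \<open>Past and increment events on the image pull back under \<open>\<phi>\<close> to those of
  the original process, so independence is inherited along with the laws.\<close>

lemma brownian_motion_push:
  fixes Y :: "real \<Rightarrow> 'q \<Rightarrow> 'w::{banach, second_countable_topology}"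
  assumes bm: "brownian_motion \<mu> M (\<lambda>t \<omega>. Y t (\<phi> \<omega>))"
  shows "brownian_motion \<mu> (push M \<phi>) Y"
proof -
  interpret M: prob_space M using bm unfolding brownian_motion_def by blast
  have pp: "prob_space (push M \<phi>)"
    using M.prob_space_distr[OF measurable_push_map] by (simp only: push_eq_distr[symmetric])
  interpret P: prob_space "push M \<phi>" by (rule pp)
  have meas: "Y t \<in> borel_measurable (push M \<phi>)" if "0 \<le> t" for t
    using bm that unfolding brownian_motion_def by (intro measurable_push_iff) auto
  have past: "\<phi> -` C \<inter> space M \<in> past_events M (\<lambda>t \<omega>. Y t (\<phi> \<omega>)) s" if C: "C \<in> past_events (push M \<phi>) Y s" for C s
  proof -
    let ?G = "\<Union>u\<in>{0..s}. {Y u -` A \<inter> space (push M \<phi>) |A. A \<in> sets borel}"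
    have "\<phi> -` C \<inter> space M \<in> {\<phi> -` A \<inter> space M |A. A \<in> sigma_sets (space (push M \<phi>)) ?G}"
      using C unfolding past_events_def by blast
    also have "\<dots> = sigma_sets (space M) {\<phi> -` A \<inter> space M |A. A \<in> ?G}"
      by (rule sigma_sets_vimage_commute) (auto simp: space_push)
    also have "\<dots> \<subseteq> past_events M (\<lambda>t \<omega>. Y t (\<phi> \<omega>)) s"
      unfolding past_events_def
    proof (rule sigma_sets_mono', safe)
      fix u and A :: "'w set" assume u: "u \<in> {0..s}" and A: "A \<in> sets borel"
      have "\<phi> -` (Y u -` A \<inter> space (push M \<phi>)) \<inter> space M = (\<lambda>\<omega>. Y u (\<phi> \<omega>)) -` A \<inter> space M"
        by (auto simp: space_push)
      then show "\<phi> -` (Y u -` A \<inter> space (push M \<phi>)) \<inter> space M \<in> (\<Union>u\<in>{0..s}. {(\<lambda>\<omega>. Y u (\<phi> \<omega>)) -` A \<inter> space M |A. A \<in> sets borel})"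
        using u A by blast
    qed
    finally show ?thesis .
  qed
  have incr: "\<phi> -` C \<inter> space M \<in> increment_events M (\<lambda>t \<omega>. Y t (\<phi> \<omega>)) s t" if C: "C \<in> increment_events (push M \<phi>) Y s t" for C s t
  proof -
    obtain A where A: "A \<in> sets borel" "C = (\<lambda>\<omega>. Y t \<omega> - Y s \<omega>) -` A \<inter> space (push M \<phi>)"
      using C unfolding increment_events_def by auto
    have "\<phi> -` C \<inter> space M = (\<lambda>\<omega>. Y t (\<phi> \<omega>) - Y s (\<phi> \<omega>)) -` A \<inter> space M"
      by (auto simp: A(2) space_push)
    then show ?thesis using A(1) unfolding increment_events_def by (intro CollectI exI[of _ A]) simp
  qed
  show ?thesis
    unfolding brownian_motion_def
  proof (intro conjI allI impI ballI)
    show "prob_space (push M \<phi>)" by (rule pp)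
    show "Y t \<in> borel_measurable (push M \<phi>)" if "0 \<le> t" for t by (rule meas[OF that])
    show "continuous_on {0..} (\<lambda>t. Y t p)" if "p \<in> space (push M \<phi>)" for p
      using that bm unfolding brownian_motion_def space_push by auto
    fix s t :: real assume st: "0 \<le> s \<and> s < t"
    then have [measurable]: "Y s \<in> borel_measurable (push M \<phi>)" "Y t \<in> borel_measurable (push M \<phi>)"
      using meas by auto
    have "distr (push M \<phi>) borel (\<lambda>\<omega>. Y t \<omega> - Y s \<omega>) = distr (distr M (push M \<phi>) \<phi>) borel (\<lambda>\<omega>. Y t \<omega> - Y s \<omega>)"
      by (simp only: push_eq_distr[symmetric])
    also have "\<dots> = distr M borel ((\<lambda>\<omega>. Y t \<omega> - Y s \<omega>) \<circ> \<phi>)"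
      by (rule distr_distr[OF _ measurable_push_map]) measurable
    also have "\<dots> = distr \<mu> borel (\<lambda>z. sqrt (t - s) *\<^sub>R z)"
      using bm st unfolding brownian_motion_def comp_def by blast
    finally show "distr (push M \<phi>) borel (\<lambda>\<omega>. Y t \<omega> - Y s \<omega>) = distr \<mu> borel (\<lambda>z. sqrt (t - s) *\<^sub>R z)" .
    have indep: "M.indep_set (past_events M (\<lambda>t \<omega>. Y t (\<phi> \<omega>)) s) (increment_events M (\<lambda>t \<omega>. Y t (\<phi> \<omega>)) s t)"
      using bm st unfolding brownian_motion_def by blast
    show "P.indep_set (past_events (push M \<phi>) Y s) (increment_events (push M \<phi>) Y s t)"
    proof (rule P.indep_setI)
      show 1: "past_events (push M \<phi>) Y s \<subseteq> P.events"
        unfolding past_events_def using meas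
        by (intro sets.sigma_sets_subset) (auto intro!: measurable_sets)
      show 2: "increment_events (push M \<phi>) Y s t \<subseteq> P.events"
        unfolding increment_events_def by auto
      fix C D assume CD: "C \<in> past_events (push M \<phi>) Y s" "D \<in> increment_events (push M \<phi>) Y s t"
      then have ev: "C \<in> P.events" "D \<in> P.events" "C \<inter> D \<in> P.events" using 1 2 by auto
      have "P.prob (C \<inter> D) = M.prob ((\<phi> -` C \<inter> space M) \<inter> (\<phi> -` D \<inter> space M))"
        unfolding measure_push[OF ev(3)] by (rule arg_cong[where f=M.prob]) auto
      also have "\<dots> = M.prob (\<phi> -` C \<inter> space M) * M.prob (\<phi> -` D \<inter> space M)"
        using past[OF CD(1)] incr[OF CD(2)] by (rule M.indep_setD[OF indep])
      finally show "P.prob (C \<inter> D) = P.prob C * P.prob D"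
        by (simp only: measure_push ev)
    qed
  qed
qed

context orthonormal_basis
begin

lemma brownian_motion_path:
  assumes r: "\<And>n. 1 \<le> r n" and Z: "iid_gaussian M Z" and tame: "\<And>\<omega>. \<omega> \<in> space M \<Longrightarrow> tame (\<lambda>a. Z a \<omega>)"
  shows "brownian_motion \<mu> M (\<lambda>t \<omega>. b + windows.path r (\<lambda>a. Z a \<omega>) t)"
proof -
  interpret W: windows r by unfold_locales (rule r)
  interpret S: gaussian_series \<mu> e f M Z W.indices W.coeff "\<lambda>t \<omega>. W.path (\<lambda>a. Z a \<omega>) t"
    by unfold_locales
      (auto intro: Z W.finite_indices W.path_tendsto W.coeff_tendsto W.continuous_on_path tame)
  show ?thesis by (rule S.brownian_motion)
qed

text \<open>Convergence is obtained at every point because the exceptional set is cut away before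
  the transport. The event of convergence is then the whole space, and its measurability, over
  uncountably many times, is no issue.\<close>

theorem coupling:
  fixes b b' :: 'w
  shows "\<exists>(M :: 'w path_pair measure) B B'.
           brownian_motion \<mu> M B \<and> brownian_motion \<mu> M B' \<and>
           (\<forall>\<omega> \<in> space M. B 0 \<omega> = b) \<and> (\<forall>\<omega> \<in> space M. B' 0 \<omega> = b') \<and>
           (\<forall>\<omega> \<in> space M. ((\<lambda>t. norm (B t \<omega> - B' t \<omega>)) \<longlongrightarrow> 0) at_top)"
proof -
  define d where "d = b - b'"
  interpret W: windows "radius d" by unfold_locales (rule radius_ge_1)
  interpret P: prob_space noises by (rule prob_space_noises)
  have "AE \<omega> in noises. tame (\<lambda>a. snd (\<omega> a)) \<and> (\<lambda>n. gap d n \<omega>) \<longlonglongrightarrow> 0"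
    using AE_tame AE_gap_tendsto[of d] by eventually_elim simp
  then obtain N where N: "N \<in> null_sets noises" "{\<omega> \<in> space noises. \<not> (tame (\<lambda>a. snd (\<omega> a)) \<and> (\<lambda>n. gap d n \<omega>) \<longlonglongrightarrow> 0)} \<subseteq> N"
    unfolding eventually_ae_filter by blast
  define G where "G = space noises - N"
  have good: "tame (\<lambda>a. snd (\<omega> a))" "(\<lambda>n. gap d n \<omega>) \<longlonglongrightarrow> 0" if "\<omega> \<in> G" for \<omega>
    using N(2) that unfolding G_def by auto
  have G: "G \<in> sets noises" "AE \<omega> in noises. \<omega> \<in> G"
    using sets.Diff[OF sets.top null_setsD2[OF N(1)]] AE_not_in[OF N(1)] unfolding G_def by auto
  define M where "M = restrict_space noises G"
  have sM: "space M = G" using G(1) by (simp add: M_def space_restrict_space)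
  define z where "z \<omega> a = snd (\<omega> a)" for \<omega> :: "nat \<times> nat \<times> nat \<Rightarrow> real \<times> 'w" and a
  define z' where "z' \<omega> a = partner d a \<omega>" for \<omega> a
  have eq: "z \<omega> (i, Suc n, j) = z' \<omega> (i, Suc n, j)" for \<omega> i n j
    by (simp add: z_def z'_def partner_def)
  have tz: "tame (z \<omega>)" if "\<omega> \<in> space M" for \<omega>
    using good(1) that sM by (simp add: z_def[abs_def])
  \<comment> \<open>Tameness concerns the levels from 1 on, where the two families coincide.\<close>
  then have tz': "tame (z' \<omega>)" if "\<omega> \<in> space M" for \<omega>
    using that unfolding tame_def eq .
  define \<phi> where "\<phi> \<omega> t = (b + W.path (z \<omega>) t, b' + W.path (z' \<omega>) t)" for \<omega> t
  have "iid_gaussian M (\<lambda>a \<omega>. z \<omega> a)"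
    unfolding M_def z_def by (rule iid_gaussian_restrict[OF iid_gaussian_noises G])
  then have B: "brownian_motion \<mu> M (\<lambda>t \<omega>. b + W.path (z \<omega>) t)"
    using brownian_motion_path[OF radius_ge_1[of d], of M "\<lambda>a \<omega>. z \<omega> a" b] tz by simp
  have "iid_gaussian M (\<lambda>a \<omega>. z' \<omega> a)"
    unfolding M_def z'_def by (rule iid_gaussian_restrict[OF iid_gaussian_partner G])
  then have B': "brownian_motion \<mu> M (\<lambda>t \<omega>. b' + W.path (z' \<omega>) t)"
    using brownian_motion_path[OF radius_ge_1[of d], of M "\<lambda>a \<omega>. z' \<omega> a" b'] tz' by simp
  have lim: "((\<lambda>t. norm (fst (\<phi> \<omega> t) - snd (\<phi> \<omega> t))) \<longlongrightarrow> 0) at_top" if \<omega>: "\<omega> \<in> space M" for \<omega>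
  proof -
    have "((\<lambda>t. norm (gap d 0 \<omega> + W.path (z \<omega>) t - W.path (z' \<omega>) t)) \<longlongrightarrow> 0) at_top"
    proof (rule W.path_difference_tendsto[OF tz[OF \<omega>] tz'[OF \<omega>] eq])
      show "gap d (Suc n) \<omega> = gap d n \<omega> + radius d n *\<^sub>R (z \<omega> (n, 0, 0) - z' \<omega> (n, 0, 0))" for n
        unfolding gap_Suc z_def z'_def ..
      show "(\<lambda>n. gap d n \<omega>) \<longlonglongrightarrow> 0" using good(2) \<omega> sM by simp
    qed
    moreover have "fst (\<phi> \<omega> t) - snd (\<phi> \<omega> t) = gap d 0 \<omega> + W.path (z \<omega>) t - W.path (z' \<omega>) t" for t
      by (simp add: \<phi>_def d_def)
    ultimately show ?thesis by simp
  qed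
  show ?thesis
  proof (rule exI[of _ "push M \<phi>"], rule exI[of _ "\<lambda>t p. fst (p t)"], rule exI[of _ "\<lambda>t p. snd (p t)"], intro conjI ballI)
    show "brownian_motion \<mu> (push M \<phi>) (\<lambda>t p. fst (p t))"
      by (rule brownian_motion_push) (use B in \<open>simp add: \<phi>_def\<close>)
    show "brownian_motion \<mu> (push M \<phi>) (\<lambda>t p. snd (p t))"
      by (rule brownian_motion_push) (use B' in \<open>simp add: \<phi>_def\<close>)
  qed (use lim in \<open>auto simp: space_push \<phi>_def\<close>)
qed

end

theorem theorem13:
  fixes \<mu> :: "'w::{banach, second_countable_topology} measure"
    and e :: "nat \<Rightarrow> 'w"
    and b b' :: 'w
  assumes "centered_gaussian_measure \<mu>"
    and "nondegenerate_gaussian \<mu>"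
    and "schauder_basis e"
    and "cm_orthonormal_basis \<mu> e"
  shows "\<exists>(M :: 'w path_pair measure) B B'.
           brownian_motion \<mu> M B \<and> brownian_motion \<mu> M B' \<and>
           (\<forall>\<omega> \<in> space M. B 0 \<omega> = b) \<and> (\<forall>\<omega> \<in> space M. B' 0 \<omega> = b') \<and>
           \<P>(\<omega> in M. ((\<lambda>t. norm (B t \<omega> - B' t \<omega>)) \<longlongrightarrow> 0) at_top) = 1"
proof -
  obtain f :: "nat \<Rightarrow> 'w \<Rightarrow>\<^sub>L real" where f: "\<And>x. (\<lambda>k. f k x *\<^sub>R e k) sums x"
    "\<And>j k. f j (e k) = (if j = k then 1 else 0)"
    using schauder_basis_functionals[OF assms(3)] by blast
  interpret gaussian_basis \<mu> e f
    using assms(1,2) f by unfold_locales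
  interpret orthonormal_basis \<mu> e f
    by unfold_locales (rule Cov_coordinate[OF assms(4)])
  obtain M :: "'w path_pair measure" and B B' where M: "brownian_motion \<mu> M B" "brownian_motion \<mu> M B'"
      "\<forall>\<omega> \<in> space M. B 0 \<omega> = b" "\<forall>\<omega> \<in> space M. B' 0 \<omega> = b'"
    and lim: "\<forall>\<omega> \<in> space M. ((\<lambda>t. norm (B t \<omega> - B' t \<omega>)) \<longlongrightarrow> 0) at_top"
    using coupling[of b b'] by blast
  have "{\<omega> \<in> space M. ((\<lambda>t. norm (B t \<omega> - B' t \<omega>)) \<longlongrightarrow> 0) at_top} = space M" using lim by blast
  moreover have "prob_space M" using M(1) unfolding brownian_motion_def by blast
  ultimately have "\<P>(\<omega> in M. ((\<lambda>t. norm (B t \<omega> - B' t \<omega>)) \<longlongrightarrow> 0) at_top) = 1"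
    using prob_space.prob_space by metis
  then show ?thesis using M by blast
qed

end
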